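(* Let $N\geq 3$ and let $\Omega\subset\mathbb{R}^N$ be a bounded domain with smooth boundary. Assume that $p,q>1$, $p+q<N$, $p+q<r$ and $r<\frac{Np-N+p}{N-p}$. Then there exists $\lambda_\star>0$ such that for any $\lambda\geq\lambda_\star$ the problem $$-\mathrm{div}\big(\log(1+|\nabla u(x)|^q)|\nabla u(x)|^{p-2}\nabla u(x)\big)=\lambda|u(x)|^{p-2}u(x)-|u(x)|^{r-2}u(x)\ \text{ for } x\in\Omega,\qquad u(x)=0\ \text{ for } x\in\partial\Omega,$$ has a nontrivial weak solution in $W_0^1L_\Phi(\Omega)$.
   Context: All functions are real-valued. For $t\in\mathbb{R}$ define $\phi(t)=\log(1+|t|^q)\,|t|^{p-2}t$ and $\Phi(t)=\int_0^t\phi(s)\,ds$ ($\Phi$ is even, convex, and increasing on $[0,\infty)$). The Orlicz class is $K_\Phi(\Omega)=\{u:\Omega\to\mathbb{R}\text{ measurable}:\int_\Omega\Phi(|u(x)|)\,dx<\infty\}$ and the Orlicz space $L_\Phi(\Omega)$ is the linear hull of $K_\Phi(\Omega)$, a Banach space with the Luxemburg norm $\|u\|_\Phi=\inf\{k>0:\int_\Omega\Phi(u(x)/k)\,dx\leq 1\}$. The Orlicz-Sobolev space is $W^1L_\Phi(\Omega)=\{u\in L_\Phi(\Omega):\partial u/\partial x_i\in L_\Phi(\Omega),\ i=1,\dots,N\}$ (weak derivatives), with norm $\|u\|_{1,\Phi}=\|u\|_\Phi+\||\nabla u|\|_\Phi$, and $W_0^1L_\Phi(\Omega)$ is the closure of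 $C_0^\infty(\Omega)$ in $W^1L_\Phi(\Omega)$. A weak solution of the problem is a function $u\in W_0^1L_\Phi(\Omega)$ such that $$\int_\Omega\log(1+|\nabla u|^q)|\nabla u|^{p-2}\nabla u\cdot\nabla v\,dx-\lambda\int_\Omega|u|^{p-2}uv\,dx+\int_\Omega|u|^{r-2}uv\,dx=0$$ for all $v\in W_0^1L_\Phi(\Omega)$. Nontrivial means not (almost everywhere) identically zero. *)

theory Defs
  imports "HOL-Analysis.Analysis"
begin

section \<open>Smooth functions and domains with smooth boundary\<close>

definition partial :: "'n::finite \<Rightarrow> (real^'n \<Rightarrow> real) \<Rightarrow> real^'n \<Rightarrow> real" where
  "partial i f x = frechet_derivative f (at x) (axis i 1)"

text \<open>Only meant for open \<open>S\<close>: derivatives are taken in the full space.\<close>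

primrec Ck_on :: "nat \<Rightarrow> (real^'n::finite) set \<Rightarrow> (real^'n \<Rightarrow> real) \<Rightarrow> bool" where
  "Ck_on 0 S f \<longleftrightarrow> continuous_on S f"
| "Ck_on (Suc k) S f \<longleftrightarrow> (\<forall>x\<in>S. f differentiable (at x)) \<and> (\<forall>i. Ck_on k S (partial i f))"

definition smooth_on :: "(real^'n::finite) set \<Rightarrow> (real^'n \<Rightarrow> real) \<Rightarrow> bool" where
  "smooth_on S f \<longleftrightarrow> (\<forall>k. Ck_on k S f)"

text \<open>Near every boundary point, \<open>\<Omega>\<close> is the negativity set of a smooth function
  with nonvanishing gradient; thus \<open>\<Omega>\<close> lies locally on one side of its boundary.\<close>

definition smooth_boundary :: "(real^'n::finite) set \<Rightarrow> bool" where
  "smooth_boundary \<Omega> \<longleftrightarrow>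
     (\<forall>x0\<in>frontier \<Omega>. \<exists>U \<rho>. open U \<and> x0 \<in> U \<and> smooth_on U \<rho> \<and>
        (\<forall>x\<in>U. \<exists>i. partial i \<rho> x \<noteq> 0) \<and> \<Omega> \<inter> U = {x\<in>U. \<rho> x < 0})"

text \<open>The space \<open>C\<^sub>0\<^sup>\<infinity>(\<Omega>)\<close>, its elements being extended by zero.\<close>

definition test_functions :: "(real^'n::finite) set \<Rightarrow> (real^'n \<Rightarrow> real) set" where
  "test_functions \<Omega> =
     {\<psi>. smooth_on UNIV \<psi> \<and> compact (closure {x. \<psi> x \<noteq> 0}) \<and> closure {x. \<psi> x \<noteq> 0} \<subseteq> \<Omega>}"

section \<open>Weak derivatives\<close>

definition locally_integrable :: "(real^'n::finite) set \<Rightarrow> (real^'n \<Rightarrow> real) \<Rightarrow> bool" where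
  "locally_integrable \<Omega> u \<longleftrightarrow>
     (\<forall>K. compact K \<and> K \<subseteq> \<Omega> \<longrightarrow> integrable (lebesgue_on K) u)"

definition has_weak_partial ::
  "(real^'n::finite) set \<Rightarrow> 'n \<Rightarrow> (real^'n \<Rightarrow> real) \<Rightarrow> (real^'n \<Rightarrow> real) \<Rightarrow> bool" where
  "has_weak_partial \<Omega> i u g \<longleftrightarrow>
     locally_integrable \<Omega> u \<and> locally_integrable \<Omega> g \<and>
     (\<forall>\<psi>\<in>test_functions \<Omega>.
        (LINT x|lebesgue_on \<Omega>. u x * partial i \<psi> x) = - (LINT x|lebesgue_on \<Omega>. g x * \<psi> x))"

text \<open>Weak derivatives are unique only almost everywhere in \<open>\<Omega>\<close>; a representative is chosen.
  It is meaningful only where a weak derivative exists.\<close>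

definition weak_partial ::
  "(real^'n::finite) set \<Rightarrow> 'n \<Rightarrow> (real^'n \<Rightarrow> real) \<Rightarrow> real^'n \<Rightarrow> real" where
  "weak_partial \<Omega> i u = (SOME g. has_weak_partial \<Omega> i u g)"

definition weak_grad ::
  "(real^'n::finite) set \<Rightarrow> (real^'n \<Rightarrow> real) \<Rightarrow> real^'n \<Rightarrow> real^'n" where
  "weak_grad \<Omega> u x = (\<chi> i. weak_partial \<Omega> i u x)"

section \<open>Orlicz and Orlicz-Sobolev spaces\<close>

text \<open>Functions are defined on the whole space, but only their values on \<open>\<Omega>\<close> matter, and they
  are not identified when equal almost everywhere. Integrals of the nonnegative \<open>\<Phi>\<close> are
  extended-real valued, since the Bochner integral of a non-integrable function is 0.\<close>

definition orlicz_class ::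
  "(real \<Rightarrow> real) \<Rightarrow> (real^'n::finite) set \<Rightarrow> (real^'n \<Rightarrow> real) set" where
  "orlicz_class \<Phi> \<Omega> =
     {u \<in> borel_measurable (lebesgue_on \<Omega>).
        (\<integral>\<^sup>+x. ennreal (\<Phi> \<bar>u x\<bar>) \<partial>lebesgue_on \<Omega>) < \<infinity>}"

text \<open>The linear hull, written out as finite linear combinations.\<close>

definition orlicz_space ::
  "(real \<Rightarrow> real) \<Rightarrow> (real^'n::finite) set \<Rightarrow> (real^'n \<Rightarrow> real) set" where
  "orlicz_space \<Phi> \<Omega> =
     {\<lambda>x. \<Sum>v\<in>F. c v * v x | F c. finite F \<and> F \<subseteq> orlicz_class \<Phi> \<Omega>}"

definition luxemburg_norm ::
  "(real \<Rightarrow> real) \<Rightarrow> (real^'n::finite) set \<Rightarrow> (real^'n \<Rightarrow> real) \<Rightarrow> real" where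
  "luxemburg_norm \<Phi> \<Omega> u =
     Inf {k. k > 0 \<and> (\<integral>\<^sup>+x. ennreal (\<Phi> (u x / k)) \<partial>lebesgue_on \<Omega>) \<le> 1}"

definition orlicz_sobolev ::
  "(real \<Rightarrow> real) \<Rightarrow> (real^'n::finite) set \<Rightarrow> (real^'n \<Rightarrow> real) set" where
  "orlicz_sobolev \<Phi> \<Omega> =
     {u \<in> orlicz_space \<Phi> \<Omega>. \<forall>i. \<exists>g\<in>orlicz_space \<Phi> \<Omega>. has_weak_partial \<Omega> i u g}"

definition orlicz_sobolev_norm ::
  "(real \<Rightarrow> real) \<Rightarrow> (real^'n::finite) set \<Rightarrow> (real^'n \<Rightarrow> real) \<Rightarrow> real" where
  "orlicz_sobolev_norm \<Phi> \<Omega> u =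
     luxemburg_norm \<Phi> \<Omega> u + luxemburg_norm \<Phi> \<Omega> (\<lambda>x. norm (weak_grad \<Omega> u x))"

definition orlicz_sobolev0 ::
  "(real \<Rightarrow> real) \<Rightarrow> (real^'n::finite) set \<Rightarrow> (real^'n \<Rightarrow> real) set" where
  "orlicz_sobolev0 \<Phi> \<Omega> =
     {u \<in> orlicz_sobolev \<Phi> \<Omega>.
        \<forall>e>0. \<exists>\<psi>\<in>test_functions \<Omega>. orlicz_sobolev_norm \<Phi> \<Omega> (\<lambda>x. u x - \<psi> x) < e}"

section \<open>The boundary value problem\<close>

definition phi :: "real \<Rightarrow> real \<Rightarrow> real \<Rightarrow> real" where
  "phi p q t = ln (1 + \<bar>t\<bar> powr q) * \<bar>t\<bar> powr (p - 2) * t"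

definition Phi :: "real \<Rightarrow> real \<Rightarrow> real \<Rightarrow> real" where
  "Phi p q t = (LBINT s=0..t. phi p q s)"

text \<open>Integrability of each integrand is part of the definition, so that the identity never
  rests on the value 0 that the integral assigns to non-integrable functions.\<close>

definition weak_solution ::
  "real \<Rightarrow> real \<Rightarrow> real \<Rightarrow> real \<Rightarrow> (real^'n::finite) set \<Rightarrow> (real^'n \<Rightarrow> real) \<Rightarrow> bool" where
  "weak_solution p q r lam \<Omega> u \<longleftrightarrow>
     u \<in> orlicz_sobolev0 (Phi p q) \<Omega> \<and>
     (\<forall>v \<in> orlicz_sobolev0 (Phi p q) \<Omega>.
        let A = (\<lambda>x. (ln (1 + norm (weak_grad \<Omega> u x) powr q) * norm (weak_grad \<Omega> u x) powr (p - 2))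
                     *\<^sub>R weak_grad \<Omega> u x \<bullet> weak_grad \<Omega> v x);
            B = (\<lambda>x. \<bar>u x\<bar> powr (p - 2) * u x * v x);
            C = (\<lambda>x. \<bar>u x\<bar> powr (r - 2) * u x * v x)
        in integrable (lebesgue_on \<Omega>) A \<and> integrable (lebesgue_on \<Omega>) B \<and>
           integrable (lebesgue_on \<Omega>) C \<and>
           (LINT x|lebesgue_on \<Omega>. A x) - lam * (LINT x|lebesgue_on \<Omega>. B x)
             + (LINT x|lebesgue_on \<Omega>. C x) = 0)"

end

theory Submission imports Defs begin

text \<open>
  The solution minimizes the energy
  \<open>\<integral> \<Phi>(|\<nabla>u|) - (lam/p) \<integral> |u|^p + (1/r) \<integral> |u|^r\<close>, whose infimum over test functions is negative for large
  \<open>lam\<close>. Neither a Sobolev embedding nor weak compactness is needed. A smooth truncation lowers the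
  energy, hence there is a minimizing sequence of nonnegative functions with a common bound. Since
  \<open>\<Phi>(t)\<close> is a convex increasing function of \<open>t^p\<close>, the energy is convex along the paths on which
  \<open>u^p\<close> is affine (hidden convexity), strictly so because \<open>r > p\<close>; this makes the sequence Cauchy
  in \<open>L^1\<close>. Comparison with ordinary midpoints and the uniform convexity of \<open>\<Phi>(|\<xi>|)\<close> then make the gradients Cauchy in
  the modular. The limit is bounded, so that all terms of the weak formulation are finite, and
  convexity inequalities give the Euler-Lagrange equation.
\<close>

section \<open>The Young function\<close>

text \<open>The obstacle is the concave term with \<open>lam\<close>: the energy is not convex, so
  ordinary midpoints alone do not force a minimizing sequence to converge. Taking the infimum over
  test functions keeps every competitor smooth and every chain rule classical; the price is that
  truncation and the p-th power mean have to be replaced by smooth maps that preserve the value 0,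
  and that their exact versions are recovered only in a limit. Weak derivatives enter only through
  the limit function and the admissible directions. Convexity in \<open>t powr p\<close> comes from
  the factorization \<open>\<phi> t = L t * t powr (p - 1)\<close> with \<open>L\<close> increasing.
  The growth bound \<open>\<Phi> (c * t) \<le> c powr (p + q) * \<Phi> t\<close> for
  \<open>c \<ge> 1\<close> makes modular and norm convergence interchangeable, so estimates are made
  with integrals of \<Phi>, and the Luxemburg norm appears only when the definitions are translated.
  The threshold for \<open>lam\<close> is the value from which on one fixed test function has energy
  at most -1.\<close>

lemma DERIV_sign_change_imp_le:
  fixes h h' :: "real \<Rightarrow> real"
  assumes st: "s \<ge> 0" "t \<ge> 0" and c: "continuous_on {0..} h"
    and d: "\<And>x. x > 0 \<Longrightarrow> (h has_real_derivative h' x) (at x)"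
    and sgn: "\<And>x. 0 < x \<Longrightarrow> x \<le> s \<Longrightarrow> h' x \<le> 0" "\<And>x. s \<le> x \<Longrightarrow> 0 \<le> h' x"
  shows "h s \<le> h t"
proof -
  have c': "continuous_on {a..b} h" if "a \<ge> 0" for a b
    by (rule continuous_on_subset[OF c]) (use that in auto)
  show ?thesis
  proof (cases "s \<le> t")
    case True
    show ?thesis
    proof (rule DERIV_nonneg_imp_increasing_open[OF True _ c'[OF st(1)]])
      fix x assume x: "s < x" "x < t"
      then show "\<exists>y. (h has_real_derivative y) (at x) \<and> 0 \<le> y"
        using d[of x] sgn(2)[of x] st by (intro exI[of _ "h' x"]) auto
    qed
  next
    case False
    show ?thesis
    proof (rule DERIV_nonpos_imp_decreasing_open[OF _ _ c'[OF st(2)]])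
      fix x assume x: "t < x" "x < s"
      then show "\<exists>y. (h has_real_derivative y) (at x) \<and> y \<le> 0"
        using d[of x] sgn(1)[of x] st by (intro exI[of _ "h' x"]) auto
    qed (use False in simp)
  qed
qed

text \<open>The function minus its tangent line has a derivative that changes sign from minus to
  plus at \<open>s\<close>. At \<open>s = 0\<close> the slope is 0, even for \<open>p = 1\<close>,
  because \<open>0 powr a = 0\<close>.\<close>

lemma powr_ge_tangent:
  fixes s t p :: real
  assumes "p \<ge> 1" "s \<ge> 0" "t \<ge> 0"
  shows "t powr p \<ge> s powr p + p * s powr (p - 1) * (t - s)"
proof -
  let ?h = "\<lambda>x. x powr p - p * s powr (p - 1) * x"
  have "?h s \<le> ?h t"
  proof (rule DERIV_sign_change_imp_le[where h = ?h and h' = "\<lambda>x. p * (x powr (p - 1) - s powr (p - 1))"])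
    show "continuous_on {0..} ?h"
      using assms by (intro continuous_intros continuous_on_powr') auto
    show "(?h has_real_derivative p * (x powr (p-1) - s powr (p-1))) (at x)" if "x > 0" for x
      using that by (auto intro!: derivative_eq_intros simp: algebra_simps)
  qed (use assms in \<open>auto intro!: mult_nonneg_nonneg mult_nonneg_nonpos powr_mono2\<close>)
  then show ?thesis by (simp add: algebra_simps)
qed

text \<open>Bernoulli's inequality, which is the tangent inequality at 1, followed by the logarithm.
  It limits how fast the logarithmic factor grows under dilation.\<close>

lemma ln_one_plus_mult_le:
  fixes c x :: real
  assumes "c \<ge> 1" "x \<ge> 0"
  shows "ln (1 + c * x) \<le> c * ln (1 + x)"
proof -
  have "1 + c * x \<le> (1 + x) powr c"
    using powr_ge_tangent[of c 1 "1 + x"] assms by simp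
  then have "ln (1 + c * x) \<le> ln ((1 + x) powr c)"
    using assms by (subst ln_le_cancel_iff) (auto intro: add_pos_nonneg)
  then show ?thesis using assms by (simp add: ln_powr)
qed

locale log_orlicz =
  fixes p q :: real
  assumes p_gt_1: "p > 1" and q_gt_1: "q > 1"
begin

abbreviation \<phi> where "\<phi> \<equiv> phi p q"
abbreviation \<Phi> where "\<Phi> \<equiv> Phi p q"

text \<open>Up to the factor \<open>1 / p\<close>, the derivative of \<open>\<Phi>\<close> with
  respect to \<open>t powr p\<close>.\<close>

definition L :: "real \<Rightarrow> real" where "L t = ln (1 + t powr q)"

lemma L_nonneg: "0 \<le> L t" unfolding L_def by simp
lemma L_pos: "t > 0 \<Longrightarrow> 0 < L t" unfolding L_def by (simp add: add_pos_nonneg)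
lemma L_mono: "0 \<le> s \<Longrightarrow> s \<le> t \<Longrightarrow> L s \<le> L t"
  unfolding L_def using q_gt_1 by (simp add: add_pos_nonneg powr_mono2)

lemma continuous_on_L: "continuous_on {0..} L"
  unfolding L_def using q_gt_1
  by (intro continuous_intros continuous_on_powr') (auto simp: add_nonneg_eq_0_iff)

lemma phi_eq: "t \<ge> 0 \<Longrightarrow> \<phi> t = L t * t powr (p - 1)"
  using powr_mult_base[of t "p - 2"] unfolding phi_def L_def by (simp add: mult_ac)

lemma phi_nonneg: "t \<ge> 0 \<Longrightarrow> 0 \<le> \<phi> t" by (simp add: phi_eq L_nonneg)
lemma phi_pos: "t > 0 \<Longrightarrow> 0 < \<phi> t" by (simp add: phi_eq L_pos)
lemma phi_0 [simp]: "\<phi> 0 = 0" by (simp add: phi_def)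

lemma phi_mono: "0 \<le> s \<Longrightarrow> s \<le> t \<Longrightarrow> \<phi> s \<le> \<phi> t"
  using p_gt_1 by (simp add: phi_eq L_nonneg L_mono mult_mono powr_mono2)

lemma continuous_on_phi: "continuous_on {0..} \<phi>"
proof -
  have "continuous_on {0..} (\<lambda>t. L t * t powr (p - 1))"
    using p_gt_1 by (intro continuous_intros continuous_on_L continuous_on_powr') auto
  then show ?thesis by (rule continuous_on_eq) (simp add: phi_eq)
qed

lemma phi_minus: "\<phi> (- t) = - \<phi> t" by (simp add: phi_def)

lemma Phi_0 [simp]: "\<Phi> 0 = 0" by (simp add: Phi_def zero_ereal_def)

lemma Phi_minus [simp]: "\<Phi> (- t) = \<Phi> t"
proof -
  have "\<Phi> (- t) = - (LBINT s=ereal (- t)..ereal 0. \<phi> s)"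
    unfolding Phi_def by (subst interval_integral_endpoints_reverse) (simp add: zero_ereal_def)
  also have "(LBINT s=ereal (- t)..ereal 0. \<phi> s) = (LBINT s=ereal 0..ereal t. \<phi> (- s))"
    by (subst interval_integral_reflect) simp
  also have "\<dots> = - \<Phi> t"
    unfolding Phi_def by (simp add: phi_minus zero_ereal_def interval_lebesgue_integral_uminus)
  finally show ?thesis by simp
qed

lemma Phi_abs [simp]: "\<Phi> \<bar>t\<bar> = \<Phi> t"
  by (cases "t \<ge> 0") auto

lemma Phi_deriv_within:
  assumes "0 \<le> t" "t \<le> b"
  shows "(\<Phi> has_real_derivative \<phi> t) (at t within {0..b})"
proof -
  have "continuous_on {0..b} \<phi>"
    by (rule continuous_on_subset[OF continuous_on_phi]) auto
  from interval_integral_FTC2[of 0 0 b \<phi> t, OF _ _ this] assms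
  show ?thesis
    unfolding Phi_def by (simp add: has_real_derivative_iff_has_vector_derivative zero_ereal_def)
qed

lemma Phi_deriv: "t > 0 \<Longrightarrow> (\<Phi> has_real_derivative \<phi> t) (at t)"
  using Phi_deriv_within[of t "t + 1"] at_within_interior[of t "{0..t+1}"] by simp

lemma continuous_on_Phi: "continuous_on {0..} \<Phi>"
proof -
  have "continuous (at t within {0..}) \<Phi>" if "t \<ge> 0" for t
  proof -
    have "continuous (at t within {0..t+1}) \<Phi>"
      using Phi_deriv_within[of t "t+1"] that
      by (intro DERIV_continuous) auto
    moreover have "at t within {0..t+1} = at t within {0..}"
      by (rule at_within_nhd[of _ "{..<t+1}"]) (use that in auto)
    ultimately show ?thesis by simp
  qed
  then show ?thesis by (simp add: continuous_on_eq_continuous_within)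
qed

lemma continuous_on_Phi_UNIV: "continuous_on UNIV \<Phi>"
proof -
  have "continuous_on UNIV (\<Phi> \<circ> abs)"
    by (intro continuous_on_compose continuous_intros continuous_on_subset[OF continuous_on_Phi]) auto
  then show ?thesis by (rule continuous_on_eq) auto
qed

text \<open>As a function of \<open>t powr p\<close>, \<open>\<Phi>\<close> has the increasing
  derivative \<open>L / p\<close>; this is the tangent inequality in that variable. Both ordinary
  and hidden convexity are drawn from it.\<close>

lemma Phi_ge_powr_tangent:
  assumes "s \<ge> 0" "t \<ge> 0"
  shows "\<Phi> t \<ge> \<Phi> s + L s / p * (t powr p - s powr p)"
proof -
  let ?h = "\<lambda>x. \<Phi> x - L s / p * x powr p"
  have "?h s \<le> ?h t"
  proof (rule DERIV_sign_change_imp_le[where h = ?h and h' = "\<lambda>x. (L x - L s) * x powr (p - 1)"])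
    show "continuous_on {0..} ?h"
      using p_gt_1 by (intro continuous_intros continuous_on_powr' continuous_on_Phi) auto
    show "(?h has_real_derivative (L x - L s) * x powr (p-1)) (at x)" if "x > 0" for x
      using that p_gt_1 by (auto intro!: derivative_eq_intros Phi_deriv simp: algebra_simps phi_eq)
  qed (use assms in \<open>auto intro!: mult_nonneg_nonneg mult_nonpos_nonneg L_mono\<close>)
  then show ?thesis by (simp add: algebra_simps)
qed

lemma Phi_ge_tangent:
  assumes "s \<ge> 0" "t \<ge> 0"
  shows "\<Phi> t \<ge> \<Phi> s + \<phi> s * (t - s)"
proof -
  have "\<phi> s * (t - s) = L s / p * (p * s powr (p - 1) * (t - s))"
    using p_gt_1 assms by (simp add: phi_eq)
  also have "\<dots> \<le> L s / p * (t powr p - s powr p)"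
    using powr_ge_tangent[of p s t] assms p_gt_1 L_nonneg[of s]
    by (intro mult_left_mono) auto
  finally show ?thesis using Phi_ge_powr_tangent[OF assms] by simp
qed

lemma Phi_nonneg [simp]: "0 \<le> \<Phi> t"
  using Phi_ge_tangent[of 0 "\<bar>t\<bar>"] by simp

lemma Phi_mono: "0 \<le> s \<Longrightarrow> s \<le> t \<Longrightarrow> \<Phi> s \<le> \<Phi> t"
  using Phi_ge_tangent[of s t] phi_nonneg[of s] by (smt (verit) mult_nonneg_nonneg)

lemma Phi_mono_abs: "\<bar>s\<bar> \<le> \<bar>t\<bar> \<Longrightarrow> \<Phi> s \<le> \<Phi> t"
  using Phi_mono[of "\<bar>s\<bar>" "\<bar>t\<bar>"] by simp

text \<open>For positive \<open>d\<close> this reads \<open>t \<le> d + \<Phi> t / \<phi> d\<close>: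
  modular bounds become \<open>L^1\<close> bounds up to an arbitrarily small constant.\<close>

lemma Phi_ge_linear: "d \<ge> 0 \<Longrightarrow> t \<ge> 0 \<Longrightarrow> \<phi> d * (t - d) \<le> \<Phi> t"
  using Phi_ge_tangent[of d t] Phi_nonneg[of d] by linarith

text \<open>A quantitative \<Delta>_2 condition. Comparing derivatives, the power contributes
  \<open>c powr p\<close> and the logarithm at most \<open>c powr q\<close>.\<close>

lemma Phi_scale:
  assumes "c \<ge> 1"
  shows "\<Phi> (c * t) \<le> c powr (p + q) * \<Phi> t"
proof -
  have nn: "\<Phi> (c * t) \<le> c powr (p + q) * \<Phi> t" if t: "t \<ge> 0" for t
  proof -
    let ?h = "\<lambda>x. c powr (p + q) * \<Phi> x - \<Phi> (c * x)"
    have dh: "(?h has_real_derivative c powr (p+q) * \<phi> x - \<phi> (c * x) * c) (at x)" if "x > 0" for x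
      using that assms
      by (auto intro!: derivative_eq_intros Phi_deriv DERIV_chain'[where f="\<lambda>x. c * x" and g=\<Phi>])
    have c: "continuous_on {0..t} ?h"
      using assms by (intro continuous_intros continuous_on_subset[OF continuous_on_Phi]
         continuous_on_compose2[OF continuous_on_Phi]) auto
    have "?h 0 \<le> ?h t"
    proof (rule DERIV_nonneg_imp_increasing_open[OF t _ c])
      fix x assume x: "0 < x" "x < t"
      have "L (c * x) \<le> c powr q * L x"
        unfolding L_def using x assms q_gt_1 ln_one_plus_mult_le[of "c powr q" "x powr q"]
        by (simp add: powr_mult ge_one_powr_ge_zero)
      then have "\<phi> (c * x) * c \<le> (c powr q * L x) * (c powr (p-1) * x powr (p-1)) * c"
        using x assms by (simp add: phi_eq powr_mult mult_right_mono)
      also have "\<dots> = c powr (p + q) * \<phi> x"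
        using x assms by (simp add: phi_eq powr_add powr_diff)
      finally show "\<exists>y. DERIV ?h x :> y \<and> 0 \<le> y" using dh[OF x(1)] by auto
    qed
    then show ?thesis by simp
  qed
  have "\<Phi> (c * t) = \<Phi> (c * \<bar>t\<bar>)" using assms by (metis Phi_abs abs_mult abs_of_nonneg order.trans zero_le_one abs_abs)
  then show ?thesis using nn[of "\<bar>t\<bar>"] by simp
qed

text \<open>Convexity on the segment from 0 to \<open>t\<close>: the tangent inequalities at
  \<open>k * \<bar>t\<bar>\<close>, evaluated at \<open>\<bar>t\<bar>\<close> and at 0, are averaged
  with weights \<open>k\<close> and \<open>1 - k\<close>, and the linear terms cancel.\<close>

lemma Phi_contract:
  assumes "0 \<le> k" "k \<le> 1"
  shows "\<Phi> (k * t) \<le> k * \<Phi> t"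
proof -
  have a: "k * \<bar>t\<bar> \<ge> 0" using assms by simp
  have 1: "\<Phi> \<bar>t\<bar> \<ge> \<Phi> (k * \<bar>t\<bar>) + \<phi> (k * \<bar>t\<bar>) * (\<bar>t\<bar> - k * \<bar>t\<bar>)"
    using Phi_ge_tangent[OF a, of "\<bar>t\<bar>"] by simp
  have 2: "0 \<ge> \<Phi> (k * \<bar>t\<bar>) + \<phi> (k * \<bar>t\<bar>) * (0 - k * \<bar>t\<bar>)"
    using Phi_ge_tangent[OF a, of 0] by simp
  have "k * \<Phi> \<bar>t\<bar> + (1 - k) * 0 \<ge> k * (\<Phi> (k * \<bar>t\<bar>) + \<phi> (k * \<bar>t\<bar>) * (\<bar>t\<bar> - k * \<bar>t\<bar>))
      + (1 - k) * (\<Phi> (k * \<bar>t\<bar>) + \<phi> (k * \<bar>t\<bar>) * (0 - k * \<bar>t\<bar>))"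
    using 1 2 assms by (intro add_mono mult_left_mono) auto
  then have "\<Phi> (k * \<bar>t\<bar>) \<le> k * \<Phi> \<bar>t\<bar>" by (simp add: algebra_simps)
  moreover have "\<Phi> (k * \<bar>t\<bar>) = \<Phi> (k * t)" using assms by (metis Phi_abs abs_mult abs_of_nonneg)
  ultimately show ?thesis by simp
qed

lemma Phi_add: "\<Phi> (s + t) \<le> 2 powr (p + q) * (\<Phi> s + \<Phi> t)"
proof -
  have "\<Phi> (s + t) \<le> \<Phi> (2 * max \<bar>s\<bar> \<bar>t\<bar>)" by (rule Phi_mono_abs) auto
  also have "\<dots> \<le> 2 powr (p + q) * \<Phi> (max \<bar>s\<bar> \<bar>t\<bar>)" by (rule Phi_scale) simp
  also have "\<Phi> (max \<bar>s\<bar> \<bar>t\<bar>) \<le> \<Phi> s + \<Phi> t" by (auto simp: max_def)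
  finally show ?thesis by simp
qed

lemma phi_mult_le: "t \<ge> 0 \<Longrightarrow> \<phi> t * t \<le> 2 powr (p + q) * \<Phi> t"
proof -
  assume "t \<ge> 0"
  then have "\<Phi> t + \<phi> t * t \<le> \<Phi> (2 * t)" using Phi_ge_tangent[of t "2 * t"] by simp
  then show ?thesis using Phi_scale[of 2 t] Phi_nonneg[of t] by linarith
qed

text \<open>A quantitative Young inequality that replaces duality with the conjugate function.\<close>

lemma phi_young:
  assumes "0 < e" "e \<le> 1" "s \<ge> 0" "t \<ge> 0"
  shows "\<phi> s * t \<le> 2 powr (p + q) * (e * \<Phi> s + (1/e) powr (p + q) * \<Phi> t)"
proof -
  \<comment> \<open>Both factors are dominated at the larger of \<open>s\<close> and
    \<open>t / e\<close>, where the bound for \<open>\<phi> m * m\<close> applies. The dilation of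
    \<open>t\<close> is what leaves the factor \<open>e\<close> in front of
    \<open>\<Phi> s\<close>.\<close>
  let ?t = "t / e" let ?m = "max s ?t"
  have "\<phi> s * t = e * (\<phi> s * ?t)" using assms by simp
  also have "\<dots> \<le> e * (\<phi> ?m * ?m)"
    using assms by (intro mult_left_mono mult_mono phi_mono phi_nonneg) (auto simp: le_max_iff_disj)
  also have "\<dots> \<le> e * (2 powr (p + q) * \<Phi> ?m)"
    using assms by (intro mult_left_mono phi_mult_le) (auto simp: le_max_iff_disj)
  also have "\<dots> \<le> 2 powr (p + q) * (e * \<Phi> s + e * \<Phi> ?t)"
    using assms by (auto simp: max_def)
  also have "\<Phi> ?t \<le> (1/e) powr (p + q) * \<Phi> t" using Phi_scale[of "1/e" t] assms by simp
  then have "e * \<Phi> ?t \<le> 1 * ((1/e) powr (p + q) * \<Phi> t)"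
    using assms by (intro mult_mono) auto
  finally show ?thesis by (simp add: mult_left_mono)
qed

text \<open>The tangents in \<open>t powr p\<close> at \<open>z\<close> are averaged over
  \<open>x\<close> and \<open>y\<close>; the linear term is nonnegative by the hypothesis on
  \<open>z\<close>. Midpoints of vectors and gradients of power means both enter through this
  inequality.\<close>

lemma Phi_powr_mean_le:
  assumes "x \<ge> 0" "y \<ge> 0" "z \<ge> 0" "z powr p \<le> (x powr p + y powr p) / 2"
  shows "\<Phi> z \<le> (\<Phi> x + \<Phi> y) / 2"
proof -
  have "0 \<le> L z / p * ((x powr p + y powr p) / 2 - z powr p)"
    using assms L_nonneg[of z] p_gt_1 by (intro mult_nonneg_nonneg) auto
  then show ?thesis
    using Phi_ge_powr_tangent[of z x] Phi_ge_powr_tangent[of z y] assms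
    by (simp add: algebra_simps add_divide_distrib)
qed

end

section \<open>Strict and uniform convexity of powers\<close>

lemma powr_gt_tangent:
  fixes s t p :: real
  assumes "p > 1" "s \<ge> 0" "t \<ge> 0" "s \<noteq> t"
  shows "t powr p > s powr p + p * s powr (p - 1) * (t - s)"
proof -
  \<comment> \<open>Two weak tangent inequalities, from \<open>s\<close> to the midpoint and from
    the midpoint to \<open>t\<close>, add up to a strict one, since the slopes at \<open>s\<close>
    and at the midpoint differ strictly.\<close>
  define z where "z = (s + t) / 2"
  have d: "t - z = (t - s) / 2" "z - s = (t - s) / 2" by (auto simp: z_def field_simps)
  have "t powr p \<ge> z powr p + p * z powr (p - 1) * ((t - s) / 2)"
       "z powr p \<ge> s powr p + p * s powr (p - 1) * ((t - s) / 2)"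
    using powr_ge_tangent[of p z t] powr_ge_tangent[of p s z] assms unfolding d by (auto simp: z_def)
  moreover have "(z powr (p - 1) - s powr (p - 1)) * (t - s) > 0"
  proof (cases "s < t")
    case True
    then have "s powr (p - 1) < z powr (p - 1)"
      using assms by (intro powr_less_mono2) (auto simp: z_def)
    then show ?thesis using True by simp
  next
    case False
    then have "z powr (p - 1) < s powr (p - 1)"
      using assms by (intro powr_less_mono2) (auto simp: z_def)
    then show ?thesis using False assms by (auto intro: mult_neg_neg)
  qed
  then have "p * ((z powr (p - 1) - s powr (p - 1)) * (t - s)) > 0" using assms by simp
  then have "p * s powr (p - 1) * (t - s) < p * z powr (p - 1) * (t - s)" by (simp add: algebra_simps)
  ultimately show ?thesis unfolding times_divide_eq_right by linarith
qed

lemma powr_mean_less: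
  fixes x y p :: real
  assumes "p > 1" "x \<ge> 0" "y \<ge> 0" "x \<noteq> y"
  shows "((x + y) / 2) powr p < (x powr p + y powr p) / 2"
proof -
  define z where "z = (x + y) / 2"
  have d: "x - z = (x - y) / 2" "y - z = - ((x - y) / 2)" "z \<noteq> x" "z \<noteq> y" "z \<ge> 0"
    using assms by (auto simp: z_def field_simps)
  show ?thesis
    using powr_gt_tangent[of p z x] powr_gt_tangent[of p z y] assms(1,2,3) d(3-)
    unfolding d(1,2) z_def[symmetric] by (simp add: algebra_simps)
qed

text \<open>For equal norms strictness comes from the parallelogram law, for different norms from
  the strict convexity of the power.\<close>

lemma norm_powr_mean_less:
  fixes a b :: "'a::real_inner"
  assumes "p > 1" "a \<noteq> b"
  shows "norm ((a + b) /\<^sub>R 2) powr p < (norm a powr p + norm b powr p) / 2"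
proof (cases "norm a = norm b")
  case True
  have "(norm (a + b))\<^sup>2 + (norm (a - b))\<^sup>2 = 2 * (norm a)\<^sup>2 + 2 * (norm b)\<^sup>2"
    by (simp add: power2_norm_eq_inner algebra_simps inner_commute)
  moreover have "(norm (a - b))\<^sup>2 > 0" using assms(2) zero_less_norm_iff[of "a - b"]
    by (simp del: zero_less_norm_iff)
  ultimately have "(norm (a + b))\<^sup>2 < (2 * norm a)\<^sup>2"   proof -
    assume *: "(norm (a + b))\<^sup>2 + (norm (a - b))\<^sup>2 = 2 * (norm a)\<^sup>2 + 2 * (norm b)\<^sup>2" "(norm (a - b))\<^sup>2 > 0"
    have "(2 * norm a)\<^sup>2 = 4 * (norm a)\<^sup>2" by (simp add: power_mult_distrib)
    with * show ?thesis unfolding True by linarith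
  qed
  then have "norm ((a + b) /\<^sub>R 2) < norm a" using power_less_imp_less_base by fastforce
  then have "norm ((a + b) /\<^sub>R 2) powr p < norm a powr p" using assms by (intro powr_less_mono2) auto
  then show ?thesis using True by simp
next
  case False
  have "norm ((a + b) /\<^sub>R 2) \<le> (norm a + norm b) / 2" using norm_triangle_ineq[of a b] by simp
  then have "norm ((a + b) /\<^sub>R 2) powr p \<le> ((norm a + norm b) / 2) powr p"
    using assms by (intro powr_mono2) auto
  also have "\<dots> < (norm a powr p + norm b powr p) / 2"
    using False assms by (intro powr_mean_less) auto
  finally show ?thesis .
qed

lemma norm_powr_mean_le:
  fixes a b :: "'a::real_inner"
  assumes "p > 1"
  shows "norm ((a + b) /\<^sub>R 2) powr p \<le> (norm a powr p + norm b powr p) / 2"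
proof (cases "a = b")
  case True
  then have "(a + b) /\<^sub>R 2 = a" by (simp add: scaleR_2[symmetric])
  then show ?thesis using True by simp
qed (use norm_powr_mean_less[OF assms, of a b] in simp)

text \<open>Both sides are homogeneous of degree \<open>p\<close>, so the larger norm can be scaled
  to 1. The remaining pairs form a compact set, on which the strict midpoint inequality has a
  positive gap.\<close>

lemma norm_powr_uniformly_convex:
  assumes "p > 1" "e > 0"
  shows "\<exists>d>0. \<forall>a b :: 'a::euclidean_space. norm (a - b) \<ge> e * max (norm a) (norm b) \<longrightarrow>
    norm ((a + b) /\<^sub>R 2) powr p \<le> (1 - d) * ((norm a powr p + norm b powr p) / 2)"
proof -
  define S where "S = {x :: 'a \<times> 'a. max (norm (fst x)) (norm (snd x)) = 1 \<and> norm (fst x - snd x) \<ge> e}"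
  define f where "f x = (norm (fst x) powr p + norm (snd x) powr p) / 2 - norm ((fst x + snd x) /\<^sub>R 2) powr p"
    for x :: "'a \<times> 'a"
  have "bounded S"
    unfolding bounded_iff
  proof (intro exI ballI)
    fix x assume "x \<in> S"
    then have "norm (fst x) \<le> 1" "norm (snd x) \<le> 1" unfolding S_def by (auto simp: max_def split: if_splits)
    then show "norm x \<le> 2" using norm_fst_le[of x] sqrt_sum_squares_le_sum_abs[of "norm (fst x)" "norm (snd x)"]
      unfolding norm_prod_def by simp
  qed
  moreover have "closed S"
    unfolding S_def by (intro closed_Collect_conj closed_Collect_eq closed_Collect_le continuous_intros)
  ultimately have S: "compact S" by (simp add: compact_eq_bounded_closed)
  have cf: "continuous_on S f"
    unfolding f_def using assms by (intro continuous_intros continuous_on_powr') auto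
  have pos: "f x > 0" if "x \<in> S" for x
  proof -
    have "fst x \<noteq> snd x" using that assms by (auto simp: S_def)
    then show ?thesis using norm_powr_mean_less[OF assms(1), of "fst x" "snd x"] by (simp add: f_def)
  qed
  obtain d where d: "d > 0" "\<And>x. x \<in> S \<Longrightarrow> d \<le> f x"
  proof (cases "S = {}")
    case True
    then show ?thesis using that[of 1] by simp
  next
    case False
    then obtain x0 where "x0 \<in> S" "\<forall>x\<in>S. f x0 \<le> f x"
      using continuous_attains_inf[OF S _ cf] by auto
    then show ?thesis using that[of "f x0"] pos by auto
  qed
  show ?thesis
  proof (intro exI[of _ d] conjI allI impI d)
    fix a b :: 'a
    assume ab: "norm (a - b) \<ge> e * max (norm a) (norm b)"
    define M where "M = max (norm a) (norm b)"
    show "norm ((a + b) /\<^sub>R 2) powr p \<le> (1 - d) * ((norm a powr p + norm b powr p) / 2)"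
    proof (cases "M = 0")
      case True
      then have "a = 0" "b = 0" unfolding M_def by (auto simp: max_def split: if_splits)
      then show ?thesis using assms by simp
    next
      case False
      have "M \<ge> 0" unfolding M_def by (simp add: le_max_iff_disj)
      with False have M: "M > 0" by simp
      have "(a /\<^sub>R M, b /\<^sub>R M) \<in> S"
      proof -
        have "max (norm a / M) (norm b / M) = 1"
          using M unfolding M_def by (auto simp: max_def)
        moreover have "norm (a /\<^sub>R M - b /\<^sub>R M) = norm (a - b) / M"
          using M by (simp add: divide_inverse mult.commute flip: scaleR_diff_right)
        moreover have "e \<le> norm (a - b) / M" using M ab by (simp add: M_def[symmetric] field_simps)
        moreover have "norm (a /\<^sub>R M) = norm a / M" "norm (b /\<^sub>R M) = norm b / M"
          using M by (auto simp: divide_inverse mult.commute)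
        ultimately show ?thesis unfolding S_def by simp
      qed
      then have "d \<le> ((norm a / M) powr p + (norm b / M) powr p) / 2 - (norm ((a + b) /\<^sub>R 2) / M) powr p"
      proof -
        have n: "norm (x /\<^sub>R M) = norm x / M" for x :: 'a
          using M by (simp add: divide_inverse mult.commute)
        have "(a /\<^sub>R M + b /\<^sub>R M) /\<^sub>R 2 = ((a + b) /\<^sub>R 2) /\<^sub>R M"
          by (simp add: algebra_simps)
        then have "norm ((a /\<^sub>R M + b /\<^sub>R M) /\<^sub>R 2) = norm ((a + b) /\<^sub>R 2) / M"
          by (simp only: n)
        then show ?thesis using d(2)[OF \<open>(a /\<^sub>R M, b /\<^sub>R M) \<in> S\<close>] by (simp only: f_def fst_conv snd_conv n)
      qed
      then have "d * M powr p \<le> (norm a powr p + norm b powr p) / 2 - norm ((a + b) /\<^sub>R 2) powr p"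
      proof -
        assume "d \<le> ((norm a / M) powr p + (norm b / M) powr p) / 2 - (norm ((a + b) /\<^sub>R 2) / M) powr p"
        also have "\<dots> = ((norm a powr p + norm b powr p) / 2 - norm ((a + b) /\<^sub>R 2) powr p) / M powr p"
          using M by (simp only: powr_divide norm_ge_zero less_imp_le diff_divide_distrib add_divide_distrib) (simp add: field_simps)
        finally show ?thesis using M by (simp add: pos_le_divide_eq)
      qed
      \<comment> \<open>Turns the gap \<open>d * M powr p\<close> into one proportional to the mean,
        as the claim requires.\<close>
      moreover have "(norm a powr p + norm b powr p) / 2 \<le> M powr p"
        using powr_mono2[of p "norm a" M] powr_mono2[of p "norm b" M] assms by (auto simp: M_def)
      then have "d * ((norm a powr p + norm b powr p) / 2) \<le> d * M powr p"
        using d by (intro mult_left_mono) auto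
      ultimately show ?thesis by (simp add: algebra_simps)
    qed
  qed
qed

text \<open>Since \<open>r > p\<close>, the map with exponent \<open>r / p\<close> is strictly
  convex and can be applied to the p-th powers; compactness of the square makes the gap uniform. All
  strictness in the \<open>L^1\<close> Cauchy estimate comes from here.\<close>

lemma powr_mean_gap:
  fixes p r M e :: real
  assumes "p > 1" "r > p" "e > 0"
  shows "\<exists>d>0. \<forall>x\<in>{0..M}. \<forall>y\<in>{0..M}. \<bar>x - y\<bar> \<ge> e \<longrightarrow>
    d \<le> (x powr r + y powr r) / 2 - ((x powr p + y powr p) / 2) powr (r / p)"
proof -
  define S where "S = {x \<in> {0..M} \<times> {0..M}. \<bar>fst x - snd x\<bar> \<ge> e}"
  define f where "f x = (fst x powr r + snd x powr r) / 2 - ((fst x powr p + snd x powr p) / 2) powr (r / p)"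
    for x :: "real \<times> real"
  have "S = {0..M} \<times> {0..M} \<inter> {x. \<bar>fst x - snd x\<bar> \<ge> e}" by (auto simp: S_def)
  moreover have "closed {x :: real \<times> real. \<bar>fst x - snd x\<bar> \<ge> e}" by (intro closed_Collect_le continuous_intros)
  ultimately have S: "compact S" by (auto intro!: compact_Int_closed compact_Times)
  have cf: "continuous_on S f"
    unfolding f_def using assms
    by (intro continuous_intros continuous_on_powr') (auto simp: S_def)
  have pos: "f x > 0" if "x \<in> S" for x
  proof -
    have x: "fst x \<noteq> snd x" "fst x \<ge> 0" "snd x \<ge> 0" using that assms by (auto simp: S_def)
    have "fst x powr p \<noteq> snd x powr p"
    proof
      assume *: "fst x powr p = snd x powr p"
      have "(fst x powr p) powr (1/p) = (snd x powr p) powr (1/p)" unfolding * ..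
      then show False using x assms by (simp add: powr_powr)
    qed
    then show ?thesis using powr_mean_less[of "r/p" "fst x powr p" "snd x powr p"] assms
      by (simp add: f_def powr_powr)
  qed
  obtain d where d: "d > 0" "\<And>x. x \<in> S \<Longrightarrow> d \<le> f x"
  proof (cases "S = {}")
    case True
    then show ?thesis using that[of 1] by simp
  next
    case False
    then obtain x0 where "x0 \<in> S" "\<forall>x\<in>S. f x0 \<le> f x"
      using continuous_attains_inf[OF S _ cf] by auto
    then show ?thesis using that[of "f x0"] pos by auto
  qed
  show ?thesis
  proof (intro exI[of _ d] conjI ballI impI d(1))
    fix x y assume "x \<in> {0..M}" "y \<in> {0..M}" "e \<le> \<bar>x - y\<bar>"
    then have "(x, y) \<in> S" by (simp add: S_def)
    from d(2)[OF this] show "d \<le> (x powr r + y powr r) / 2 - ((x powr p + y powr p) / 2) powr (r / p)"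
      by (simp add: f_def)
  qed
qed

context log_orlicz
begin

lemma Phi_norm_mean_le:
  fixes a b :: "'a::real_inner"
  shows "\<Phi> (norm ((a + b) /\<^sub>R 2)) \<le> (\<Phi> (norm a) + \<Phi> (norm b)) / 2"
  by (intro Phi_powr_mean_le norm_powr_mean_le p_gt_1) auto

text \<open>Either \<open>norm (a - b)\<close> is small relative to the larger norm, and contraction
  by \<open>e\<close> settles the claim, or the uniform convexity of the p-th power applies. In the
  second case the factor \<open>1 - d\<close> is absorbed as the dilation \<theta> of the midpoint,
  and contraction by \<theta> turns it into a relative defect of at least
  \<open>1 - \<theta>\<close>.\<close>

lemma Phi_uniformly_convex:
  assumes "0 < e" "e \<le> 1"
  shows "\<exists>C>0. \<forall>a b :: 'a::euclidean_space. \<Phi> (norm (a - b)) \<le> e * (\<Phi> (norm a) + \<Phi> (norm b))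
     + C * ((\<Phi> (norm a) + \<Phi> (norm b)) / 2 - \<Phi> (norm ((a + b) /\<^sub>R 2)))"
proof -
  obtain d0 where d0: "d0 > 0" "\<And>a b :: 'a. norm (a - b) \<ge> e * max (norm a) (norm b) \<Longrightarrow>
    norm ((a + b) /\<^sub>R 2) powr p \<le> (1 - d0) * ((norm a powr p + norm b powr p) / 2)"
    using norm_powr_uniformly_convex[OF p_gt_1 assms(1)] by blast
  define d where "d = min d0 (1/2)"
  have d: "d > 0" "d < 1" "d \<le> d0" using d0 by (auto simp: d_def)
  define \<theta> where "\<theta> = (1 - d) powr (1/p)"
  have "\<theta> < 1 powr (1/p)" unfolding \<theta>_def using d p_gt_1 by (intro powr_less_mono2) auto
  then have \<theta>: "0 < \<theta>" "\<theta> < 1" "\<theta> powr p = 1 - d" using d p_gt_1 by (auto simp: \<theta>_def powr_powr)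
  define K where "K = 2 powr (p + q)"
  \<comment> \<open>Chosen so that \<open>C\<close> times the guaranteed defect
    \<open>(1 - \<theta>) * (?A / 2)\<close> is \<open>K * ?A\<close>, the crude bound for
    \<open>\<Phi> (norm (a - b))\<close>.\<close>
  define C where "C = 2 * K / (1 - \<theta>)"
  have K: "K > 0" by (simp add: K_def)
  have C: "C > 0" using K \<theta> by (simp add: C_def)
  show ?thesis
  proof (intro exI[of _ C] conjI allI C)
    fix a b :: 'a
    let ?A = "\<Phi> (norm a) + \<Phi> (norm b)"
    let ?D = "?A / 2 - \<Phi> (norm ((a + b) /\<^sub>R 2))"
    have D: "?D \<ge> 0" using Phi_norm_mean_le[of a b] by simp
    show "\<Phi> (norm (a - b)) \<le> e * ?A + C * ?D"
    proof (cases "norm (a - b) \<ge> e * max (norm a) (norm b)")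
      case False
      then have "\<Phi> (norm (a - b)) \<le> \<Phi> (e * max (norm a) (norm b))"
        by (intro Phi_mono) auto
      also have "\<dots> \<le> e * \<Phi> (max (norm a) (norm b))" using assms by (intro Phi_contract) auto
      also have "\<dots> \<le> e * ?A" using assms by (intro mult_left_mono) (auto simp: max_def)
      finally show ?thesis using D C by (simp add: add_increasing2)
    next
      case True
      let ?z = "norm ((a + b) /\<^sub>R 2)"
      have "?z powr p \<le> (1 - d0) * ((norm a powr p + norm b powr p) / 2)" by (rule d0(2)[OF True])
      also have "\<dots> \<le> (1 - d) * ((norm a powr p + norm b powr p) / 2)" using d by (intro mult_right_mono) auto
      finally have "(?z / \<theta>) powr p \<le> (norm a powr p + norm b powr p) / 2"
      proof -
        assume "?z powr p \<le> (1 - d) * ((norm a powr p + norm b powr p) / 2)"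
        moreover have "(?z / \<theta>) powr p = ?z powr p / (1 - d)" using \<theta> by (subst powr_divide) auto
        ultimately show ?thesis using d(2) by (simp only: pos_divide_le_eq diff_gt_0_iff_gt mult.commute)
      qed
      then have "\<Phi> (?z / \<theta>) \<le> ?A / 2" using \<theta> by (intro Phi_powr_mean_le) auto
      moreover have "\<Phi> ?z \<le> \<theta> * \<Phi> (?z / \<theta>)" using Phi_contract[of \<theta> "?z / \<theta>"] \<theta> by simp
      moreover have "\<theta> * \<Phi> (?z / \<theta>) \<le> \<theta> * (?A / 2)" using calculation(1) \<theta> by (intro mult_left_mono) auto
      ultimately have "\<Phi> ?z \<le> \<theta> * (?A / 2)" by linarith
      then have "(1 - \<theta>) * (?A / 2) \<le> ?D" unfolding left_diff_distrib mult_1 by linarith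
      then have "C * ((1 - \<theta>) * (?A / 2)) \<le> C * ?D" using C by (intro mult_left_mono) auto
      moreover have "C * ((1 - \<theta>) * (?A / 2)) = K * ?A" using \<theta> by (simp add: C_def)
      moreover have "\<Phi> (norm (a - b)) \<le> \<Phi> (norm a + norm b)"
        by (intro Phi_mono norm_triangle_ineq4) auto
      moreover have "\<dots> \<le> K * ?A" unfolding K_def by (rule Phi_add)
      moreover have "e * ?A \<ge> 0" using assms by (intro mult_nonneg_nonneg add_nonneg_nonneg) auto
      ultimately show ?thesis by linarith
    qed
  qed
qed

end

section \<open>Smooth functions and weak derivatives\<close>

subsection \<open>Smooth functions\<close>

lemma partial_eqI: "(f has_derivative f') (at x) \<Longrightarrow> partial i f x = f' (axis i 1)"
  by (simp add: partial_def frechet_derivative_at[symmetric])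

lemma Ck_on_SucD: "Ck_on (Suc k) S f \<Longrightarrow> Ck_on k S f"
proof (induction k arbitrary: f)
  case 0
  then show ?case
    by (auto intro!: continuous_at_imp_continuous_on differentiable_imp_continuous_within)
qed auto

lemma Ck_const: "Ck_on k UNIV (\<lambda>x. c)"
proof (induction k arbitrary: c)
  case (Suc k)
  have "partial i (\<lambda>x. c) = (\<lambda>x. 0)" for i :: 'a
    by (rule ext, subst partial_eqI[OF has_derivative_const]) simp
  then show ?case using Suc by simp
qed simp

lemma Ck_add: "Ck_on k UNIV f \<Longrightarrow> Ck_on k UNIV g \<Longrightarrow> Ck_on k UNIV (\<lambda>x. f x + g x)"
proof (induction k arbitrary: f g)
  case (Suc k)
  have "partial i (\<lambda>x. f x + g x) = (\<lambda>x. partial i f x + partial i g x)" for i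
    using Suc.prems
    by (intro ext, subst partial_eqI[OF has_derivative_add[OF
          frechet_derivative_works[THEN iffD1] frechet_derivative_works[THEN iffD1]]]) (auto simp: partial_def)
  then show ?case using Suc by auto
qed (auto intro: continuous_intros)

lemma Ck_mult: "Ck_on k UNIV f \<Longrightarrow> Ck_on k UNIV g \<Longrightarrow> Ck_on k UNIV (\<lambda>x. f x * g x)"
proof (induction k arbitrary: f g)
  case (Suc k)
  have "partial i (\<lambda>x. f x * g x) = (\<lambda>x. f x * partial i g x + partial i f x * g x)" for i
    using Suc.prems
    by (intro ext, subst partial_eqI[OF has_derivative_mult[OF
          frechet_derivative_works[THEN iffD1] frechet_derivative_works[THEN iffD1]]]) (auto simp: partial_def)
  moreover have "Ck_on k UNIV f" "Ck_on k UNIV g" using Suc.prems by (auto intro: Ck_on_SucD)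
  ultimately show ?case using Suc by (auto intro!: Ck_add)
qed (auto intro: continuous_intros)

lemma Ck_nth: "Ck_on k UNIV (\<lambda>x. x $ i)"
proof (cases k)
  case (Suc j)
  have d: "((\<lambda>x. x $ i) has_derivative (\<lambda>x. x $ i)) (at x)" for x :: "real^'a"
    by (rule bounded_linear_imp_has_derivative[OF bounded_linear_vec_nth])
  have "partial l (\<lambda>x. x $ i) = (\<lambda>x. axis l 1 $ i)" for l
    by (rule ext, subst partial_eqI[OF d]) simp
  then show ?thesis using Suc d by (auto simp: differentiable_def Ck_const)
qed (auto intro: continuous_intros)

text \<open>\<open>H\<close> stands for a smooth function of one variable together with all its derivatives.\<close>

lemma Ck_compose:
  fixes H :: "(real \<Rightarrow> real) set"
  assumes H: "\<And>h. h \<in> H \<Longrightarrow> \<exists>h'\<in>H. \<forall>t\<in>I. (h has_real_derivative h' t) (at t)"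
    and I: "\<And>x. f x \<in> I" and f: "Ck_on k UNIV f" and h: "h \<in> H"
  shows "Ck_on k UNIV (\<lambda>x. h (f x))"
  using f h
proof (induction k arbitrary: h)
  case 0
  obtain h' where "\<forall>t\<in>I. (h has_real_derivative h' t) (at t)" using H 0 by blast
  then have "continuous_on I h" by (auto intro: DERIV_continuous_on DERIV_subset)
  with 0 I show ?case by (auto intro!: continuous_on_compose2[of I h UNIV f])
next
  case (Suc k)
  obtain h' where h': "h' \<in> H" "\<forall>t\<in>I. (h has_real_derivative h' t) (at t)" using H Suc.prems by blast
  have d: "((\<lambda>x. h (f x)) has_derivative (\<lambda>v. h' (f x) * frechet_derivative f (at x) v)) (at x)" for x
    using Suc.prems h'(2) I
    by (intro has_derivative_compose[of f _ x UNIV h "(*) (h' (f x))", simplified])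
      (auto simp: has_field_derivative_def frechet_derivative_works[symmetric])
  have "partial i (\<lambda>x. h (f x)) = (\<lambda>x. h' (f x) * partial i f x)" for i
    by (rule ext, subst partial_eqI[OF d]) (simp add: partial_def)
  moreover have "Ck_on k UNIV (\<lambda>x. h' (f x))" using Suc h' Ck_on_SucD by blast
  ultimately show ?case using Suc.prems d by (auto simp: differentiable_def intro!: Ck_mult)
qed

abbreviation smooth :: "(real^'n::finite \<Rightarrow> real) \<Rightarrow> bool" where "smooth \<equiv> smooth_on UNIV"

lemma smooth_const: "smooth (\<lambda>x. c)" by (simp add: smooth_on_def Ck_const)
lemma smooth_add: "smooth f \<Longrightarrow> smooth g \<Longrightarrow> smooth (\<lambda>x. f x + g x)" by (simp add: smooth_on_def Ck_add)
lemma smooth_mult: "smooth f \<Longrightarrow> smooth g \<Longrightarrow> smooth (\<lambda>x. f x * g x)" by (simp add: smooth_on_def Ck_mult)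
lemma smooth_nth: "smooth (\<lambda>x. x $ i)" by (simp add: smooth_on_def Ck_nth)
lemma smooth_diff: "smooth f \<Longrightarrow> smooth g \<Longrightarrow> smooth (\<lambda>x. f x - g x)"
  using smooth_add[of f "\<lambda>x. (-1) * g x"] smooth_mult[OF smooth_const, of g "-1"] by simp
lemma smooth_power: "smooth f \<Longrightarrow> smooth (\<lambda>x. f x ^ n)"
  by (induction n) (auto intro: smooth_const smooth_mult)
lemma smooth_prod: "(\<And>i. i \<in> A \<Longrightarrow> smooth (f i)) \<Longrightarrow> smooth (\<lambda>x. \<Prod>i\<in>A. f i x)"
  by (induction A rule: infinite_finite_induct) (auto intro: smooth_const smooth_mult)

lemma smooth_compose:
  fixes H :: "(real \<Rightarrow> real) set"
  assumes "\<And>h. h \<in> H \<Longrightarrow> \<exists>h'\<in>H. \<forall>t\<in>I. (h has_real_derivative h' t) (at t)"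
    and "\<And>x. f x \<in> I" and "smooth f" and "h \<in> H"
  shows "smooth (\<lambda>x. h (f x))"
  using assms Ck_compose[of H I f _ h] by (simp add: smooth_on_def)

lemma smooth_exp: "smooth f \<Longrightarrow> smooth (\<lambda>x. exp (f x))"
  by (rule smooth_compose[of "{exp}" UNIV]) auto

lemma smooth_powr:
  fixes a :: real
  assumes "smooth f" "\<And>x. f x > 0"
  shows "smooth (\<lambda>x. f x powr a)"
proof -
  \<comment> \<open>Scalar multiples are included because differentiation brings the exponent down
    as a factor; the family is then closed under derivatives on the positive reals.\<close>
  let ?H = "range (\<lambda>(c :: real, a :: real) t. c * t powr a)"
  have "smooth (\<lambda>x. (\<lambda>t. 1 * t powr a) (f x))"
  proof (rule smooth_compose[of ?H "{0<..}" f "\<lambda>t. 1 * t powr a"])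
    fix h assume "h \<in> ?H"
    then obtain c b where "h = (\<lambda>t. c * t powr b)" by auto
    then show "\<exists>h'\<in>?H. \<forall>t\<in>{0<..}. (h has_real_derivative h' t) (at t)"
      by (intro bexI[of _ "\<lambda>t. (c * b) * t powr (b - 1)"]) (auto intro!: derivative_eq_intros)
  qed (use assms in \<open>auto intro: range_eqI[of _ _ "(1, a)"]\<close>)
  then show ?thesis by simp
qed

text \<open>The classical smooth function \<open>exp (- 1 / t)\<close>, flat at 0. The polynomial
  factor in \<open>1 / t\<close> makes the family closed under differentiation.\<close>

definition flat_exp :: "real poly \<Rightarrow> real \<Rightarrow> real" where
  "flat_exp P t = (if t > 0 then poly P (1 / t) * exp (- 1 / t) else 0)"

lemma tendsto_poly_mult_exp_minus: "((\<lambda>t :: real. poly P t * exp (- t)) \<longlongrightarrow> 0) at_top"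
proof -
  have "((\<lambda>t :: real. \<Sum>i\<le>degree P. coeff P i * (t ^ i / exp t)) \<longlongrightarrow> (\<Sum>i\<le>degree P. coeff P i * 0)) at_top"
    by (intro tendsto_intros tendsto_power_div_exp_0)
  then show ?thesis by (simp add: poly_altdef sum_distrib_left exp_minus divide_inverse mult_ac)
qed

text \<open>Differentiating \<open>poly P (1 / t) * exp (- 1 / t)\<close> gives the factor
  \<open>1 / t^2\<close> and replaces \<open>P\<close> by \<open>P - P'\<close>. At 0 the difference
  quotient vanishes in the limit, because the exponential beats every polynomial.\<close>

lemma flat_exp_deriv:
  "(flat_exp P has_real_derivative flat_exp (monom 1 2 * (P - pderiv P)) t) (at t)"
proof -
  consider "t > 0" | "t < 0" | "t = 0" by linarith
  then show ?thesis
  proof cases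
    case 1
    have "((\<lambda>t. poly P (1 / t) * exp (- 1 / t)) has_real_derivative flat_exp (monom 1 2 * (P - pderiv P)) t) (at t)"
      using 1 by (auto intro!: derivative_eq_intros DERIV_chain'[where g = "poly P", OF _ poly_DERIV]
        simp: flat_exp_def poly_monom field_simps power2_eq_square)
    then show ?thesis
      by (rule DERIV_cong_ev[THEN iffD1, rotated 3])
        (auto simp: flat_exp_def 1 intro: eventually_mono[OF eventually_nhds_in_open[of "{0<..}"]])
  next
    case 2
    have "((\<lambda>t. 0) has_real_derivative flat_exp (monom 1 2 * (P - pderiv P)) t) (at t)"
      using 2 by (simp add: flat_exp_def)
    then show ?thesis
      by (rule DERIV_cong_ev[THEN iffD1, rotated 3])
        (auto simp: flat_exp_def 2 intro: eventually_mono[OF eventually_nhds_in_open[of "{..<0}"]])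
  next
    case 3
    \<comment> \<open>Dividing by \<open>h\<close> multiplies the polynomial by its variable
      \<open>1 / h\<close>, which is \<open>pCons 0 P\<close>.\<close>
    have "((\<lambda>h. poly (pCons 0 P) (1 / h) * exp (- (1 / h))) \<longlongrightarrow> 0) (at_right 0)"
      using filterlim_compose[OF tendsto_poly_mult_exp_minus[of "pCons 0 P"] filterlim_inverse_at_top_right]
      by (simp add: inverse_eq_divide)
    then have "((\<lambda>h. flat_exp P h / h) \<longlongrightarrow> 0) (at_right 0)"
      by (rule Lim_transform_eventually)
        (auto simp: flat_exp_def eventually_at_filter)
    moreover have "((\<lambda>h. flat_exp P h / h) \<longlongrightarrow> 0) (at_left 0)"
      by (rule Lim_transform_eventually[OF tendsto_const]) (auto simp: flat_exp_def eventually_at_filter)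
    ultimately have "((\<lambda>h. flat_exp P h / h) \<longlongrightarrow> 0) (at 0)" by (simp add: filterlim_split_at)
    then show ?thesis using 3 by (simp add: has_field_derivative_iff flat_exp_def)
  qed
qed

lemma smooth_flat_exp: "smooth f \<Longrightarrow> smooth (\<lambda>x. flat_exp P (f x))"
  by (rule smooth_compose[of "range flat_exp" UNIV]) (auto intro: flat_exp_deriv)

lemma smooth_partial: "smooth f \<Longrightarrow> smooth (partial i f)"
  unfolding smooth_on_def by (metis Ck_on.simps(2))

lemma smooth_continuous: "smooth f \<Longrightarrow> continuous_on UNIV f"
  unfolding smooth_on_def by (metis Ck_on.simps(1))

lemma smooth_differentiable: "smooth f \<Longrightarrow> f differentiable (at x)"
  unfolding smooth_on_def by (metis Ck_on.simps(2) UNIV_I)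

lemma smooth_has_derivative: "smooth f \<Longrightarrow> (f has_derivative frechet_derivative f (at x)) (at x)"
  using smooth_differentiable frechet_derivative_works by blast

lemma partial_const: "partial i (\<lambda>x. c) x = 0"
  by (simp add: partial_eqI[OF has_derivative_const])

lemma partial_add: "smooth f \<Longrightarrow> smooth g \<Longrightarrow> partial i (\<lambda>x. f x + g x) x = partial i f x + partial i g x"
  by (subst partial_eqI[OF has_derivative_add[OF smooth_has_derivative smooth_has_derivative]]) (auto simp: partial_def)

lemma partial_mult: "smooth f \<Longrightarrow> smooth g \<Longrightarrow>
    partial i (\<lambda>x. f x * g x) x = f x * partial i g x + partial i f x * g x"
  by (subst partial_eqI[OF has_derivative_mult[OF smooth_has_derivative smooth_has_derivative]]) (auto simp: partial_def)

lemma partial_cmult: "smooth f \<Longrightarrow> partial i (\<lambda>x. c * f x) x = c * partial i f x"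
  using partial_mult[OF smooth_const, of f i c x] by (simp add: partial_const)

lemma partial_compose:
  assumes "smooth f" "(h has_real_derivative d) (at (f x))"
  shows "partial i (\<lambda>x. h (f x)) x = d * partial i f x"
proof -
  have "((\<lambda>x. h (f x)) has_derivative (\<lambda>v. d * frechet_derivative f (at x) v)) (at x)"
    using has_derivative_compose[OF smooth_has_derivative[OF assms(1)], of h "(*) d" x] assms(2)
    by (simp add: has_field_derivative_def)
  then show ?thesis by (subst partial_eqI) (auto simp: partial_def)
qed

subsection \<open>Test functions\<close>

definition grad :: "(real^'n::finite \<Rightarrow> real) \<Rightarrow> real^'n \<Rightarrow> real^'n" where
  "grad f x = (\<chi> i. partial i f x)"

lemma grad_nth [simp]: "grad f x $ i = partial i f x" by (simp add: grad_def)

lemma continuous_on_grad: "smooth f \<Longrightarrow> continuous_on UNIV (grad f)"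
  unfolding grad_def by (intro continuous_intros continuous_on_vec_lambda smooth_continuous smooth_partial)

lemma test_smooth: "f \<in> test_functions \<Omega> \<Longrightarrow> smooth f" by (simp add: test_functions_def)

lemma test_functionsI:
  assumes "smooth f" "\<psi>1 \<in> test_functions \<Omega>" "\<psi>2 \<in> test_functions \<Omega>"
    and "\<And>x. \<psi>1 x = 0 \<Longrightarrow> \<psi>2 x = 0 \<Longrightarrow> f x = 0"
  shows "f \<in> test_functions \<Omega>"
proof -
  have "{x. f x \<noteq> 0} \<subseteq> {x. \<psi>1 x \<noteq> 0} \<union> {x. \<psi>2 x \<noteq> 0}" using assms(4) by auto
  then have s: "closure {x. f x \<noteq> 0} \<subseteq> closure {x. \<psi>1 x \<noteq> 0} \<union> closure {x. \<psi>2 x \<noteq> 0}"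
    using closure_mono closure_Un by metis
  have c: "compact (closure {x. \<psi>1 x \<noteq> 0} \<union> closure {x. \<psi>2 x \<noteq> 0})"
    using assms(2,3) by (auto simp: test_functions_def)
  have "compact (closure {x. f x \<noteq> 0})"
    using compact_Int_closed[OF c closed_closure] s by (metis Int_absorb1)
  then show ?thesis using assms s by (auto simp: test_functions_def)
qed

lemma test_add: "f \<in> test_functions \<Omega> \<Longrightarrow> g \<in> test_functions \<Omega> \<Longrightarrow> (\<lambda>x. f x + g x) \<in> test_functions \<Omega>"
  by (rule test_functionsI[of _ f _ g]) (auto intro: smooth_add test_smooth)
lemma test_cmult: "f \<in> test_functions \<Omega> \<Longrightarrow> (\<lambda>x. c * f x) \<in> test_functions \<Omega>"
  by (rule test_functionsI[of _ f _ f]) (auto intro: smooth_mult smooth_const test_smooth)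
lemma test_mult: "f \<in> test_functions \<Omega> \<Longrightarrow> smooth g \<Longrightarrow> (\<lambda>x. f x * g x) \<in> test_functions \<Omega>"
  by (rule test_functionsI[of _ f _ f]) (auto intro: smooth_mult test_smooth)
lemma test_zero: "(\<lambda>x. 0) \<in> test_functions \<Omega>"
  by (auto simp: test_functions_def smooth_const)

lemma partial_eq_0:
  assumes "\<And>y. y \<in> S \<Longrightarrow> f y = 0" "open S" "x \<in> S"
  shows "partial i f x = 0"
proof -
  have "(f has_derivative (\<lambda>v. 0)) (at x)"
    using assms by (intro has_derivative_transform_within_open[OF has_derivative_const[of 0]]) auto
  then show ?thesis by (subst partial_eqI) auto
qed

lemma test_partial:
  assumes "f \<in> test_functions \<Omega>"
  shows "partial i f \<in> test_functions \<Omega>"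
proof -
  let ?K = "closure {x. f x \<noteq> 0}"
  have "partial i f x = 0" if "x \<notin> ?K" for x
    using that closure_subset[of "{x. f x \<noteq> 0}"] by (intro partial_eq_0[of "- ?K"]) auto
  then have "{x. partial i f x \<noteq> 0} \<subseteq> ?K" by auto
  then have s: "closure {x. partial i f x \<noteq> 0} \<subseteq> ?K" by (simp add: closure_minimal)
  have "compact ?K" using assms by (auto simp: test_functions_def)
  from compact_Int_closed[OF this closed_closure] s
  have "compact (closure {x. partial i f x \<noteq> 0})" by (metis Int_absorb1)
  then show ?thesis using assms s by (auto simp: test_functions_def intro: smooth_partial)
qed

lemma test_bounded:
  assumes "f \<in> test_functions \<Omega>"
  obtains C where "C > 0" "\<And>x. \<bar>f x\<bar> \<le> C"
proof -
  let ?K = "closure {x. f x \<noteq> 0}"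
  have "compact (f ` ?K)"
    using assms by (intro compact_continuous_image continuous_on_subset[OF smooth_continuous]) (auto simp: test_functions_def)
  then have "bounded (f ` ?K)" by (rule compact_imp_bounded)
  then obtain C where C: "C > 0" "\<And>x. x \<in> ?K \<Longrightarrow> \<bar>f x\<bar> \<le> C" by (auto simp: bounded_pos)
  have "\<bar>f x\<bar> \<le> C" for x
    using C closure_subset[of "{x. f x \<noteq> 0}"] by (cases "f x = 0") auto
  then show ?thesis using that C by blast
qed

lemma test_grad_bounded:
  assumes "f \<in> test_functions \<Omega>"
  obtains C where "C > 0" "\<And>x. norm (grad f x) \<le> C"
proof -
  have "\<forall>i. \<exists>C. \<forall>x. \<bar>partial i f x\<bar> \<le> C" using test_bounded[OF test_partial[OF assms]] by metis
  then obtain C where C: "\<And>i x. \<bar>partial i f x\<bar> \<le> C i" by metis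
  have "norm (grad f x) \<le> (\<Sum>i\<in>UNIV. C i) + 1" for x
    using norm_le_l1_cart[of "grad f x"] sum_mono[of UNIV "\<lambda>i. \<bar>grad f x $ i\<bar>" C] C by force
  moreover have "C i \<ge> 0" for i using order_trans[OF abs_ge_zero C] .
  then have "(\<Sum>i\<in>UNIV. C i) + 1 > 0" by (intro add_nonneg_pos sum_nonneg) auto
  ultimately show ?thesis by (rule that[rotated])
qed

section \<open>Smooth approximation of indicators of boxes\<close>

definition box_bump :: "real^'n::finite \<Rightarrow> real^'n \<Rightarrow> real^'n \<Rightarrow> real" where
  "box_bump a b x = (\<Prod>i\<in>UNIV. flat_exp 1 (x $ i - a $ i) * flat_exp 1 (b $ i - x $ i))"

lemma smooth_box_bump: "smooth (box_bump a b)"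
  unfolding box_bump_def
  by (intro smooth_prod smooth_mult smooth_flat_exp smooth_diff smooth_nth smooth_const)

lemma box_bump_nonneg: "box_bump a b x \<ge> 0"
  unfolding box_bump_def flat_exp_def by (intro prod_nonneg) auto

lemma box_bump_pos_iff: "box_bump a b x \<noteq> 0 \<longleftrightarrow> x \<in> box a b"
  unfolding box_bump_def flat_exp_def by (auto simp: mem_box_cart)

lemma box_bump_test:
  assumes "cbox a b \<subseteq> \<Omega>"
  shows "box_bump a b \<in> test_functions \<Omega>"
proof -
  have "closure {x. box_bump a b x \<noteq> 0} \<subseteq> cbox a b"
    by (intro closure_minimal) (auto simp: box_bump_pos_iff intro: box_subset_cbox[THEN subsetD])
  moreover from this have "compact (closure {x. box_bump a b x \<noteq> 0})"
    by (meson bounded_cbox bounded_subset closed_closure compact_eq_bounded_closed)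
  ultimately show ?thesis using assms by (auto simp: test_functions_def smooth_box_bump)
qed

text \<open>The exponential sends a bump of unknown height into the unit interval, and for growing
  \<open>k\<close> to 1 wherever the bump is positive.\<close>

definition box_step :: "real^'n::finite \<Rightarrow> real^'n \<Rightarrow> nat \<Rightarrow> real^'n \<Rightarrow> real" where
  "box_step a b k x = 1 - exp (- real k * box_bump a b x)"

lemma box_step_test:
  assumes "cbox a b \<subseteq> \<Omega>"
  shows "box_step a b k \<in> test_functions \<Omega>"
  unfolding box_step_def
  by (rule test_functionsI[OF _ box_bump_test[OF assms] box_bump_test[OF assms]])
    (use smooth_mult[OF smooth_const smooth_box_bump, of "- real k" a b] in
      \<open>auto intro: smooth_diff smooth_const smooth_exp\<close>)

lemma box_step_bounds: "0 \<le> box_step a b k x" "box_step a b k x \<le> 1"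
  using box_bump_nonneg[of a b x] by (auto simp: box_step_def)

lemma box_step_tendsto: "(\<lambda>k. box_step a b k x) \<longlonglongrightarrow> indicator (box a b) x"
proof (cases "x \<in> box a b")
  case True
  then have b: "box_bump a b x > 0" using box_bump_pos_iff[of a b x] box_bump_nonneg[of a b x] by simp
  have "(\<lambda>k. exp (- box_bump a b x) ^ k) \<longlonglongrightarrow> 0" using b by (intro LIMSEQ_realpow_zero) auto
  then have "(\<lambda>k. 1 - exp (- box_bump a b x) ^ k) \<longlonglongrightarrow> 1 - 0" by (intro tendsto_diff tendsto_const)
  then show ?thesis using True by (simp add: box_step_def exp_of_nat_mult[symmetric])
next
  case False
  then have "box_bump a b x = 0" using box_bump_pos_iff by blast
  then show ?thesis using False by (simp add: box_step_def)
qed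

subsection \<open>Weak derivatives\<close>

lemma continuous_measurable_on:
  assumes "continuous_on UNIV f" "open S"
  shows "f \<in> borel_measurable (lebesgue_on S)"
  using assms by (intro continuous_imp_measurable_on_sets_lebesgue) (auto intro: continuous_on_subset)

lemma test_eq_0: "f \<in> test_functions \<Omega> \<Longrightarrow> x \<notin> \<Omega> \<Longrightarrow> f x = 0"
  using closure_subset[of "{x. f x \<noteq> 0}"] by (auto simp: test_functions_def)

lemma test_borel: "f \<in> test_functions \<Omega> \<Longrightarrow> f \<in> borel_measurable borel"
  by (intro borel_measurable_continuous_onI smooth_continuous test_smooth)

lemma test_integrable:
  assumes "f \<in> test_functions \<Omega>"
  shows "integrable lborel f"
proof -
  let ?K = "closure {x. f x \<noteq> 0}"
  have "integrable lborel (\<lambda>x. indicator ?K x *\<^sub>R f x)"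
    using assms by (intro borel_integrable_compact continuous_on_subset[OF smooth_continuous])
      (auto simp: test_functions_def)
  moreover have "(\<lambda>x. indicator ?K x *\<^sub>R f x) = f"
    using closure_subset[of "{x. f x \<noteq> 0}"] by (intro ext) (auto simp: indicator_def)
  ultimately show ?thesis by simp
qed

text \<open>A test function vanishes off \<Omega>, so its integral can be moved to
  \<open>lborel\<close> on the whole space, where translation invariance is available.\<close>

lemma test_lebesgue_on:
  assumes "f \<in> test_functions \<Omega>" "open \<Omega>"
  shows "integrable (lebesgue_on \<Omega>) f" "(LINT x|lebesgue_on \<Omega>. f x) = (LINT x|lborel. f x)"
proof -
  have eq: "(\<lambda>x. indicator \<Omega> x *\<^sub>R f x) = f"
    using test_eq_0[OF assms(1)] by (intro ext) (auto simp: indicator_def)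
  have m: "f \<in> borel_measurable lborel" using test_borel[OF assms(1)] by simp
  show "integrable (lebesgue_on \<Omega>) f"
    using assms test_integrable[OF assms(1)]
    by (subst integrable_restrict_space) (auto simp: eq[simplified] integrable_completion m)
  show "(LINT x|lebesgue_on \<Omega>. f x) = (LINT x|lborel. f x)"
    using assms eq integral_completion[OF m] by (subst integral_restrict_space) auto
qed

lemma DERIV_along_axis:
  assumes "smooth f"
  shows "((\<lambda>t. f (x + t *\<^sub>R axis i 1)) has_real_derivative partial i f (x + t *\<^sub>R axis i 1)) (at t)"
proof -
  let ?y = "x + t *\<^sub>R axis i 1"
  have 1: "((\<lambda>t. x + t *\<^sub>R axis i 1) has_derivative (\<lambda>h. h *\<^sub>R axis i 1)) (at t)"
    by (auto intro!: derivative_eq_intros)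
  have 2: "(f has_derivative frechet_derivative f (at ?y)) (at ?y)" by (rule smooth_has_derivative[OF assms])
  have "((\<lambda>t. f (x + t *\<^sub>R axis i 1)) has_derivative (\<lambda>h. frechet_derivative f (at ?y) (h *\<^sub>R axis i 1))) (at t)"
    by (rule has_derivative_compose[OF 1 2])
  moreover have "frechet_derivative f (at ?y) (h *\<^sub>R axis i 1) = partial i f ?y * h" for h
    using linear_cmul[OF has_derivative_linear[OF 2]] by (simp add: partial_def)
  ultimately show ?thesis by (simp add: has_field_derivative_def)
qed

text \<open>Difference quotients along the axis have integral 0 by translation invariance, and they
  converge to the partial derivative.\<close>

lemma integral_partial_lborel:
  fixes f :: "real^'n::finite \<Rightarrow> real"
  assumes f: "f \<in> test_functions \<Omega>"
  shows "(LINT x|lborel. partial i f x) = 0"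
proof -
  define h where "h k = 1 / real (Suc k)" for k
  have h: "0 < h k" "h k \<le> 1" for k by (auto simp: h_def)
  define s where "s k x = (f (x + h k *\<^sub>R axis i 1) - f x) / h k" for k x
  obtain C where C: "C > 0" "\<And>x. \<bar>partial i f x\<bar> \<le> C" using test_bounded[OF test_partial[OF f]] by metis
  have "bounded {x. f x \<noteq> 0}"
    using f bounded_subset[OF compact_imp_bounded closure_subset] by (auto simp: test_functions_def)
  then obtain R where R: "\<And>x. f x \<noteq> 0 \<Longrightarrow> norm x \<le> R" by (auto simp: bounded_iff)
  have sm: "smooth f" by (rule test_smooth[OF f])
  have shift: "integrable lborel (\<lambda>x. f (x + a))" "(LINT x|lborel. f (x + a)) = (LINT x|lborel. f x)" for a
  proof -
    have i: "integrable (distr lborel borel ((+) a)) f" by (simp add: lborel_distr_plus test_integrable[OF f])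
    have m: "(+) a \<in> lborel \<rightarrow>\<^sub>M borel" by simp
    show "integrable lborel (\<lambda>x. f (x + a))" using integrable_distr[OF m i] by (simp add: add.commute)
    show "(LINT x|lborel. f (x + a)) = (LINT x|lborel. f x)"
      using integral_distr[OF m test_borel[OF f]] by (simp add: lborel_distr_plus add.commute)
  qed
  have "(\<lambda>k. LINT x|lborel. s k x) \<longlonglongrightarrow> (LINT x|lborel. partial i f x)"
  \<comment> \<open>By the mean value theorem the quotients are bounded by \<open>C\<close>; as the
    shifts have length at most 1, they vanish outside radius \<open>R + 1\<close>.\<close>
  proof (rule integral_dominated_convergence[where w = "\<lambda>x. indicator (cball 0 (R + 1)) x *\<^sub>R C"])
    show "integrable lborel (\<lambda>x. indicator (cball 0 (R + 1)) x *\<^sub>R C :: real)"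
      by (rule borel_integrable_compact) auto
    show "partial i f \<in> borel_measurable lborel" using test_borel[OF test_partial[OF f]] by simp
    show "s k \<in> borel_measurable lborel" for k
      using shift(1) test_integrable[OF f] unfolding s_def by (auto intro!: borel_measurable_divide borel_measurable_diff)
    show "AE x in lborel. (\<lambda>k. s k x) \<longlonglongrightarrow> partial i f x"
    proof (intro AE_I2)
      fix x
      have "((\<lambda>t. (f (x + t *\<^sub>R axis i 1) - f x) / t) \<longlongrightarrow> partial i f x) (at 0)"
        using DERIV_along_axis[OF sm, of x i 0] by (simp add: has_field_derivative_iff)
      moreover have "filterlim h (at 0) sequentially"
        using h LIMSEQ_Suc[OF lim_1_over_n[where 'a=real]] unfolding filterlim_at h_def by (auto intro: always_eventually)
      ultimately show "(\<lambda>k. s k x) \<longlonglongrightarrow> partial i f x"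
        unfolding s_def by (rule filterlim_compose)
    qed
    show "AE x in lborel. norm (s k x) \<le> indicator (cball 0 (R + 1)) x *\<^sub>R C" for k
    proof (intro AE_I2)
      fix x
      show "norm (s k x) \<le> indicator (cball 0 (R + 1)) x *\<^sub>R C"
      proof (cases "s k x = 0")
        case False
        have "norm x \<le> R + 1"
        proof (cases "f x = 0")
          case True
          with False have "f (x + h k *\<^sub>R axis i 1) \<noteq> 0" by (simp add: s_def)
          from R[OF this] have "norm (x + h k *\<^sub>R axis i 1) \<le> R" .
          moreover have "norm x \<le> norm (x + h k *\<^sub>R axis i 1) + norm (h k *\<^sub>R (axis i 1 :: real^'n))"
            using norm_triangle_ineq4[of "x + h k *\<^sub>R axis i 1" "h k *\<^sub>R axis i 1"] by simp
          ultimately show ?thesis using h[of k] by (simp add: norm_axis_1)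
        qed (use R in force)
        moreover obtain z where "0 < z" "z < h k"
            "f (x + h k *\<^sub>R axis i 1) - f (x + 0 *\<^sub>R axis i 1) = (h k - 0) * partial i f (x + z *\<^sub>R axis i 1)"
          using MVT2[OF h(1) DERIV_along_axis[OF sm], of k x i] by blast
        then have "s k x = partial i f (x + z *\<^sub>R axis i 1)" using h[of k] by (simp add: s_def)
        then have "\<bar>s k x\<bar> \<le> C" using C by simp
        ultimately show ?thesis by simp
      qed (use C in simp)
    qed
  qed
  moreover have "(LINT x|lborel. s k x) = 0" for k
    unfolding s_def using shift test_integrable[OF f] by simp
  ultimately show ?thesis by (simp add: LIMSEQ_const_iff)
qed

lemma integral_by_parts:
  assumes "smooth f" "g \<in> test_functions \<Omega>" "open \<Omega>"
  shows "(LINT x|lebesgue_on \<Omega>. f x * partial i g x) = - (LINT x|lebesgue_on \<Omega>. partial i f x * g x)"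
proof -
  have t: "(\<lambda>x. g x * f x) \<in> test_functions \<Omega>" "(\<lambda>x. partial i g x * f x) \<in> test_functions \<Omega>"
      "(\<lambda>x. g x * partial i f x) \<in> test_functions \<Omega>"
    using assms by (auto intro: test_mult test_partial smooth_partial)
  have "0 = (LINT x|lebesgue_on \<Omega>. partial i (\<lambda>x. g x * f x) x)"
    using integral_partial_lborel[OF t(1)] test_lebesgue_on(2)[OF test_partial[OF t(1)] assms(3)] by simp
  also have "\<dots> = (LINT x|lebesgue_on \<Omega>. g x * partial i f x + partial i g x * f x)"
    using assms by (simp add: partial_mult test_smooth)
  also have "\<dots> = (LINT x|lebesgue_on \<Omega>. g x * partial i f x) + (LINT x|lebesgue_on \<Omega>. partial i g x * f x)"
    using t assms by (intro Bochner_Integration.integral_add test_lebesgue_on)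
  finally show ?thesis by (simp add: mult.commute)
qed

lemma locally_integrableI:
  assumes "integrable (lebesgue_on \<Omega>) u" "open \<Omega>"
  shows "locally_integrable \<Omega> u"
  unfolding locally_integrable_def
proof safe
  fix K assume K: "compact K" "K \<subseteq> \<Omega>"
  have KL: "K \<in> sets lebesgue" using lmeasurable_compact[OF K(1)] by (rule fmeasurableD)
  have "integrable lebesgue (\<lambda>x. indicator \<Omega> x *\<^sub>R u x)"
    using assms by (subst (asm) integrable_restrict_space) auto
  then have "integrable lebesgue (\<lambda>x. indicator K x *\<^sub>R (indicator \<Omega> x *\<^sub>R u x))"
    using KL by (rule integrable_mult_indicator[rotated])
  also have "(\<lambda>x. indicator K x *\<^sub>R (indicator \<Omega> x *\<^sub>R u x)) = (\<lambda>x. indicator K x *\<^sub>R u x)"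
    using K by (intro ext) (auto simp: indicator_def)
  finally show "integrable (lebesgue_on K) u" using KL by (subst integrable_restrict_space) auto
qed

lemma integrable_mult_bounded:
  fixes u w :: "'a \<Rightarrow> real"
  assumes "integrable M u" "w \<in> borel_measurable M" "\<And>x. \<bar>w x\<bar> \<le> C"
  shows "integrable M (\<lambda>x. u x * w x)"
proof (rule Bochner_Integration.integrable_bound[where f = "\<lambda>x. C * u x"])
  have "C \<ge> 0" using assms(3) abs_ge_zero order_trans by blast
  then show "AE x in M. norm (u x * w x) \<le> norm (C * u x)"
  proof (intro AE_I2)
    fix x
    show "norm (u x * w x) \<le> norm (C * u x)"
      using mult_left_mono[OF assms(3)[of x], of "\<bar>u x\<bar>"] \<open>C \<ge> 0\<close> by (simp add: abs_mult mult.commute)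
  qed
qed (use assms in auto)

lemma locally_integrable_mult_test:
  assumes "locally_integrable \<Omega> u" "\<eta> \<in> test_functions \<Omega>" "open \<Omega>"
  shows "integrable (lebesgue_on \<Omega>) (\<lambda>x. u x * \<eta> x)"
proof -
  let ?K = "closure {x. \<eta> x \<noteq> 0}"
  have K: "compact ?K" "?K \<subseteq> \<Omega>" using assms(2) by (auto simp: test_functions_def)
  obtain C where C: "\<And>x. \<bar>\<eta> x\<bar> \<le> C" using test_bounded[OF assms(2)] by metis
  have "integrable (lebesgue_on ?K) u" using assms(1) K by (simp add: locally_integrable_def)
  then have "integrable lebesgue (\<lambda>x. indicator ?K x *\<^sub>R u x)"
    by (subst (asm) integrable_restrict_space) auto
  then have "integrable lebesgue (\<lambda>x. (indicator ?K x *\<^sub>R u x) * \<eta> x)"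
    using C test_borel[OF assms(2)]
    by (intro integrable_mult_bounded[where C = C]) (auto intro!: measurable_completion)
  also have "(\<lambda>x. (indicator ?K x *\<^sub>R u x) * \<eta> x) = (\<lambda>x. indicator \<Omega> x *\<^sub>R (u x * \<eta> x))"
    using closure_subset[of "{x. \<eta> x \<noteq> 0}"] K(2) by (intro ext) (auto simp: indicator_def)
  finally show ?thesis using assms by (subst integrable_restrict_space) auto
qed

lemma has_weak_partial_test:
  assumes "\<psi> \<in> test_functions \<Omega>" "open \<Omega>"
  shows "has_weak_partial \<Omega> i \<psi> (partial i \<psi>)"
  using assms unfolding has_weak_partial_def
  by (auto intro!: locally_integrableI test_lebesgue_on test_partial integral_by_parts test_smooth)

lemma has_weak_partial_diff:
  assumes "has_weak_partial \<Omega> i u g" "has_weak_partial \<Omega> i v h" "open \<Omega>"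
  shows "has_weak_partial \<Omega> i (\<lambda>x. u x - v x) (\<lambda>x. g x - h x)"
proof -
  note l = assms(1,2)[unfolded has_weak_partial_def]
  have "(LINT x|lebesgue_on \<Omega>. (u x - v x) * partial i \<psi> x) = - (LINT x|lebesgue_on \<Omega>. (g x - h x) * \<psi> x)"
    if \<psi>: "\<psi> \<in> test_functions \<Omega>" for \<psi>
    using l \<psi> assms(3) by (simp add: left_diff_distrib locally_integrable_mult_test test_partial)
  then show ?thesis using l unfolding has_weak_partial_def locally_integrable_def by auto
qed

lemma tendsto_integral_mult_bounded:
  fixes u w :: "'a \<Rightarrow> real"
  assumes "\<And>n. integrable M (f n)" "integrable M u" "(\<lambda>n. LINT x|M. \<bar>f n x - u x\<bar>) \<longlonglongrightarrow> 0"
    and w: "w \<in> borel_measurable M" "\<And>x. \<bar>w x\<bar> \<le> C"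
  shows "(\<lambda>n. LINT x|M. f n x * w x) \<longlonglongrightarrow> (LINT x|M. u x * w x)"
proof -
  have i: "integrable M (\<lambda>x. f n x * w x)" "integrable M (\<lambda>x. u x * w x)" for n
    using assms by (auto intro: integrable_mult_bounded)
  have b: "\<bar>(LINT x|M. f n x * w x) - (LINT x|M. u x * w x)\<bar> \<le> C * (LINT x|M. \<bar>f n x - u x\<bar>)" for n
  proof -
    have "\<bar>(LINT x|M. f n x * w x) - (LINT x|M. u x * w x)\<bar> = \<bar>LINT x|M. f n x * w x - u x * w x\<bar>"
      using i by simp
    also have "\<dots> \<le> (LINT x|M. \<bar>f n x * w x - u x * w x\<bar>)" by (rule integral_abs_bound)
    also have "\<dots> \<le> (LINT x|M. C * \<bar>f n x - u x\<bar>)"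
    proof (rule integral_mono)
      show "integrable M (\<lambda>x. \<bar>f n x * w x - u x * w x\<bar>)" "integrable M (\<lambda>x. C * \<bar>f n x - u x\<bar>)"
        using i assms by auto
      show "\<bar>f n x * w x - u x * w x\<bar> \<le> C * \<bar>f n x - u x\<bar>" for x
      proof -
        have "\<bar>f n x * w x - u x * w x\<bar> = \<bar>f n x - u x\<bar> * \<bar>w x\<bar>"
          by (metis abs_mult left_diff_distrib)
        also have "\<dots> \<le> \<bar>f n x - u x\<bar> * C" by (intro mult_left_mono w) auto
        finally show ?thesis by (simp only: mult.commute)
      qed
    qed
    finally show ?thesis by simp
  qed
  have "(\<lambda>n. C * (LINT x|M. \<bar>f n x - u x\<bar>)) \<longlonglongrightarrow> 0"
    using tendsto_mult_right_zero[OF assms(3)] by simp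
  then have "(\<lambda>n. (LINT x|M. f n x * w x) - (LINT x|M. u x * w x)) \<longlonglongrightarrow> 0"
    by (rule Lim_null_comparison[rotated]) (use b in \<open>simp add: always_eventually\<close>)
  then show ?thesis by (simp add: LIM_zero_iff)
qed

text \<open>Test functions and their derivatives are bounded, so both sides of the formula of
  integration by parts are continuous under \<open>L^1\<close> convergence.\<close>

lemma has_weak_partial_limit:
  assumes \<psi>: "\<And>n. \<psi> n \<in> test_functions \<Omega>" and "open \<Omega>"
    and u: "integrable (lebesgue_on \<Omega>) u" "(\<lambda>n. LINT x|lebesgue_on \<Omega>. \<bar>\<psi> n x - u x\<bar>) \<longlonglongrightarrow> 0"
    and g: "integrable (lebesgue_on \<Omega>) g" "(\<lambda>n. LINT x|lebesgue_on \<Omega>. \<bar>partial i (\<psi> n) x - g x\<bar>) \<longlonglongrightarrow> 0"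
  shows "has_weak_partial \<Omega> i u g"
  unfolding has_weak_partial_def
proof (intro conjI ballI locally_integrableI assms)
  fix \<eta> assume \<eta>: "\<eta> \<in> test_functions \<Omega>"
  obtain C where C: "\<And>x. \<bar>\<eta> x\<bar> \<le> C" using test_bounded[OF \<eta>] by metis
  obtain D where D: "\<And>x. \<bar>partial i \<eta> x\<bar> \<le> D" using test_bounded[OF test_partial[OF \<eta>]] by metis
  have m: "\<eta> \<in> borel_measurable (lebesgue_on \<Omega>)" "partial i \<eta> \<in> borel_measurable (lebesgue_on \<Omega>)"
    using test_lebesgue_on(1)[OF \<eta> assms(2)] test_lebesgue_on(1)[OF test_partial[OF \<eta>] assms(2)] by auto
  have "(\<lambda>n. LINT x|lebesgue_on \<Omega>. \<psi> n x * partial i \<eta> x) \<longlonglongrightarrow> (LINT x|lebesgue_on \<Omega>. u x * partial i \<eta> x)"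
    using assms test_lebesgue_on(1) m D by (intro tendsto_integral_mult_bounded) auto
  moreover have "(\<lambda>n. - (LINT x|lebesgue_on \<Omega>. partial i (\<psi> n) x * \<eta> x)) \<longlonglongrightarrow> - (LINT x|lebesgue_on \<Omega>. g x * \<eta> x)"
    using assms test_lebesgue_on(1) m C
    by (intro tendsto_minus tendsto_integral_mult_bounded) (auto intro: test_lebesgue_on(1) test_partial)
  ultimately show "(LINT x|lebesgue_on \<Omega>. u x * partial i \<eta> x) = - (LINT x|lebesgue_on \<Omega>. g x * \<eta> x)"
    using integral_by_parts[OF test_smooth[OF \<psi>] \<eta> assms(2), of _ i] LIMSEQ_unique by simp
qed

section \<open>Uniqueness of weak derivatives\<close>

lemma integral_box_eq_0:
  assumes f: "locally_integrable \<Omega> f" and "open \<Omega>" "cbox a b \<subseteq> \<Omega>"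
    and z: "\<And>\<psi>. \<psi> \<in> test_functions \<Omega> \<Longrightarrow> (LINT x|lebesgue_on \<Omega>. f x * \<psi> x) = 0"
  shows "integral (cbox a b) f = 0"
proof -
  have i: "integrable (lebesgue_on (cbox a b)) f"
    using assms by (simp add: locally_integrable_def)
  have "(LINT x|lebesgue_on (cbox a b). f x * box_step a b k x) = (LINT x|lebesgue_on \<Omega>. f x * box_step a b k x)" for k
  proof -
    have "indicator (cbox a b) x *\<^sub>R (f x * box_step a b k x) = indicator \<Omega> x *\<^sub>R (f x * box_step a b k x)" for x
    proof (cases "x \<in> cbox a b")
      case False
      then have "box_bump a b x = 0" using box_bump_pos_iff[of a b x] box_subset_cbox[of a b] by blast
      then show ?thesis by (simp add: box_step_def)
    qed (use assms in \<open>auto simp: indicator_def\<close>)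
    then have "(\<lambda>x. indicator (cbox a b) x *\<^sub>R (f x * box_step a b k x)) = (\<lambda>x. indicator \<Omega> x *\<^sub>R (f x * box_step a b k x))" ..
    then have "(LINT x|lebesgue. indicator (cbox a b) x *\<^sub>R (f x * box_step a b k x)) =
        (LINT x|lebesgue. indicator \<Omega> x *\<^sub>R (f x * box_step a b k x))" by (rule arg_cong)
    then show ?thesis using assms(2) by (subst (1 2) integral_restrict_space) auto
  qed
  then have s0: "(LINT x|lebesgue_on (cbox a b). f x * box_step a b k x) = 0" for k
    using z[OF box_step_test[OF assms(3)]] by simp
  have sm: "box_step a b k \<in> borel_measurable (lebesgue_on (cbox a b))" for k
    using smooth_continuous[OF test_smooth[OF box_step_test[OF assms(3)]]]
    by (intro continuous_imp_measurable_on_sets_lebesgue) (auto intro: continuous_on_subset)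
  \<comment> \<open>The smooth steps tend to the indicator of the open box, which differs from the
    closed one by a null set.\<close>
  have "(\<lambda>k. LINT x|lebesgue_on (cbox a b). f x * box_step a b k x) \<longlonglongrightarrow>
      (LINT x|lebesgue_on (cbox a b). f x * indicator (box a b) x)"
  proof (rule integral_dominated_convergence[where w = "\<lambda>x. \<bar>f x\<bar>"])
    show "AE x in lebesgue_on (cbox a b). norm (f x * box_step a b k x) \<le> \<bar>f x\<bar>" for k
      using box_step_bounds[of a b k] by (intro AE_I2) (simp add: abs_mult mult_left_le)
    show "AE x in lebesgue_on (cbox a b). (\<lambda>k. f x * box_step a b k x) \<longlonglongrightarrow> f x * indicator (box a b) x"
      by (intro AE_I2 tendsto_intros box_step_tendsto)
    show "(\<lambda>x. f x * indicator (box a b) x) \<in> borel_measurable (lebesgue_on (cbox a b))"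
      using i by (intro borel_measurable_times borel_measurable_indicator) (auto simp: sets_restrict_space_iff
         intro: box_subset_cbox[THEN subsetD])
  qed (use i sm in auto)
  then have "(LINT x|lebesgue_on (cbox a b). f x * indicator (box a b) x) = 0"
    by (simp add: s0 LIMSEQ_const_iff)
  moreover have "AE x in lebesgue_on (cbox a b). f x * indicator (box a b) x = f x"
  proof -
    have "cbox a b - box a b \<in> null_sets lebesgue"
      using negligible_frontier_interval[of a b] by (simp add: negligible_iff_null_sets)
    then have "AE x in lebesgue. x \<notin> cbox a b - box a b" by (rule AE_not_in)
    then show ?thesis by (subst AE_restrict_space_iff) (auto elim!: eventually_mono)
  qed
  then have "(LINT x|lebesgue_on (cbox a b). f x * indicator (box a b) x) = (LINT x|lebesgue_on (cbox a b). f x)"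
    using i by (intro integral_cong_AE borel_measurable_times borel_measurable_indicator) (auto simp: sets_restrict_space_iff
         intro: box_subset_cbox[THEN subsetD])
  ultimately show ?thesis using lebesgue_integral_eq_integral[OF i] by simp
qed

text \<open>Lebesgue differentiation: almost every value is a limit of averages over small cubes
  with a corner at the point, and these averages are all 0.\<close>

lemma AE_eq_0_on_box:
  fixes f :: "real^'n::finite \<Rightarrow> real"
  assumes i: "integrable (lebesgue_on (cbox a b)) f"
    and z: "\<And>c d. cbox c d \<subseteq> cbox a b \<Longrightarrow> integral (cbox c d) f = 0"
  shows "AE x in lebesgue. x \<in> cbox a b \<longrightarrow> f x = 0"
proof -
  define F where "F x = (if x \<in> cbox a b then f x else 0)" for x
  have "f integrable_on cbox a b" using integrable_on_lebesgue_on[OF i] by simp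
  then have "F integrable_on UNIV" unfolding F_def by (simp only: integrable_restrict_UNIV)
  then have "F integrable_on cbox c d" for c d by (rule integrable_on_subcbox) auto
  from integrable_ccontinuous_explicit[OF this] obtain N where N: "negligible N"
    "\<And>x e. x \<notin> N \<Longrightarrow> 0 < e \<Longrightarrow> \<exists>d>0. \<forall>h. 0 < h \<and> h < d \<longrightarrow>
       norm (integral (cbox x (x + h *\<^sub>R One)) F /\<^sub>R h ^ DIM(real^'n) - F x) < e" by metis
  have "f x = 0" if x: "x \<notin> N" "x \<in> box a b" for x
  proof (rule ccontr)
    assume "f x \<noteq> 0"
    then have "\<bar>f x\<bar> > 0" by simp
    from N(2)[OF x(1) this] obtain d where d: "d > 0" "\<And>h. 0 < h \<Longrightarrow> h < d \<Longrightarrow>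
       norm (integral (cbox x (x + h *\<^sub>R One)) F /\<^sub>R h ^ DIM(real^'n) - F x) < \<bar>f x\<bar>" by blast
    obtain r where r: "r > 0" "ball x r \<subseteq> box a b" using x(2) open_box openE by blast
    let ?K = "norm (One :: real^'n)"
    \<comment> \<open>The diagonal of a cube with side \<open>h\<close> has length
      \<open>h * ?K\<close>, which must stay below \<open>r\<close> for the cube to lie in the ball;
      adding 1 avoids a case distinction on \<open>?K\<close>.\<close>
    define h where "h = min (d/2) (r / (2 * (?K + 1)))"
    have K: "?K \<ge> 0" by simp
    then have h: "0 < h" "h < d" using d r by (auto simp: h_def add_nonneg_pos)
    have "h * ?K \<le> r / (2 * (?K + 1)) * ?K" using K by (intro mult_right_mono) (auto simp: h_def)
    also have "\<dots> < r" using K r by (simp add: field_simps add_nonneg_pos)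
    finally have "h * ?K < r" .
    have sub: "cbox x (x + h *\<^sub>R One) \<subseteq> cbox a b"
    proof
      fix y assume y: "y \<in> cbox x (x + h *\<^sub>R One)"
      have "norm (y - x) \<le> norm (h *\<^sub>R (One :: real^'n))"
        using y h by (intro norm_le_componentwise) (auto simp: mem_box inner_diff_left inner_add_left)
      then have "norm (y - x) < r" using h \<open>h * ?K < r\<close> by simp
      then have "y \<in> ball x r" by (simp add: dist_norm norm_minus_commute)
      then show "y \<in> cbox a b" using r(2) box_subset_cbox by blast
    qed
    then have "integral (cbox x (x + h *\<^sub>R One)) F = integral (cbox x (x + h *\<^sub>R One)) f"
      by (intro integral_cong) (auto simp: F_def)
    then have "integral (cbox x (x + h *\<^sub>R One)) F = 0" using z[OF sub] by simp
    moreover have "F x = f x" using x(2) box_subset_cbox[of a b] by (auto simp: F_def)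
    ultimately show False using d(2)[OF h(1,2)] by simp
  qed
  moreover have "negligible (N \<union> (cbox a b - box a b))"
    using N(1) negligible_frontier_interval by (simp add: negligible_Un)
  then have "N \<union> (cbox a b - box a b) \<in> null_sets lebesgue" by (simp add: negligible_iff_null_sets)
  then have ae: "AE x in lebesgue. x \<notin> N \<union> (cbox a b - box a b)" by (rule AE_not_in)
  ultimately show ?thesis by (intro eventually_mono[OF ae]) blast
qed

text \<open>An open set is a countable union of closed boxes, so the exceptional null sets of the
  individual boxes can be united.\<close>

lemma du_Bois_Reymond:
  assumes f: "locally_integrable \<Omega> f" and "open \<Omega>"
    and z: "\<And>\<psi>. \<psi> \<in> test_functions \<Omega> \<Longrightarrow> (LINT x|lebesgue_on \<Omega>. f x * \<psi> x) = 0"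
  shows "AE x in lebesgue_on \<Omega>. f x = 0"
proof -
  obtain D where D: "countable D" "D \<subseteq> Pow \<Omega>" "\<And>X. X \<in> D \<Longrightarrow> \<exists>a b. X = cbox a b" "\<Union>D = \<Omega>"
    using open_countable_Union_open_cbox[OF assms(2)] by metis
  have "AE x in lebesgue. x \<in> X \<longrightarrow> f x = 0" if X: "X \<in> D" for X
  proof -
    obtain a b where ab: "X = cbox a b" using D(3)[OF X] by blast
    have sub: "cbox a b \<subseteq> \<Omega>" using D(2) X ab by blast
    show ?thesis unfolding ab
    proof (rule AE_eq_0_on_box)
      show "integrable (lebesgue_on (cbox a b)) f" using f sub by (simp add: locally_integrable_def)
      show "integral (cbox c d) f = 0" if "cbox c d \<subseteq> cbox a b" for c d
        using integral_box_eq_0[OF f assms(2) _ z] that sub by blast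
    qed
  qed
  then have "AE x in lebesgue. \<forall>X\<in>D. x \<in> X \<longrightarrow> f x = 0" by (subst AE_ball_countable[OF D(1)]) blast
  then have "AE x in lebesgue. x \<in> \<Omega> \<longrightarrow> f x = 0" using D(4) by (auto elim!: eventually_mono)
  then show ?thesis using assms by (subst AE_restrict_space_iff) auto
qed

lemma has_weak_partial_unique:
  assumes "has_weak_partial \<Omega> i u g" "has_weak_partial \<Omega> i u h" "open \<Omega>"
  shows "AE x in lebesgue_on \<Omega>. g x = h x"
proof -
  have d: "has_weak_partial \<Omega> i (\<lambda>x. u x - u x) (\<lambda>x. g x - h x)" by (rule has_weak_partial_diff[OF assms])
  have "AE x in lebesgue_on \<Omega>. g x - h x = 0"
    using d assms(3) by (intro du_Bois_Reymond) (auto simp: has_weak_partial_def)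
  then show ?thesis by simp
qed

text \<open>\<open>weak_partial\<close> is an arbitrary choice. By uniqueness any known weak
  gradient may stand for it almost everywhere, so later arguments can use convenient
  representatives.\<close>

lemma weak_grad_AE:
  assumes "\<And>i. has_weak_partial \<Omega> i u (\<lambda>x. g x $ i)" "open \<Omega>"
  shows "AE x in lebesgue_on \<Omega>. weak_grad \<Omega> u x = g x"
proof -
  have "AE x in lebesgue_on \<Omega>. weak_partial \<Omega> i u x = g x $ i" for i
    using has_weak_partial_unique[OF _ assms(1) assms(2)] someI[of "has_weak_partial \<Omega> i u"] assms(1)
    unfolding weak_partial_def by blast
  then have "AE x in lebesgue_on \<Omega>. \<forall>i\<in>UNIV. weak_partial \<Omega> i u x = g x $ i"
    by (subst AE_ball_countable) auto
  then show ?thesis by (simp add: weak_grad_def vec_eq_iff)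
qed

section \<open>Modular convergence\<close>

lemma small_multiplier:
  fixes A \<epsilon> :: real
  assumes "0 < \<epsilon>"
  obtains e where "0 < e" "e \<le> 1" "e * A < \<epsilon> / 2"
proof -
  define e where "e = min 1 (\<epsilon> / (2 * (\<bar>A\<bar> + 1)))"
  have e: "0 < e" "e \<le> 1" using assms by (auto simp: e_def)
  have "e * A \<le> e * \<bar>A\<bar>" using e by (intro mult_left_mono) auto
  also have "\<dots> \<le> \<epsilon> / (2 * (\<bar>A\<bar> + 1)) * \<bar>A\<bar>" by (intro mult_right_mono) (auto simp: e_def)
  also have "\<dots> < \<epsilon> / 2 * 1" using assms by (simp add: field_simps add_nonneg_pos)
  finally show ?thesis using that e by simp
qed

text \<open>The absorption scheme behind most limits here: first \<open>e\<close> is fixed to make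
  the bounded part small, then the null sequence beats the constant \<open>C\<close>, which may
  depend on \<open>e\<close>.\<close>

lemma tendsto_0_by_small:
  fixes X y :: "nat \<Rightarrow> real"
  assumes "\<And>e. 0 < e \<Longrightarrow> e \<le> 1 \<Longrightarrow> \<exists>C. \<forall>n. \<bar>X n\<bar> \<le> e * A + C * y n"
    and "y \<longlonglongrightarrow> 0"
  shows "X \<longlonglongrightarrow> 0"
proof (rule LIMSEQ_I)
  fix \<epsilon> :: real assume \<epsilon>: "0 < \<epsilon>"
  obtain e where e: "0 < e" "e \<le> 1" and a: "e * A < \<epsilon> / 2" using small_multiplier[OF \<epsilon>] by blast
  obtain C where C: "\<And>n. \<bar>X n\<bar> \<le> e * A + C * y n" using assms(1)[OF e] by blast
  have "(\<lambda>n. C * y n) \<longlonglongrightarrow> 0" using tendsto_mult_right_zero[OF assms(2)] by simp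
  from LIMSEQ_D[OF this, of "\<epsilon>/2"] \<epsilon> obtain N where N: "\<And>n. n \<ge> N \<Longrightarrow> \<bar>C * y n\<bar> < \<epsilon> / 2" by auto
  have "norm (X n - 0) < \<epsilon>" if "n \<ge> N" for n using C[of n] N[OF that] a by auto
  then show "\<exists>N. \<forall>n\<ge>N. norm (X n - 0) < \<epsilon>" by blast
qed

text \<open>Because \<open>x * y \<le> \<bar>x\<bar> * \<bar>y\<bar>\<close>, the subgradient
  inequality reduces to the tangent inequality for the absolute values.\<close>

lemma powr_gradient_ineq:
  fixes x y s :: real
  assumes "s > 1"
  shows "\<bar>y\<bar> powr s / s \<ge> \<bar>x\<bar> powr s / s + \<bar>x\<bar> powr (s - 2) * x * (y - x)"
proof -
  have eq: "\<bar>x\<bar> powr (s - 2) * x * x = \<bar>x\<bar> powr (s - 1) * \<bar>x\<bar>"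
  proof -
    have b: "\<bar>x\<bar> powr (s - 1) = \<bar>x\<bar> * \<bar>x\<bar> powr (s - 2)"
      using powr_mult_base[of "\<bar>x\<bar>" "s - 2"] by simp
    have "\<bar>x\<bar> powr (s - 2) * x * x = \<bar>x\<bar> powr (s - 2) * (\<bar>x\<bar> * \<bar>x\<bar>)"
      by (simp only: mult.assoc abs_mult_self_eq)
    then show ?thesis unfolding b by (simp only: mult_ac)
  qed
  have "\<bar>x\<bar> powr (s - 2) * (x * y) \<le> \<bar>x\<bar> powr (s - 2) * (\<bar>x\<bar> * \<bar>y\<bar>)"
    using abs_ge_self[of "x * y"] by (intro mult_left_mono) (simp_all only: abs_mult powr_ge_zero)
  also have "\<dots> = \<bar>x\<bar> powr (s - 1) * \<bar>y\<bar>"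
    using powr_mult_base[of "\<bar>x\<bar>" "s - 2"] by (simp add: mult_ac)
  finally have "\<bar>x\<bar> powr (s - 2) * x * (y - x) \<le> \<bar>x\<bar> powr (s - 1) * (\<bar>y\<bar> - \<bar>x\<bar>)"
    using eq by (simp add: algebra_simps)
  moreover have "\<bar>x\<bar> powr s + s * (\<bar>x\<bar> powr (s - 1) * (\<bar>y\<bar> - \<bar>x\<bar>)) \<le> \<bar>y\<bar> powr s"
    using powr_ge_tangent[of s "\<bar>x\<bar>" "\<bar>y\<bar>"] assms by (simp add: mult.assoc)
  then have "(\<bar>x\<bar> powr s + s * (\<bar>x\<bar> powr (s - 1) * (\<bar>y\<bar> - \<bar>x\<bar>))) / s \<le> \<bar>y\<bar> powr s / s"
    using assms by (intro divide_right_mono) auto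
  then have "\<bar>x\<bar> powr s / s + \<bar>x\<bar> powr (s - 1) * (\<bar>y\<bar> - \<bar>x\<bar>) \<le> \<bar>y\<bar> powr s / s"
    using assms by (simp add: add_divide_distrib)
  ultimately show ?thesis by linarith
qed

lemma abs_powr_mult_self:
  fixes x s :: real
  shows "\<bar>\<bar>x\<bar> powr (s - 2) * x\<bar> = \<bar>x\<bar> powr (s - 1)"
  using powr_mult_base[of "\<bar>x\<bar>" "s - 2"] by (simp add: abs_mult mult_ac)

text \<open>Only 0 needs care: for \<open>s < 2\<close> the first factor is unbounded there, but the
  product has absolute value \<open>\<bar>x\<bar> powr (s - 1)\<close>.\<close>

lemma continuous_on_powr_mult_self:
  fixes s :: real
  assumes "s > 1"
  shows "continuous_on UNIV (\<lambda>x. \<bar>x\<bar> powr (s - 2) * x)"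
proof -
  have "isCont (\<lambda>x. \<bar>x\<bar> powr (s - 2) * x) x" for x
  proof (cases "x = 0")
    case False
    then show ?thesis by (intro continuous_intros) auto
  next
    case True
    have "((\<lambda>x. \<bar>x\<bar> powr (s - 1)) \<longlongrightarrow> \<bar>0\<bar> powr (s - 1)) (at (0 :: real))"
      using assms by (intro tendsto_powr' tendsto_intros) auto
    then have "((\<lambda>x. \<bar>\<bar>x\<bar> powr (s - 2) * x\<bar>) \<longlongrightarrow> 0) (at (0 :: real))"
      using assms by (simp add: abs_powr_mult_self)
    then show ?thesis unfolding True isCont_def by (simp add: tendsto_rabs_zero_iff)
  qed
  then show ?thesis by (simp add: continuous_at_imp_continuous_on)
qed

context log_orlicz
begin

lemma Phi_borel [measurable]: "\<Phi> \<in> borel_measurable borel"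
  by (rule borel_measurable_continuous_onI[OF continuous_on_Phi_UNIV])

text \<open>The gradient of \<open>\<Phi> (norm \<xi>)\<close>, that is, the vector field under the
  divergence of the equation.\<close>

definition flux :: "'a::real_inner \<Rightarrow> 'a" where
  "flux \<xi> = (ln (1 + norm \<xi> powr q) * norm \<xi> powr (p - 2)) *\<^sub>R \<xi>"

lemma norm_flux: "norm (flux \<xi>) = \<phi> (norm \<xi>)"
  by (simp add: flux_def phi_def abs_mult)

lemma continuous_on_flux: "continuous_on UNIV (flux :: 'a::real_inner \<Rightarrow> 'a)"
proof -
  have "isCont flux \<xi>" for \<xi> :: 'a
  proof (cases "\<xi> = 0")
    case False
    then show ?thesis unfolding flux_def
      by (intro continuous_intros) (auto simp: add_nonneg_eq_0_iff)
  next
    case True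
    have "continuous_on UNIV (\<lambda>\<xi> :: 'a. \<phi> (norm \<xi>))"
      by (intro continuous_on_compose2[OF continuous_on_phi] continuous_intros) auto
    then have "isCont (\<lambda>\<xi> :: 'a. \<phi> (norm \<xi>)) 0" by (simp add: continuous_on_eq_continuous_at)
    then have "((\<lambda>\<xi> :: 'a. norm (flux \<xi>)) \<longlongrightarrow> 0) (at 0)" by (simp add: isCont_def norm_flux)
    then show ?thesis unfolding True isCont_def using norm_flux[of "0::'a"] by (simp add: tendsto_norm_zero_iff)
  qed
  then show ?thesis by (simp add: continuous_at_imp_continuous_on)
qed

lemma Phi_gradient_ineq:
  fixes a b :: "'a::real_inner"
  shows "\<Phi> (norm b) \<ge> \<Phi> (norm a) + flux a \<bullet> (b - a)"
proof -
  have "flux a \<bullet> b \<le> \<phi> (norm a) * norm b"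
    using norm_cauchy_schwarz[of "flux a" b] by (simp add: norm_flux)
  moreover have "flux a \<bullet> a = \<phi> (norm a) * norm a"
    by (simp add: flux_def phi_def power2_norm_eq_inner[symmetric] power2_eq_square)
  ultimately show ?thesis
    using Phi_ge_tangent[of "norm a" "norm b"] by (simp add: algebra_simps)
qed

lemma flux_inner_le:
  assumes "0 < e" "e \<le> 1"
  shows "\<bar>flux a \<bullet> b\<bar> \<le> 2 powr (p + q) * (e * \<Phi> (norm a) + (1/e) powr (p + q) * \<Phi> (norm b))"
  using Cauchy_Schwarz_ineq2[of "flux a" b] phi_young[of e "norm a" "norm b"] assms
  by (simp add: norm_flux)

text \<open>The subgradient inequality in both orders, with Young's inequality for the inner
  products. The large terms carry the free factor \<open>e\<close>, which yields continuity of the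
  modular although \<Phi> is not Lipschitz.\<close>

lemma Phi_norm_diff_le:
  fixes a b :: "'a::real_inner"
  assumes "0 < e" "e \<le> 1"
  shows "\<bar>\<Phi> (norm a) - \<Phi> (norm b)\<bar>
    \<le> 2 powr (p + q) * (e * (\<Phi> (norm a) + \<Phi> (norm b)) + (1/e) powr (p + q) * \<Phi> (norm (a - b)))"
proof -
  let ?K = "2 powr (p + q)"
  have "\<Phi> (norm a) - \<Phi> (norm b) \<le> ?K * (e * \<Phi> (norm a) + (1/e) powr (p + q) * \<Phi> (norm (a - b)))"
    using Phi_gradient_ineq[of a b] flux_inner_le[OF assms, of a "b - a"]
    by (simp add: norm_minus_commute)
  moreover have "\<Phi> (norm b) - \<Phi> (norm a) \<le> ?K * (e * \<Phi> (norm b) + (1/e) powr (p + q) * \<Phi> (norm (a - b)))"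
    using Phi_gradient_ineq[of b a] flux_inner_le[OF assms, of b "a - b"] by simp
  moreover have "0 \<le> ?K * (e * \<Phi> (norm a))" "0 \<le> ?K * (e * \<Phi> (norm b))" using assms by auto
  ultimately show ?thesis unfolding abs_le_iff by (simp add: algebra_simps)
qed

lemma Phi_norm_add_le:
  fixes a b :: "'a::real_normed_vector"
  shows "\<Phi> (norm (a + b)) \<le> 2 powr (p + q) * (\<Phi> (norm a) + \<Phi> (norm b))"
  using Phi_mono[OF norm_ge_zero norm_triangle_ineq[of a b]] Phi_add[of "norm a" "norm b"] by linarith

lemma Phi_norm_diff_le':
  fixes a b :: "'a::real_normed_vector"
  shows "\<Phi> (norm (a - b)) \<le> 2 powr (p + q) * (\<Phi> (norm a) + \<Phi> (norm b))"
  using Phi_norm_add_le[of a "- b"] by simp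

end

section \<open>Functions with finite modular on a bounded open set\<close>

locale orlicz_domain = log_orlicz p q for p q :: real +
  fixes \<Omega> :: "(real^'n::finite) set"
  assumes open_\<Omega>: "open \<Omega>" and bounded_\<Omega>: "bounded \<Omega>"
begin

abbreviation \<mu> where "\<mu> \<equiv> lebesgue_on \<Omega>"

lemma finite_\<mu>: "finite_measure \<mu>"
proof
  have "\<Omega> \<in> lmeasurable" using bounded_\<Omega> open_\<Omega> by (simp add: lmeasurable_open)
  then show "emeasure \<mu> (space \<mu>) \<noteq> \<infinity>"
    by (simp add: emeasure_restrict_space fmeasurable_def open_\<Omega>)
qed

sublocale finite_measure \<mu> by (rule finite_\<mu>)

definition vol :: real where "vol = measure \<mu> (space \<mu>)"

lemma integral_const_\<mu>: "(LINT x|\<mu>. c) = vol * (c :: real)" by (simp add: vol_def)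

lemma continuous_\<mu>: "continuous_on UNIV f \<Longrightarrow> f \<in> borel_measurable \<mu>"
  by (rule continuous_measurable_on[OF _ open_\<Omega>])

text \<open>The Orlicz class, extended to vector fields so that gradients are treated like
  functions.\<close>

definition mod_int :: "(real^'n \<Rightarrow> 'b::euclidean_space) \<Rightarrow> bool" where
  "mod_int f \<longleftrightarrow> f \<in> borel_measurable \<mu> \<and> integrable \<mu> (\<lambda>x. \<Phi> (norm (f x)))"

lemma mod_intI:
  assumes "f \<in> borel_measurable \<mu>" "integrable \<mu> g" "AE x in \<mu>. \<Phi> (norm (f x)) \<le> g x"
  shows "mod_int f"
  unfolding mod_int_def
proof
  show "integrable \<mu> (\<lambda>x. \<Phi> (norm (f x)))"
    using assms by (intro Bochner_Integration.integrable_bound[OF assms(2)]) (auto elim!: eventually_mono)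
qed fact

lemma mod_int_add: "mod_int f \<Longrightarrow> mod_int g \<Longrightarrow> mod_int (\<lambda>x. f x + g x)"
  by (rule mod_intI[where g = "\<lambda>x. 2 powr (p + q) * (\<Phi> (norm (f x)) + \<Phi> (norm (g x)))"])
    (auto simp: mod_int_def Phi_norm_add_le)

lemma mod_int_diff: "mod_int f \<Longrightarrow> mod_int g \<Longrightarrow> mod_int (\<lambda>x. f x - g x)"
  by (rule mod_intI[where g = "\<lambda>x. 2 powr (p + q) * (\<Phi> (norm (f x)) + \<Phi> (norm (g x)))"])
    (auto simp: mod_int_def Phi_norm_diff_le')

lemma mod_int_scaleR:
  assumes "mod_int f"
  shows "mod_int (\<lambda>x. c *\<^sub>R f x)"
proof (rule mod_intI[where g = "\<lambda>x. (max 1 \<bar>c\<bar>) powr (p + q) * \<Phi> (norm (f x))"])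
  show "AE x in \<mu>. \<Phi> (norm (c *\<^sub>R f x)) \<le> (max 1 \<bar>c\<bar>) powr (p + q) * \<Phi> (norm (f x))"
  proof (intro AE_I2)
    fix x
    have "\<Phi> (norm (c *\<^sub>R f x)) \<le> \<Phi> (max 1 \<bar>c\<bar> * norm (f x))" by (intro Phi_mono) (auto intro: mult_right_mono)
    then show "\<Phi> (norm (c *\<^sub>R f x)) \<le> (max 1 \<bar>c\<bar>) powr (p + q) * \<Phi> (norm (f x))"
      using Phi_scale[of "max 1 \<bar>c\<bar>" "norm (f x)"] by simp
  qed
qed (use assms in \<open>auto simp: mod_int_def\<close>)

lemma mod_int_bounded:
  assumes "f \<in> borel_measurable \<mu>" "AE x in \<mu>. norm (f x) \<le> C"
  shows "mod_int f"
  by (rule mod_intI[where g = "\<lambda>x. \<Phi> C"]) (use assms in \<open>auto elim!: eventually_mono intro: Phi_mono\<close>)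

lemma mod_int_integrable:
  assumes "mod_int f"
  shows "integrable \<mu> f"
proof (rule Bochner_Integration.integrable_bound[where f = "\<lambda>x. 1 + \<Phi> (norm (f x)) / \<phi> 1"])
  show "AE x in \<mu>. norm (f x) \<le> norm (1 + \<Phi> (norm (f x)) / \<phi> 1)"
    using Phi_ge_linear[of 1] phi_pos[of 1]
  proof (intro AE_I2)
    fix x
    have "norm (f x) * \<phi> 1 \<le> \<phi> 1 + \<Phi> (norm (f x))"
      using Phi_ge_linear[of 1 "norm (f x)"] by (simp add: algebra_simps)
    then have "norm (f x) \<le> 1 + \<Phi> (norm (f x)) / \<phi> 1" using phi_pos[of 1] by (simp add: field_simps)
    then show "norm (f x) \<le> norm (1 + \<Phi> (norm (f x)) / \<phi> 1)" by simp
  qed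
qed (use assms in \<open>auto simp: mod_int_def\<close>)

lemma integral_norm_le_modular:
  fixes f :: "real^'n \<Rightarrow> 'b::euclidean_space"
  assumes "mod_int f" "0 < e"
  shows "(LINT x|\<mu>. norm (f x)) \<le> e * vol + 1 / \<phi> e * (LINT x|\<mu>. \<Phi> (norm (f x)))"
proof -
  have "norm (f x) \<le> e + 1 / \<phi> e * \<Phi> (norm (f x))" for x
    using Phi_ge_linear[of e "norm (f x)"] phi_pos[OF assms(2)] assms(2) by (simp add: field_simps)
  then have "(LINT x|\<mu>. norm (f x)) \<le> (LINT x|\<mu>. e + 1 / \<phi> e * \<Phi> (norm (f x)))"
    using assms(1) mod_int_integrable[OF assms(1)] by (intro integral_mono) (auto simp: mod_int_def)
  also have "\<dots> = e * vol + 1 / \<phi> e * (LINT x|\<mu>. \<Phi> (norm (f x)))"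
    using assms(1) by (simp add: mod_int_def vol_def)
  finally show ?thesis .
qed

lemma modular_small_integral:
  fixes f :: "nat \<Rightarrow> real^'n \<Rightarrow> 'b::euclidean_space"
  assumes "\<And>n. mod_int (f n)" "(\<lambda>n. LINT x|\<mu>. \<Phi> (norm (f n x))) \<longlonglongrightarrow> 0"
  shows "(\<lambda>n. LINT x|\<mu>. norm (f n x)) \<longlonglongrightarrow> 0"
proof (rule tendsto_0_by_small[OF _ assms(2)])
  fix e :: real assume e: "0 < e"
  show "\<exists>C. \<forall>n. \<bar>LINT x|\<mu>. norm (f n x)\<bar> \<le> e * vol + C * (LINT x|\<mu>. \<Phi> (norm (f n x)))"
  proof (intro exI allI)
    fix n
    show "\<bar>LINT x|\<mu>. norm (f n x)\<bar> \<le> e * vol + 1 / \<phi> e * (LINT x|\<mu>. \<Phi> (norm (f n x)))"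
      using integral_norm_le_modular[OF assms(1) e, of n] by simp
  qed
qed

lemma modular_continuous:
  fixes f :: "nat \<Rightarrow> real^'n \<Rightarrow> 'b::euclidean_space"
  assumes f: "\<And>n. mod_int (f n)" and g: "mod_int g" and lim: "(\<lambda>n. LINT x|\<mu>. \<Phi> (norm (f n x - g x))) \<longlonglongrightarrow> 0"
  shows "(\<lambda>n. LINT x|\<mu>. \<Phi> (norm (f n x))) \<longlonglongrightarrow> (LINT x|\<mu>. \<Phi> (norm (g x)))"
proof -
  let ?K = "2 powr (p + q)"
  let ?G = "LINT x|\<mu>. \<Phi> (norm (g x))"
  have "(\<lambda>n. (LINT x|\<mu>. \<Phi> (norm (f n x))) - ?G) \<longlonglongrightarrow> 0"
  proof (rule tendsto_0_by_small[OF _ lim])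
    fix e :: real assume e: "0 < e" "e \<le> 1"
    \<comment> \<open>Collects two contributions of the modular of the difference: the one from
      Young's inequality, and the one that appears when \<open>\<Phi> (norm (f n x))\<close> is
      bounded through \<open>g\<close>.\<close>
    define c where "c = ?K * (e * ?K + (1/e) powr (p + q))"
    show "\<exists>C. \<forall>n. \<bar>(LINT x|\<mu>. \<Phi> (norm (f n x))) - ?G\<bar>
        \<le> e * (?K * ((?K + 1) * ?G)) + C * (LINT x|\<mu>. \<Phi> (norm (f n x - g x)))"
    proof (intro exI[of _ c] allI)
      fix n
      have i: "integrable \<mu> (\<lambda>x. \<Phi> (norm (f n x)))" "integrable \<mu> (\<lambda>x. \<Phi> (norm (g x)))"
        "integrable \<mu> (\<lambda>x. \<Phi> (norm (f n x - g x)))"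
        using f g mod_int_diff[OF f g] by (auto simp: mod_int_def)
      have pw: "\<bar>\<Phi> (norm (f n x)) - \<Phi> (norm (g x))\<bar>
          \<le> e * (?K * ((?K + 1) * \<Phi> (norm (g x)))) + c * \<Phi> (norm (f n x - g x))" for x
      proof -
        have "\<Phi> (norm (f n x)) \<le> ?K * (\<Phi> (norm (g x)) + \<Phi> (norm (f n x - g x)))"
          using Phi_norm_add_le[of "g x" "f n x - g x"] by simp
        then have "?K * (e * \<Phi> (norm (f n x))) \<le> ?K * (e * (?K * (\<Phi> (norm (g x)) + \<Phi> (norm (f n x - g x)))))"
          using e by (intro mult_left_mono) auto
        then show ?thesis
          using Phi_norm_diff_le[OF e, of "f n x" "g x"] unfolding c_def by (simp add: algebra_simps)
      qed
      have "\<bar>(LINT x|\<mu>. \<Phi> (norm (f n x))) - ?G\<bar> \<le> (LINT x|\<mu>. \<bar>\<Phi> (norm (f n x)) - \<Phi> (norm (g x))\<bar>)"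
        using i integral_abs_bound[of \<mu> "\<lambda>x. \<Phi> (norm (f n x)) - \<Phi> (norm (g x))"] by simp
      also have "\<dots> \<le> (LINT x|\<mu>. e * (?K * ((?K + 1) * \<Phi> (norm (g x)))) + c * \<Phi> (norm (f n x - g x)))"
        using i pw by (intro integral_mono) auto
      also have "\<dots> = e * (?K * ((?K + 1) * ?G)) + c * (LINT x|\<mu>. \<Phi> (norm (f n x - g x)))"
        using i by simp
      finally show "\<bar>(LINT x|\<mu>. \<Phi> (norm (f n x))) - ?G\<bar>
        \<le> e * (?K * ((?K + 1) * ?G)) + c * (LINT x|\<mu>. \<Phi> (norm (f n x - g x)))" .
    qed
  qed
  then show ?thesis by (simp add: LIM_zero_iff)
qed

lemma flux_measurable: "f \<in> borel_measurable \<mu> \<Longrightarrow> (\<lambda>x. flux (f x :: 'b::euclidean_space)) \<in> borel_measurable \<mu>"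
  using measurable_compose[OF _ borel_measurable_continuous_onI[OF continuous_on_flux]] .

lemma integrable_flux_inner:
  fixes f g :: "real^'n \<Rightarrow> 'b::euclidean_space"
  assumes "mod_int f" "mod_int g"
  shows "integrable \<mu> (\<lambda>x. flux (f x) \<bullet> g x)"
proof (rule Bochner_Integration.integrable_bound[where f = "\<lambda>x. 2 powr (p + q) * (\<Phi> (norm (f x)) + \<Phi> (norm (g x)))"])
  show "AE x in \<mu>. norm (flux (f x) \<bullet> g x) \<le> norm (2 powr (p + q) * (\<Phi> (norm (f x)) + \<Phi> (norm (g x))))"
  proof (intro AE_I2)
    fix x
    have "\<bar>flux (f x) \<bullet> g x\<bar> \<le> 2 powr (p + q) * (\<Phi> (norm (f x)) + \<Phi> (norm (g x)))"
      using flux_inner_le[of 1 "f x" "g x"] by simp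
    then show "norm (flux (f x) \<bullet> g x) \<le> norm (2 powr (p + q) * (\<Phi> (norm (f x)) + \<Phi> (norm (g x))))"
      unfolding real_norm_def by linarith
  qed
qed (use assms flux_measurable in \<open>auto simp: mod_int_def intro!: borel_measurable_inner\<close>)

text \<open>The modular of \<open>f\<close> stays fixed, so its small coefficient in Young's
  inequality can be absorbed.\<close>

lemma flux_inner_tendsto:
  fixes f h :: "real^'n \<Rightarrow> 'b::euclidean_space"
  assumes f: "mod_int f" and g: "\<And>n. mod_int (g n)" and h: "mod_int h"
    and lim: "(\<lambda>n. LINT x|\<mu>. \<Phi> (norm (g n x - h x))) \<longlonglongrightarrow> 0"
  shows "(\<lambda>n. LINT x|\<mu>. flux (f x) \<bullet> g n x) \<longlonglongrightarrow> (LINT x|\<mu>. flux (f x) \<bullet> h x)"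
proof -
  let ?K = "2 powr (p + q)"
  let ?F = "LINT x|\<mu>. \<Phi> (norm (f x))"
  have "(\<lambda>n. (LINT x|\<mu>. flux (f x) \<bullet> g n x) - (LINT x|\<mu>. flux (f x) \<bullet> h x)) \<longlonglongrightarrow> 0"
  proof (rule tendsto_0_by_small[OF _ lim])
    fix e :: real assume e: "0 < e" "e \<le> 1"
    define c where "c = ?K * (1/e) powr (p + q)"
    show "\<exists>C. \<forall>n. \<bar>(LINT x|\<mu>. flux (f x) \<bullet> g n x) - (LINT x|\<mu>. flux (f x) \<bullet> h x)\<bar>
        \<le> e * (?K * ?F) + C * (LINT x|\<mu>. \<Phi> (norm (g n x - h x)))"
    proof (intro exI[of _ c] allI)
      fix n
      have m: "mod_int (\<lambda>x. g n x - h x)" by (rule mod_int_diff[OF g h])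
      have i: "integrable \<mu> (\<lambda>x. flux (f x) \<bullet> g n x)" "integrable \<mu> (\<lambda>x. flux (f x) \<bullet> h x)"
        "integrable \<mu> (\<lambda>x. \<Phi> (norm (f x)))" "integrable \<mu> (\<lambda>x. \<Phi> (norm (g n x - h x)))"
        using f g h m by (auto simp: mod_int_def intro!: integrable_flux_inner)
      have "\<bar>(LINT x|\<mu>. flux (f x) \<bullet> g n x) - (LINT x|\<mu>. flux (f x) \<bullet> h x)\<bar> = \<bar>LINT x|\<mu>. flux (f x) \<bullet> (g n x - h x)\<bar>"
        using i by (simp add: inner_diff_right)
      also have "\<dots> \<le> (LINT x|\<mu>. \<bar>flux (f x) \<bullet> (g n x - h x)\<bar>)" by (rule integral_abs_bound)
      also have "\<dots> \<le> (LINT x|\<mu>. e * (?K * \<Phi> (norm (f x))) + c * \<Phi> (norm (g n x - h x)))"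
      proof (rule integral_mono)
        show "\<bar>flux (f x) \<bullet> (g n x - h x)\<bar> \<le> e * (?K * \<Phi> (norm (f x))) + c * \<Phi> (norm (g n x - h x))" for x
          using flux_inner_le[OF e, of "f x" "g n x - h x"] by (simp add: c_def algebra_simps)
      qed (use i integrable_flux_inner[OF f m] in auto)
      also have "\<dots> = e * (?K * ?F) + c * (LINT x|\<mu>. \<Phi> (norm (g n x - h x)))" using i by simp
      finally show "\<bar>(LINT x|\<mu>. flux (f x) \<bullet> g n x) - (LINT x|\<mu>. flux (f x) \<bullet> h x)\<bar>
        \<le> e * (?K * ?F) + c * (LINT x|\<mu>. \<Phi> (norm (g n x - h x)))" .
    qed
  qed
  then show ?thesis by (simp add: LIM_zero_iff)
qed

subsection \<open>Orlicz spaces and the Luxemburg norm\<close>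

lemma nn_integral_Phi:
  "mod_int f \<Longrightarrow> (\<integral>\<^sup>+x. ennreal (\<Phi> (norm (f x))) \<partial>\<mu>) = ennreal (LINT x|\<mu>. \<Phi> (norm (f x)))"
  by (rule nn_integral_eq_integral) (auto simp: mod_int_def)

lemma orlicz_class_iff: "u \<in> orlicz_class \<Phi> \<Omega> \<longleftrightarrow> mod_int u"
  unfolding orlicz_class_def mod_int_def integrable_iff_bounded by auto

text \<open>By the growth bound the Orlicz class is closed under sums and multiples, so it equals
  its linear hull.\<close>

lemma orlicz_space_iff: "u \<in> orlicz_space \<Phi> \<Omega> \<longleftrightarrow> mod_int u"
proof
  assume "u \<in> orlicz_space \<Phi> \<Omega>"
  then obtain F c where u: "u = (\<lambda>x. \<Sum>v\<in>F. c v * v x)" and F: "finite F" "F \<subseteq> orlicz_class \<Phi> \<Omega>"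
    by (auto simp: orlicz_space_def)
  have "mod_int (\<lambda>x. \<Sum>v\<in>F. c v * v x)"
    using F
  proof (induction F rule: finite_induct)
    case empty
    then show ?case by (intro mod_int_bounded[where C = 0]) auto
  next
    case (insert v F)
    then show ?case using mod_int_scaleR[of v "c v"] by (auto simp: orlicz_class_iff intro!: mod_int_add)
  qed
  then show "mod_int u" by (simp add: u)
next
  assume "mod_int u"
  then have "{u} \<subseteq> orlicz_class \<Phi> \<Omega>" by (simp add: orlicz_class_iff)
  then show "u \<in> orlicz_space \<Phi> \<Omega>" unfolding orlicz_space_def
    by (intro CollectI exI[of _ "{u}"] exI[of _ "\<lambda>_. 1 :: real"]) simp
qed

text \<open>Dividing by \<open>k \<le> 1\<close> multiplies the modular by at most
  \<open>(1/k) powr (p + q)\<close>, so \<open>k\<close> belongs to the set of the infimum. Modular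
  convergence thus implies norm convergence.\<close>

lemma luxemburg_le:
  assumes f: "mod_int f" and k: "0 < k" "k \<le> 1" and le: "(LINT x|\<mu>. \<Phi> (norm (f x))) \<le> k powr (p + q)"
  shows "luxemburg_norm \<Phi> \<Omega> (\<lambda>x. norm (f x)) \<le> k"
  unfolding luxemburg_norm_def
proof (rule cInf_lower)
  have m: "mod_int (\<lambda>x. (1/k) *\<^sub>R f x)" by (rule mod_int_scaleR[OF f])
  have "(\<integral>\<^sup>+x. ennreal (\<Phi> (norm (f x) / k)) \<partial>\<mu>) = ennreal (LINT x|\<mu>. \<Phi> (norm ((1/k) *\<^sub>R f x)))"
    using nn_integral_Phi[OF m] k by simp
  also have "(LINT x|\<mu>. \<Phi> (norm ((1/k) *\<^sub>R f x))) \<le> (LINT x|\<mu>. (1/k) powr (p + q) * \<Phi> (norm (f x)))"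
    using m f k Phi_scale[of "1/k"] by (intro integral_mono) (auto simp: mod_int_def)
  also have "\<dots> = (1/k) powr (p + q) * (LINT x|\<mu>. \<Phi> (norm (f x)))" by simp
  also have "\<dots> \<le> (1/k) powr (p + q) * k powr (p + q)" using le by (intro mult_left_mono) auto
  also have "\<dots> = 1" using k by (simp add: powr_divide)
  finally show "k \<in> {k. 0 < k \<and> (\<integral>\<^sup>+x. ennreal (\<Phi> (norm (f x) / k)) \<partial>\<mu>) \<le> 1}"
    using k by (simp add: ennreal_leI)
qed (auto intro!: bdd_belowI[of _ 0])

lemma luxemburg_set:
  assumes f: "mod_int f"
  defines "S \<equiv> {k. 0 < k \<and> (\<integral>\<^sup>+x. ennreal (\<Phi> (norm (f x) / k)) \<partial>\<mu>) \<le> 1}"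
  shows "S \<noteq> {}" "\<And>k. k \<in> S \<Longrightarrow> integrable \<mu> (\<lambda>x. \<Phi> (norm (f x) / k)) \<and> (LINT x|\<mu>. \<Phi> (norm (f x) / k)) \<le> 1"
proof -
  let ?A = "LINT x|\<mu>. \<Phi> (norm (f x))"
  have m: "(\<integral>\<^sup>+x. ennreal (\<Phi> (norm (f x) / k)) \<partial>\<mu>) = ennreal (LINT x|\<mu>. \<Phi> (norm (f x) / k))"
    "integrable \<mu> (\<lambda>x. \<Phi> (norm (f x) / k))" if "k > 0" for k
    using nn_integral_Phi[OF mod_int_scaleR[OF f, of "1/k"]] mod_int_scaleR[OF f, of "1/k"] that
    by (auto simp: mod_int_def)
  \<comment> \<open>A witness for nonemptiness, without which the real infimum would carry no
    information: contraction by \<open>1 / ?k\<close> brings the modular down to at most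
    \<open>?A / ?k\<close>.\<close>
  let ?k = "?A + 1"
  have A: "?A \<ge> 0" by simp
  have gen: "0 \<le> 1 / (a + 1)" "1 / (a + 1) \<le> 1" "1 / (a + 1) * a \<le> 1" if "a \<ge> 0" for a :: real
    using that by auto
  note k = gen(1,2)[OF A]
  have "(LINT x|\<mu>. \<Phi> (norm (f x) / ?k)) \<le> (LINT x|\<mu>. (1 / ?k) * \<Phi> (norm (f x)))"
  proof (rule integral_mono)
    show "\<Phi> (norm (f x) / ?k) \<le> (1 / ?k) * \<Phi> (norm (f x))" for x
      using Phi_contract[OF k, of "norm (f x)"] by simp
  qed (use m(2)[of ?k] f A in \<open>auto simp: mod_int_def\<close>)
  also have "\<dots> = 1 / ?k * ?A" by simp
  also have "\<dots> \<le> 1" by (rule gen(3)[OF A])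
  finally have le: "(LINT x|\<mu>. \<Phi> (norm (f x) / ?k)) \<le> 1" .
  have "?k > 0" using A by linarith
  with le have "?k \<in> S" unfolding S_def using m(1)[of ?k] by (simp only: mem_Collect_eq ennreal_le_1 simp_thms)
  then show "S \<noteq> {}" by blast
  show "integrable \<mu> (\<lambda>x. \<Phi> (norm (f x) / k)) \<and> (LINT x|\<mu>. \<Phi> (norm (f x) / k)) \<le> 1" if "k \<in> S" for k
    using m[of k] that unfolding S_def by auto
qed

lemma luxemburg_nonneg: "mod_int f \<Longrightarrow> 0 \<le> luxemburg_norm \<Phi> \<Omega> (\<lambda>x. norm (f x))"
  unfolding luxemburg_norm_def using luxemburg_set(1) by (intro cInf_greatest) auto

text \<open>The direction from norm to modular rests on convexity: an admissible
  \<open>k < e \<le> 1\<close> bounds the modular by \<open>k\<close>, through contraction by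
  \<open>k\<close>.\<close>

lemma luxemburg_lessD:
  assumes f: "mod_int f" and e: "luxemburg_norm \<Phi> \<Omega> (\<lambda>x. norm (f x)) < e" "e \<le> 1"
  shows "(LINT x|\<mu>. \<Phi> (norm (f x))) \<le> e"
proof -
  let ?A = "LINT x|\<mu>. \<Phi> (norm (f x))"
  obtain k where k: "k \<in> {k. 0 < k \<and> (\<integral>\<^sup>+x. ennreal (\<Phi> (norm (f x) / k)) \<partial>\<mu>) \<le> 1}" "k < e"
    using cInf_lessD[OF luxemburg_set(1)[OF f]] e(1) unfolding luxemburg_norm_def by auto
  note i = luxemburg_set(2)[OF f k(1)]
  have k1: "0 < k" "k \<le> 1" using k e(2) by auto
  have "?A \<le> (LINT x|\<mu>. k * \<Phi> (norm (f x) / k))"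
  proof (rule integral_mono)
    show "\<Phi> (norm (f x)) \<le> k * \<Phi> (norm (f x) / k)" for x
      using Phi_contract[of k "norm (f x) / k"] k1 by simp
  qed (use i f in \<open>auto simp: mod_int_def\<close>)
  also have "\<dots> \<le> k * 1" using k1 i by (simp del: mult_1_right)
  finally show ?thesis using k(2) by simp
qed

lemma luxemburg_norm_cong_AE:
  assumes "AE x in \<mu>. u x = v x"
  shows "luxemburg_norm \<Phi> \<Omega> u = luxemburg_norm \<Phi> \<Omega> v"
proof -
  have "(\<integral>\<^sup>+x. ennreal (\<Phi> (u x / k)) \<partial>\<mu>) = (\<integral>\<^sup>+x. ennreal (\<Phi> (v x / k)) \<partial>\<mu>)" for k
    using assms by (intro nn_integral_cong_AE) (auto elim!: eventually_mono)
  then show ?thesis by (simp add: luxemburg_norm_def)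
qed

lemma luxemburg_norm_abs: "luxemburg_norm \<Phi> \<Omega> u = luxemburg_norm \<Phi> \<Omega> (\<lambda>x. norm (u x))"
proof -
  have "{k. k > 0 \<and> (\<integral>\<^sup>+x. ennreal (\<Phi> (u x / k)) \<partial>\<mu>) \<le> 1} = {k. k > 0 \<and> (\<integral>\<^sup>+x. ennreal (\<Phi> (norm (u x) / k)) \<partial>\<mu>) \<le> 1}"
  proof (intro Collect_cong conj_cong refl)
    fix k :: real assume "k > 0"
    then have "\<Phi> (norm (u x) / k) = \<Phi> (u x / k)" for x
      using Phi_abs[of "u x / k"] by (simp add: abs_divide)
    then show "((\<integral>\<^sup>+x. ennreal (\<Phi> (u x / k)) \<partial>\<mu>) \<le> 1) = ((\<integral>\<^sup>+x. ennreal (\<Phi> (norm (u x) / k)) \<partial>\<mu>) \<le> 1)" by simp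
  qed
  then show ?thesis by (simp only: luxemburg_norm_def)
qed

end

section \<open>The variational problem\<close>

lemma norm_grad_compose_le:
  assumes "smooth f" "(h has_real_derivative d) (at (f x))" "\<bar>d\<bar> \<le> 1"
  shows "norm (grad (\<lambda>x. h (f x)) x) \<le> norm (grad f x)"
proof -
  have "grad (\<lambda>x. h (f x)) x = d *\<^sub>R grad f x"
    by (simp add: vec_eq_iff partial_compose[OF assms(1,2)])
  then show ?thesis using assms(3) mult_right_mono[of "\<bar>d\<bar>" 1 "norm (grad f x)"] by simp
qed

lemma grad_add: "smooth f \<Longrightarrow> smooth g \<Longrightarrow> grad (\<lambda>x. f x + g x) x = grad f x + grad g x"
  by (simp add: vec_eq_iff partial_add)

lemma grad_cmult: "smooth f \<Longrightarrow> grad (\<lambda>x. c * f x) x = c *\<^sub>R grad f x"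
  by (simp add: vec_eq_iff partial_cmult)

subsection \<open>Smooth truncation\<close>

text \<open>A smooth substitute for \<open>\<bar>t\<bar>\<close>. Subtracting \<open>e\<close>
  restores the value 0 at 0, so that supports do not grow; the root is written with
  \<open>powr\<close> to fit \<open>smooth_powr\<close>.\<close>

definition smooth_abs :: "real \<Rightarrow> real \<Rightarrow> real" where
  "smooth_abs e t = (t\<^sup>2 + e\<^sup>2) powr (1/2) - e"

lemma smooth_abs_eq: "smooth_abs e t = sqrt (t\<^sup>2 + e\<^sup>2) - e"
  by (simp add: smooth_abs_def powr_half_sqrt)

lemma smooth_abs_bounds:
  assumes "e > 0"
  shows "0 \<le> smooth_abs e t" "smooth_abs e t \<le> \<bar>t\<bar>" "\<bar>t\<bar> - e \<le> smooth_abs e t"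
proof -
  have "sqrt (e\<^sup>2) \<le> sqrt (t\<^sup>2 + e\<^sup>2)" "sqrt (t\<^sup>2) \<le> sqrt (t\<^sup>2 + e\<^sup>2)" by (simp_all only: real_sqrt_le_iff) auto
  moreover have "sqrt (t\<^sup>2 + e\<^sup>2) \<le> \<bar>t\<bar> + e"
    using assms by (intro real_le_lsqrt) (auto simp: power2_sum)
  ultimately show "0 \<le> smooth_abs e t" "smooth_abs e t \<le> \<bar>t\<bar>" "\<bar>t\<bar> - e \<le> smooth_abs e t"
    using assms by (auto simp: smooth_abs_eq)
qed

lemma smooth_abs_0: "e > 0 \<Longrightarrow> smooth_abs e 0 = 0" by (simp add: smooth_abs_eq)

lemma smooth_abs_deriv:
  assumes "e > 0"
  shows "\<exists>d. (smooth_abs e has_real_derivative d) (at t) \<and> \<bar>d\<bar> \<le> 1"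
proof -
  have pos: "t\<^sup>2 + e\<^sup>2 > 0" using assms by (simp add: add_nonneg_pos)
  have "(smooth_abs e has_real_derivative t / sqrt (t\<^sup>2 + e\<^sup>2)) (at t)"
    unfolding smooth_abs_eq[abs_def] using pos
    by (auto intro!: derivative_eq_intros simp: divide_simps)
  moreover have "\<bar>t / sqrt (t\<^sup>2 + e\<^sup>2)\<bar> \<le> 1"
  proof -
    have "sqrt (t\<^sup>2) \<le> sqrt (t\<^sup>2 + e\<^sup>2)" by (simp only: real_sqrt_le_iff) auto
    then show ?thesis using pos by (simp add: abs_divide field_simps)
  qed
  ultimately show ?thesis by blast
qed

lemma smooth_smooth_abs:
  assumes "smooth f" "e > 0"
  shows "smooth (\<lambda>x. smooth_abs e (f x))"
  unfolding smooth_abs_def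
  using assms by (intro smooth_diff smooth_powr smooth_add smooth_power smooth_const) (auto simp: add_nonneg_pos)

text \<open>For positive \<open>t\<close> this is the power mean type expression
  \<open>(t powr (-n) + M powr (-n)) powr (-1/n)\<close>, rewritten so that it makes sense and is
  smooth at 0. For growing \<open>n\<close> it approaches \<open>min t M\<close>.\<close>

definition soft_min :: "real \<Rightarrow> nat \<Rightarrow> real \<Rightarrow> real" where
  "soft_min M n t = t * (1 + (t / M) ^ n) powr (- 1 / real n)"

text \<open>With \<open>y = t / M\<close>, the sum \<open>1 + y ^ n\<close> lies between
  \<open>max 1 (y ^ n)\<close> and twice that maximum. The exponent \<open>- 1 / n\<close> reduces
  the discrepancy to the factor \<open>2 powr (- 1 / n)\<close>, which tends to 1.\<close>

lemma soft_min_bounds: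
  assumes "M > 0" "t \<ge> 0" "n > 0"
  shows "0 \<le> soft_min M n t" "soft_min M n t \<le> min t M" "min t M * 2 powr (- 1 / real n) \<le> soft_min M n t"
proof -
  define y where "y = t / M"
  have y: "y \<ge> 0" "t = M * y" using assms by (auto simp: y_def)
  let ?a = "- 1 / real n"
  have a: "?a < 0" using assms by simp
  have yn: "(y ^ n) powr ?a = inverse y" if "y > 0"
    using that assms by (simp add: powr_powr powr_minus flip: powr_realpow)
  show "0 \<le> soft_min M n t" using assms by (simp add: soft_min_def)
  have le1: "(1 + y ^ n) powr ?a \<le> 1"
    using powr_mono2'[of ?a 1 "1 + y ^ n"] a y by simp
  then have "soft_min M n t \<le> t"
    using assms mult_left_mono[OF le1, of t] by (simp add: soft_min_def y_def)
  moreover have "soft_min M n t \<le> M"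
  proof (cases "y = 0")
    case False
    then have y0: "y > 0" using y by simp
    have "(1 + y ^ n) powr ?a \<le> (y ^ n) powr ?a"
      using a y0 by (intro powr_mono2') auto
    then have "y * (1 + y ^ n) powr ?a \<le> y * inverse y" using y0 yn by (intro mult_left_mono) auto
    then have "M * (y * (1 + y ^ n) powr ?a) \<le> M * 1" using assms y0 by (intro mult_left_mono) auto
    then show ?thesis by (simp add: soft_min_def y_def[symmetric]) (simp add: y mult.assoc)
  qed (use assms y in \<open>simp add: soft_min_def\<close>)
  ultimately show "soft_min M n t \<le> min t M" by simp
  show "min t M * 2 powr ?a \<le> soft_min M n t"
  proof (cases "y \<le> 1")
    case True
    then have "1 + y ^ n \<le> 2" using y power_le_one[of y n] by simp
    then have "2 powr ?a \<le> (1 + y ^ n) powr ?a" using a y by (intro powr_mono2') (auto simp: add_pos_nonneg)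
    then have "t * 2 powr ?a \<le> soft_min M n t" using assms by (simp add: soft_min_def y_def mult_left_mono)
    moreover have "min t M = t" using True assms(1) by (simp add: y_def)
    ultimately show ?thesis by simp
  next
    case False
    then have "1 + y ^ n \<le> 2 * y ^ n" using one_le_power[of y n] by simp
    then have "(2 * y ^ n) powr ?a \<le> (1 + y ^ n) powr ?a" using a y by (intro powr_mono2') (auto simp: add_pos_nonneg)
    moreover have "(2 * y ^ n) powr ?a = 2 powr ?a * inverse y"
      using False yn y(1) by (subst powr_mult) auto
    ultimately have "2 powr ?a * inverse y \<le> (1 + y ^ n) powr ?a" by simp
    then have "t * (2 powr ?a * inverse y) \<le> t * (1 + y ^ n) powr ?a" using assms(2) by (rule mult_left_mono)
    then have "t * (2 powr ?a * inverse y) \<le> soft_min M n t" by (simp only: soft_min_def y_def)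
    moreover have "t * inverse y = M" using False assms(1) by (auto simp: y_def)
    then have "t * (2 powr ?a * inverse y) = M * 2 powr ?a" by (metis mult.assoc mult.commute)
    moreover have "min t M = M" using False assms(1) by (simp add: y_def)
    ultimately show ?thesis by metis
  qed
qed

lemma soft_min_deriv:
  assumes "M > 0" "t \<ge> 0" "n > 0"
  shows "\<exists>d. (soft_min M n has_real_derivative d) (at t) \<and> \<bar>d\<bar> \<le> 1"
proof -
  let ?a = "- 1 / real n" and ?s = "1 + (t / M) ^ n"
  have s: "?s \<ge> 1" using assms by simp
  have "((\<lambda>t. t * (1 + (t / M) ^ n) powr ?a) has_real_derivative
      ?s powr ?a + t * (?a * ?s powr (?a - 1) * (real n * (t / M) ^ (n - 1) * (1 / M)))) (at t)"
  proof -
    have "((\<lambda>t. 1 + (t / M) ^ n) has_real_derivative real n * (t / M) ^ (n - 1) * (1 / M)) (at t)"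
      using assms(1) by (auto intro!: derivative_eq_intros)
    from DERIV_fun_powr[OF this, of ?a]
    have "((\<lambda>t. (1 + (t / M) ^ n) powr ?a) has_real_derivative
        ?a * ?s powr (?a - 1) * (real n * (t / M) ^ (n - 1) * (1 / M))) (at t)" using s by simp
    from DERIV_mult[OF DERIV_ident this] show ?thesis by (simp add: add.commute mult.commute)
  qed
  \<comment> \<open>The two terms collapse into a single power of \<open>?s \<ge> 1\<close> with
    negative exponent, so the derivative lies between 0 and 1 and truncation cannot enlarge a
    gradient.\<close>
  moreover have "?s powr ?a + t * (?a * ?s powr (?a - 1) * (real n * (t / M) ^ (n - 1) * (1 / M))) = ?s powr (?a - 1)"
  proof -
    have "?s powr ?a = ?s powr (?a - 1) * ?s" using s powr_mult_base[of ?s "?a - 1"] by (simp add: mult.commute)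
    moreover have "t * (?a * ?s powr (?a - 1) * (real n * (t / M) ^ (n - 1) * (1 / M)))
        = - (?s powr (?a - 1) * ((t / M) * (t / M) ^ (n - 1)))"
      using assms by (simp add: field_simps)
    moreover have y: "(t / M) * (t / M) ^ (n - 1) = (t / M) ^ n" using assms by (cases n) auto
    have "?s powr (?a - 1) * ?s - ?s powr (?a - 1) * (t / M) ^ n = ?s powr (?a - 1)" by (simp add: algebra_simps)
    ultimately show ?thesis unfolding y by linarith
  qed
  moreover have "?s powr (?a - 1) \<le> 1"
  proof -
    have "?a \<le> 0" by simp
    then have "?a - 1 \<le> 0" by linarith
    from powr_mono2'[OF this zero_less_one s] show ?thesis by simp
  qed
  ultimately show ?thesis unfolding soft_min_def[abs_def] by (intro exI[of _ "?s powr (?a - 1)"]) auto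
qed

lemma smooth_soft_min:
  assumes "smooth f" "\<And>x. f x \<ge> 0" "M > 0"
  shows "smooth (\<lambda>x. soft_min M n (f x))"
proof -
  have "smooth (\<lambda>x. (1 / M) * f x)" using assms by (intro smooth_mult smooth_const)
  then have "smooth (\<lambda>x. f x / M)" by simp
  then show ?thesis unfolding soft_min_def using assms
    by (intro smooth_mult smooth_powr smooth_add smooth_power smooth_const) (auto intro!: add_pos_nonneg)
qed

text \<open>One index drives both smoothing parameters; the limit is
  \<open>min \<bar>t\<bar> M\<close>. The successor keeps \<open>1 / real (Suc n)\<close> positive
  for every \<open>n\<close>.\<close>

definition truncation :: "real \<Rightarrow> nat \<Rightarrow> real \<Rightarrow> real" where
  "truncation M n t = soft_min M (Suc n) (smooth_abs (1 / real (Suc n)) t)"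

lemma truncation_bounds: "M > 0 \<Longrightarrow> 0 \<le> truncation M n t" "M > 0 \<Longrightarrow> truncation M n t \<le> M"
  using soft_min_bounds(1,2)[of M "smooth_abs (1 / real (Suc n)) t" "Suc n"] smooth_abs_bounds(1)[of "1 / real (Suc n)" t]
  by (auto simp: truncation_def)

lemma truncation_deriv:
  assumes "M > 0"
  shows "\<exists>d. (truncation M n has_real_derivative d) (at t) \<and> \<bar>d\<bar> \<le> 1"
proof -
  let ?e = "1 / real (Suc n)"
  obtain d1 where d1: "(smooth_abs ?e has_real_derivative d1) (at t)" "\<bar>d1\<bar> \<le> 1"
    using smooth_abs_deriv[of ?e t] by auto
  obtain d2 where d2: "(soft_min M (Suc n) has_real_derivative d2) (at (smooth_abs ?e t))" "\<bar>d2\<bar> \<le> 1"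
    using soft_min_deriv[OF assms smooth_abs_bounds(1)[of ?e t], of "Suc n"] by auto
  have "(truncation M n has_real_derivative d2 * d1) (at t)"
    unfolding truncation_def[abs_def] using DERIV_chain'[OF d1(1) d2(1)] by simp
  moreover have "\<bar>d2 * d1\<bar> \<le> 1" using d1(2) d2(2) by (simp add: abs_mult mult_le_one)
  ultimately show ?thesis by blast
qed

lemma truncation_test:
  assumes "\<psi> \<in> test_functions \<Omega>" "M > 0"
  shows "(\<lambda>x. truncation M n (\<psi> x)) \<in> test_functions \<Omega>"
proof (rule test_functionsI[OF _ assms(1) assms(1)])
  show "smooth (\<lambda>x. truncation M n (\<psi> x))"
    unfolding truncation_def using assms
    by (intro smooth_soft_min smooth_smooth_abs smooth_abs_bounds test_smooth) auto
  show "truncation M n (\<psi> x) = 0" if "\<psi> x = 0" for x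
    using that smooth_abs_0[of "1 / real (Suc n)"] by (simp add: truncation_def soft_min_def)
qed

lemma truncation_tendsto:
  assumes M: "M > 0"
  shows "(\<lambda>n. truncation M n t) \<longlonglongrightarrow> min \<bar>t\<bar> M"
proof -
  let ?e = "\<lambda>n. 1 / real (Suc n)"
  have e0: "?e \<longlonglongrightarrow> 0" using LIMSEQ_Suc[OF lim_1_over_n[where 'a=real]] by simp
  have b: "min (smooth_abs (?e n) t) M * 2 powr (- ?e n) \<le> truncation M n t"
    "truncation M n t \<le> min (smooth_abs (?e n) t) M" for n
    using soft_min_bounds(2,3)[of M "smooth_abs (?e n) t" "Suc n"] smooth_abs_bounds(1)[of "?e n" t] M
    by (auto simp: truncation_def)
  have s: "(\<lambda>n. smooth_abs (?e n) t) \<longlonglongrightarrow> \<bar>t\<bar>"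
  proof (rule tendsto_sandwich[of "\<lambda>n. \<bar>t\<bar> - ?e n" _ _ "\<lambda>n. \<bar>t\<bar>"])
    show "(\<lambda>n. \<bar>t\<bar> - ?e n) \<longlonglongrightarrow> \<bar>t\<bar>" using tendsto_diff[OF tendsto_const e0, of "\<bar>t\<bar>"] by simp
  qed (use smooth_abs_bounds(2,3) in \<open>auto intro!: always_eventually\<close>)
  have m: "(\<lambda>n. min (smooth_abs (?e n) t) M) \<longlonglongrightarrow> min \<bar>t\<bar> M" by (intro tendsto_intros s)
  have "(\<lambda>n. 2 powr (- ?e n)) \<longlonglongrightarrow> 2 powr (- 0)" by (intro tendsto_intros e0) auto
  from tendsto_mult[OF m this]
  have l: "(\<lambda>n. min (smooth_abs (?e n) t) M * 2 powr (- ?e n)) \<longlonglongrightarrow> min \<bar>t\<bar> M" by simp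
  show ?thesis
    by (rule tendsto_sandwich[OF _ _ l m]) (use b in \<open>auto intro!: always_eventually\<close>)
qed

subsection \<open>The energy functional\<close>

locale variational_problem = orlicz_domain p q \<Omega> for p q :: real and \<Omega> :: "(real^'n::finite) set" +
  fixes r lam :: real
  assumes r_gt_p: "r > p" and lam_pos: "lam > 0"
begin

lemma r_gt_1: "r > 1" using r_gt_p p_gt_1 by simp

definition low :: "real \<Rightarrow> real" where
  "low t = \<bar>t\<bar> powr r / r - lam * (\<bar>t\<bar> powr p / p)"

definition low_bound :: "real \<Rightarrow> real" where
  "low_bound B = B powr r / r + lam * (B powr p / p)"

text \<open>Stated with the classical gradient, since it is evaluated at test functions only. For
  the limit the two integrals are written out with its weak gradient.\<close>

definition energy :: "(real^'n \<Rightarrow> real) \<Rightarrow> real" where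
  "energy \<psi> = (LINT x|\<mu>. \<Phi> (norm (grad \<psi> x))) + (LINT x|\<mu>. low (\<psi> x))"

text \<open>Beyond this bound the lower-order part of the energy is increasing.\<close>

definition bd :: real where "bd = lam powr (1 / (r - p))"

lemma bd_pos: "bd > 0" using lam_pos by (simp add: bd_def)

lemma bd_powr: "bd powr (r - p) = lam"
  using lam_pos r_gt_p by (simp add: bd_def powr_powr)

lemma low_0 [simp]: "low 0 = 0" by (simp add: low_def)
lemma low_abs [simp]: "low \<bar>t\<bar> = low t" by (simp add: low_def)

lemma continuous_on_low: "continuous_on UNIV low"
  unfolding low_def using r_gt_1 p_gt_1
  by (intro continuous_intros continuous_on_powr') auto

lemma low_borel [measurable]: "low \<in> borel_measurable borel"
  by (rule borel_measurable_continuous_onI[OF continuous_on_low])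

lemma abs_low_le: "\<bar>t\<bar> \<le> B \<Longrightarrow> \<bar>low t\<bar> \<le> low_bound B"
proof -
  assume t: "\<bar>t\<bar> \<le> B"
  have "\<bar>t\<bar> powr r / r \<le> B powr r / r" "lam * (\<bar>t\<bar> powr p / p) \<le> lam * (B powr p / p)"
    using t r_gt_1 p_gt_1 lam_pos by (auto intro!: divide_right_mono powr_mono2 mult_left_mono)
  moreover have "0 \<le> \<bar>t\<bar> powr r / r" "0 \<le> lam * (\<bar>t\<bar> powr p / p)" using r_gt_1 p_gt_1 lam_pos by auto
  ultimately show ?thesis unfolding low_def low_bound_def by linarith
qed

text \<open>The derivative is \<open>x powr (p - 1) * (x powr (r - p) - lam)\<close>, and
  \<open>bd\<close> is the zero of the second factor.\<close>

lemma low_mono: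
  assumes "bd \<le> s" "s \<le> t"
  shows "low s \<le> low t"
proof (rule DERIV_nonneg_imp_increasing_open[OF assms(2)])
  fix x assume x: "s < x" "x < t"
  then have x0: "x > 0" using assms bd_pos by simp
  have "((\<lambda>t. t powr r / r - lam * (t powr p / p)) has_real_derivative x powr (r - 1) - lam * x powr (p - 1)) (at x)"
    using x0 r_gt_1 p_gt_1 by (auto intro!: derivative_eq_intros)
  then have "(low has_real_derivative x powr (r - 1) - lam * x powr (p - 1)) (at x)"
    by (rule DERIV_cong_ev[THEN iffD1, rotated 3])
      (use x0 in \<open>auto simp: low_def intro: eventually_mono[OF eventually_nhds_in_open[of "{0<..}"]]\<close>)
  moreover have "lam \<le> x powr (r - p)"
    using powr_mono2[of "r - p" bd x] x assms bd_pos r_gt_p bd_powr by simp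
  then have "lam * x powr (p - 1) \<le> x powr (r - p) * x powr (p - 1)" by (intro mult_right_mono) auto
  then have "0 \<le> x powr (r - 1) - lam * x powr (p - 1)" by (simp flip: powr_add)
  ultimately show "\<exists>y. (low has_real_derivative y) (at x) \<and> 0 \<le> y" by blast
qed (rule continuous_on_subset[OF continuous_on_low], simp)

lemma low_min_le: "low (min \<bar>t\<bar> bd) \<le> low t"
  using low_mono[of bd "\<bar>t\<bar>"] by (cases "\<bar>t\<bar> \<le> bd") (auto simp: min_def)

lemma low_ge: "low t \<ge> - low_bound bd"
proof -
  have "\<bar>low (min \<bar>t\<bar> bd)\<bar> \<le> low_bound bd" using bd_pos by (intro abs_low_le) auto
  then show ?thesis using low_min_le[of t] by linarith
qed

lemma integrable_low:
  assumes "f \<in> borel_measurable \<mu>" "\<And>x. \<bar>f x\<bar> \<le> B"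
  shows "integrable \<mu> (\<lambda>x. low (f x))"
  using assms by (intro integrable_const_bound[where B = "low_bound B"]) (auto simp: abs_low_le)

lemma tendsto_integral_low:
  assumes "\<And>n. f n \<in> borel_measurable \<mu>" "g \<in> borel_measurable \<mu>" "\<And>n x. \<bar>f n x\<bar> \<le> B"
    and "AE x in \<mu>. (\<lambda>n. f n x) \<longlonglongrightarrow> g x"
  shows "(\<lambda>n. LINT x|\<mu>. low (f n x)) \<longlonglongrightarrow> (LINT x|\<mu>. low (g x))"
proof (rule integral_dominated_convergence[where w = "\<lambda>x. low_bound B"])
  show "AE x in \<mu>. (\<lambda>n. low (f n x)) \<longlonglongrightarrow> low (g x)"
    using assms(4) by (rule eventually_mono) (rule continuous_on_tendsto_compose[OF continuous_on_low], auto)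
qed (use assms in \<open>auto simp: abs_low_le\<close>)

lemma test_measurable: "\<psi> \<in> test_functions \<Omega> \<Longrightarrow> \<psi> \<in> borel_measurable \<mu>"
  by (intro continuous_\<mu> smooth_continuous test_smooth)

lemma test_low_integrable: "\<psi> \<in> test_functions \<Omega> \<Longrightarrow> integrable \<mu> (\<lambda>x. low (\<psi> x))"
  by (metis integrable_low test_measurable test_bounded)

lemma test_grad_mod: "\<psi> \<in> test_functions \<Omega> \<Longrightarrow> mod_int (grad \<psi>)"
proof -
  assume \<psi>: "\<psi> \<in> test_functions \<Omega>"
  obtain C where "\<And>x. norm (grad \<psi> x) \<le> C" using test_grad_bounded[OF \<psi>] by blast
  then show ?thesis
    by (intro mod_int_bounded[where C = C] continuous_\<mu> continuous_on_grad test_smooth[OF \<psi>]) auto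
qed

text \<open>Coercivity: the lower-order part is bounded below and \<Omega> has finite volume, so the
  energy controls the gradient.\<close>

lemma modular_le_energy:
  assumes "\<psi> \<in> test_functions \<Omega>"
  shows "(LINT x|\<mu>. \<Phi> (norm (grad \<psi> x))) \<le> energy \<psi> + low_bound bd * vol"
proof -
  have "(LINT x|\<mu>. low (\<psi> x)) \<ge> (LINT x|\<mu>. - low_bound bd)"
    using assms low_ge by (intro integral_mono test_low_integrable) auto
  then show ?thesis unfolding energy_def integral_const_\<mu> by (simp add: mult.commute)
qed

text \<open>The smooth truncation never enlarges the gradient term, but the lower-order term is
  compared only in the limit of exact truncation. This is where \<epsilon> is lost.\<close>

lemma energy_truncation:
  assumes \<psi>: "\<psi> \<in> test_functions \<Omega>" and "\<epsilon> > 0"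
  shows "\<exists>\<psi>'\<in>test_functions \<Omega>. (\<forall>x. 0 \<le> \<psi>' x \<and> \<psi>' x \<le> bd) \<and> energy \<psi>' < energy \<psi> + \<epsilon>"
proof -
  define T where "T n x = truncation bd n (\<psi> x)" for n x
  have T: "T n \<in> test_functions \<Omega>" "0 \<le> T n x" "T n x \<le> bd" for n x
    using truncation_test[OF \<psi> bd_pos] truncation_bounds[OF bd_pos] unfolding T_def by auto
  have gr: "(LINT x|\<mu>. \<Phi> (norm (grad (T n) x))) \<le> (LINT x|\<mu>. \<Phi> (norm (grad \<psi> x)))" for n
  proof (rule integral_mono)
    show "\<Phi> (norm (grad (T n) x)) \<le> \<Phi> (norm (grad \<psi> x))" for x
    proof -
      obtain d where "(truncation bd n has_real_derivative d) (at (\<psi> x))" "\<bar>d\<bar> \<le> 1"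
        using truncation_deriv[OF bd_pos] by blast
      from norm_grad_compose_le[OF test_smooth[OF \<psi>] this] show ?thesis
        unfolding T_def by (intro Phi_mono) auto
    qed
  qed (use test_grad_mod[OF \<psi>] test_grad_mod[OF T(1)] in \<open>auto simp: mod_int_def\<close>)
  have m: "(\<lambda>x. min \<bar>\<psi> x\<bar> bd) \<in> borel_measurable \<mu>" using test_measurable[OF \<psi>] by measurable
  have "(\<lambda>n. LINT x|\<mu>. low (T n x)) \<longlonglongrightarrow> (LINT x|\<mu>. low (min \<bar>\<psi> x\<bar> bd))"
    using T(2,3) by (intro tendsto_integral_low[where B = bd] m test_measurable[OF T(1)] AE_I2)
      (auto simp: T_def intro: truncation_tendsto[OF bd_pos])
  moreover have le: "(LINT x|\<mu>. low (min \<bar>\<psi> x\<bar> bd)) \<le> (LINT x|\<mu>. low (\<psi> x))"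
    using m bd_pos by (intro integral_mono low_min_le test_low_integrable[OF \<psi>] integrable_low[where B = bd]) auto
  ultimately have "eventually (\<lambda>n. (LINT x|\<mu>. low (T n x)) < (LINT x|\<mu>. low (\<psi> x)) + \<epsilon>) sequentially"
    using assms(2) by (intro order_tendstoD(2)) auto
  then obtain n where "(LINT x|\<mu>. low (T n x)) < (LINT x|\<mu>. low (\<psi> x)) + \<epsilon>"
    by (auto simp: eventually_sequentially)
  then have "energy (T n) < energy \<psi> + \<epsilon>" using gr[of n] by (simp add: energy_def)
  then show ?thesis using T by blast
qed

end

subsection \<open>Hidden convexity\<close>

text \<open>Hoelder's inequality for an average of two terms, with exponents
  \<open>p / (p - 1)\<close> and \<open>p\<close>. In the application \<alpha>, \<beta> are
  regularized function values and \<open>X\<close>, \<open>Y\<close> gradient norms.\<close>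

lemma powr_mean_quotient_le:
  fixes \<alpha> \<beta> X Y p :: real
  assumes "p > 1" "\<alpha> > 0" "\<beta> > 0" "X \<ge> 0" "Y \<ge> 0"
  defines "S \<equiv> (\<alpha> powr p + \<beta> powr p) / 2"
  shows "(S powr (1/p - 1) * ((\<alpha> powr (p - 1) * X + \<beta> powr (p - 1) * Y) / 2)) powr p \<le> (X powr p + Y powr p) / 2"
proof -
  define Z where "Z = S powr (1/p - 1) * ((\<alpha> powr (p - 1) * X + \<beta> powr (p - 1) * Y) / 2)"
  have S: "S > 0" unfolding S_def using assms by (simp add: add_pos_pos)
  \<comment> \<open>With this \<open>c\<close> the weighted average equals \<open>c * S\<close>, so
    the linear terms of the tangents at \<open>\<alpha> * c\<close> and \<open>\<beta> * c\<close>
    cancel in the mean.\<close>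
  define c where "c = Z / S powr (1/p)"
  have Z0: "Z \<ge> 0" unfolding Z_def using assms by (intro mult_nonneg_nonneg) auto
  then have c0: "c \<ge> 0" unfolding c_def by simp
  have Zp: "Z powr p = c powr p * S"
    using S Z0 assms(1) unfolding c_def by (simp add: powr_divide powr_powr)
  have "(\<alpha> powr (p - 1) * X + \<beta> powr (p - 1) * Y) / 2 = S powr (1 - 1/p) * Z"
    using S unfolding Z_def by (simp flip: powr_add mult.assoc)
  also have "\<dots> = c * S"
    using S unfolding c_def by (simp add: powr_diff)
  finally have avg: "(\<alpha> powr (p - 1) * X + \<beta> powr (p - 1) * Y) / 2 = c * S" .
  have t: "W powr p \<ge> c powr p * \<gamma> powr p + p * c powr (p - 1) * (\<gamma> powr (p - 1) * W - c * \<gamma> powr p)"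
    if "W \<ge> 0" "\<gamma> > 0" for W \<gamma>
  proof -
    have g: "\<gamma> powr (p - 1) * \<gamma> = \<gamma> powr p" using powr_mult_base[of \<gamma> "p - 1"] that by (simp add: mult.commute)
    have "W powr p \<ge> (\<gamma> * c) powr p + p * (\<gamma> * c) powr (p - 1) * (W - \<gamma> * c)"
      using powr_ge_tangent[of p "\<gamma> * c" W] that assms c0 by simp
    also have "(\<gamma> * c) powr p + p * (\<gamma> * c) powr (p - 1) * (W - \<gamma> * c)
      = c powr p * \<gamma> powr p + p * c powr (p - 1) * (\<gamma> powr (p - 1) * W - c * (\<gamma> powr (p - 1) * \<gamma>))"
      using that c0 by (simp add: powr_mult algebra_simps)
    finally show ?thesis unfolding g .
  qed
  have "(X powr p + Y powr p) / 2 \<ge> c powr p * S + p * c powr (p - 1) *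
     ((\<alpha> powr (p - 1) * X + \<beta> powr (p - 1) * Y) / 2 - c * S)"
    using t[OF assms(4,2)] t[OF assms(5,3)] unfolding S_def by (simp add: algebra_simps add_divide_distrib)
  then have "Z powr p \<le> (X powr p + Y powr p) / 2" unfolding avg Zp by simp
  then show ?thesis unfolding Z_def .
qed

text \<open>The two shifts by \<open>e\<close> make the \<open>p\<close>-th power mean smooth at the origin while keeping its value 0 there,
  so that it maps test functions to test functions.\<close>

definition pmean :: "real \<Rightarrow> real \<Rightarrow> real \<Rightarrow> real \<Rightarrow> real" where
  "pmean p e s t = (((s\<^sup>2 + e\<^sup>2) powr (p/2) + (t\<^sup>2 + e\<^sup>2) powr (p/2)) / 2) powr (1/p) - e"

lemma pmean_arg_pos:
  fixes e s t p :: real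
  assumes "e > 0"
  shows "s\<^sup>2 + e\<^sup>2 > 0" "((s\<^sup>2 + e\<^sup>2) powr (p/2) + (t\<^sup>2 + e\<^sup>2) powr (p/2)) / 2 > 0"
proof -
  have *: "s\<^sup>2 + e\<^sup>2 > 0" for s using assms by (intro add_nonneg_pos) auto
  show "s\<^sup>2 + e\<^sup>2 > 0" by (rule *)
  have "(s\<^sup>2 + e\<^sup>2) powr (p/2) > 0" for s using *[of s] unfolding powr_gt_zero by (metis less_irrefl)
  then show "((s\<^sup>2 + e\<^sup>2) powr (p/2) + (t\<^sup>2 + e\<^sup>2) powr (p/2)) / 2 > 0" by (simp add: add_pos_pos)
qed

text \<open>The averaged numbers are \<open>sqrt (u\<^sup>2 + e\<^sup>2)\<close> for
  \<open>u = s, t\<close>. They lie between \<open>e\<close> and \<open>B + e\<close>, hence so does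
  their power mean.\<close>

lemma pmean_bounds:
  assumes "e > 0" "p > 0" "\<bar>s\<bar> \<le> B" "\<bar>t\<bar> \<le> B"
  shows "0 \<le> pmean p e s t" "pmean p e s t \<le> B"
proof -
  have e2: "(e\<^sup>2) powr (p/2) = e powr p" using assms(1,2) by (simp add: powr_powr flip: powr_numeral)
  have B2: "((B + e)\<^sup>2) powr (p/2) = (B + e) powr p" using assms by (simp add: powr_powr flip: powr_numeral)
  have lo: "e powr p \<le> (u\<^sup>2 + e\<^sup>2) powr (p/2)" for u
    using powr_mono2[of "p/2" "e\<^sup>2" "u\<^sup>2 + e\<^sup>2"] assms unfolding e2 by simp
  have hi: "(u\<^sup>2 + e\<^sup>2) powr (p/2) \<le> (B + e) powr p" if "\<bar>u\<bar> \<le> B" for u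
  proof -
    have "u\<^sup>2 \<le> B\<^sup>2" using that by (simp add: abs_le_square_iff[symmetric])
    moreover have "0 \<le> B * e" using that assms by simp
    ultimately have "u\<^sup>2 + e\<^sup>2 \<le> (B + e)\<^sup>2" by (simp add: power2_sum)
    then show ?thesis using powr_mono2[of "p/2" "u\<^sup>2 + e\<^sup>2" "(B + e)\<^sup>2"] assms unfolding B2 by simp
  qed
  let ?S = "((s\<^sup>2 + e\<^sup>2) powr (p/2) + (t\<^sup>2 + e\<^sup>2) powr (p/2)) / 2"
  have "(e powr p) powr (1/p) \<le> ?S powr (1/p)"
    using lo[of s] lo[of t] assms by (intro powr_mono2) auto
  then show "0 \<le> pmean p e s t" using assms by (simp add: pmean_def powr_powr)
  have "?S powr (1/p) \<le> ((B + e) powr p) powr (1/p)"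
    using hi[of s] hi[of t] assms by (intro powr_mono2) auto
  then show "pmean p e s t \<le> B" using assms by (simp add: pmean_def powr_powr)
qed

lemma pmean_0: "e > 0 \<Longrightarrow> p > 0 \<Longrightarrow> pmean p e 0 0 = 0"
  using pmean_bounds[of e p 0 0 0] by simp

lemma pmean_tendsto:
  assumes "p > 0"
  shows "(\<lambda>n. pmean p (1 / real (Suc n)) s t) \<longlonglongrightarrow> ((\<bar>s\<bar> powr p + \<bar>t\<bar> powr p) / 2) powr (1/p)"
proof -
  let ?e = "\<lambda>n. 1 / real (Suc n)"
  have e0: "?e \<longlonglongrightarrow> 0" using LIMSEQ_Suc[OF lim_1_over_n[where 'a=real]] by simp
  have u: "(\<lambda>n. (u\<^sup>2 + (?e n)\<^sup>2) powr (p/2)) \<longlonglongrightarrow> \<bar>u\<bar> powr p" for u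
  proof -
    have "(\<lambda>n. (u\<^sup>2 + (?e n)\<^sup>2) powr (p/2)) \<longlonglongrightarrow> (u\<^sup>2 + 0\<^sup>2) powr (p/2)"
      by (rule tendsto_powr'[OF tendsto_add[OF tendsto_const tendsto_power[OF e0]] tendsto_const]) (use assms in auto)
    moreover have "(u\<^sup>2) powr (p/2) = \<bar>u\<bar> powr p"
      using powr_powr[of "\<bar>u\<bar>" 2 "p/2"] by (cases "u = 0") auto
    ultimately show ?thesis by simp
  qed
  have "(\<lambda>n. (((s\<^sup>2 + (?e n)\<^sup>2) powr (p/2) + (t\<^sup>2 + (?e n)\<^sup>2) powr (p/2)) / 2) powr (1/p) - ?e n)
     \<longlonglongrightarrow> ((\<bar>s\<bar> powr p + \<bar>t\<bar> powr p) / 2) powr (1/p) - 0"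
    by (rule tendsto_diff[OF tendsto_powr'[OF tendsto_divide[OF tendsto_add[OF u u] tendsto_const] tendsto_const] e0])
      (use assms in auto)
  then show ?thesis by (simp add: pmean_def)
qed

context
  fixes \<psi>1 \<psi>2 :: "real^'n::finite \<Rightarrow> real" and e p :: real
  assumes sm: "smooth \<psi>1" "smooth \<psi>2" and e: "e > 0" and p1: "p > 1"
begin

lemma smooth_pmean_part: "smooth f \<Longrightarrow> smooth (\<lambda>x. 1/2 * ((f x)\<^sup>2 + e\<^sup>2) powr (p/2))"
  using e by (intro smooth_mult smooth_powr smooth_add smooth_power smooth_const) (auto simp: add_nonneg_pos)

lemma smooth_pmean: "smooth (\<lambda>x. pmean p e (\<psi>1 x) (\<psi>2 x))"
proof -
  have "smooth (\<lambda>x. (1/2 * ((\<psi>1 x)\<^sup>2 + e\<^sup>2) powr (p/2) + 1/2 * ((\<psi>2 x)\<^sup>2 + e\<^sup>2) powr (p/2)) powr (1/p) - e)"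
    using pmean_arg_pos(2)[OF e]
    by (intro smooth_diff smooth_powr smooth_add smooth_pmean_part sm smooth_const) (auto simp: add_divide_distrib)
  then show ?thesis by (simp add: pmean_def add_divide_distrib)
qed

lemma partial_pmean_part:
  assumes "smooth f"
  shows "partial i (\<lambda>x. 1/2 * ((f x)\<^sup>2 + e\<^sup>2) powr (p/2)) x
    = p / 2 * ((f x)\<^sup>2 + e\<^sup>2) powr (p/2 - 1) * f x * partial i f x"
proof (rule partial_compose[OF assms, where h = "\<lambda>t. 1/2 * (t\<^sup>2 + e\<^sup>2) powr (p/2)"])
  have pos: "(f x)\<^sup>2 + e\<^sup>2 > 0" by (rule pmean_arg_pos(1)[OF e])
  have "((\<lambda>t. t\<^sup>2 + e\<^sup>2) has_real_derivative 2 * f x) (at (f x))"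
    by (auto intro!: derivative_eq_intros)
  from DERIV_cmult[OF DERIV_fun_powr[OF this pos, of "p/2"], of "1/2"]
  show "((\<lambda>t. 1/2 * (t\<^sup>2 + e\<^sup>2) powr (p/2)) has_real_derivative p / 2 * ((f x)\<^sup>2 + e\<^sup>2) powr (p/2 - 1) * f x) (at (f x))"
    by (simp add: mult.assoc)
qed

text \<open>The chain rule produces a factor \<open>f x\<close> in the gradient of each part;
  estimating it by \<open>sqrt ((f x)\<^sup>2 + e\<^sup>2)\<close> gives the weights to which the
  Hoelder bound applies.\<close>

lemma norm_grad_pmean_le:
  defines "\<alpha> \<equiv> \<lambda>x. ((\<psi>1 x)\<^sup>2 + e\<^sup>2) powr (1/2)" and "\<beta> \<equiv> \<lambda>x. ((\<psi>2 x)\<^sup>2 + e\<^sup>2) powr (1/2)"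
  shows "norm (grad (\<lambda>x. pmean p e (\<psi>1 x) (\<psi>2 x)) x) \<le> (((\<alpha> x) powr p + (\<beta> x) powr p) / 2) powr (1/p - 1) *
     ((\<alpha> x powr (p - 1) * norm (grad \<psi>1 x) + \<beta> x powr (p - 1) * norm (grad \<psi>2 x)) / 2)"
proof -
  define S where "S x = 1/2 * ((\<psi>1 x)\<^sup>2 + e\<^sup>2) powr (p/2) + 1/2 * ((\<psi>2 x)\<^sup>2 + e\<^sup>2) powr (p/2)" for x
  have Ssm: "smooth S" unfolding S_def by (intro smooth_add smooth_pmean_part sm)
  have Seq: "S x = (\<alpha> x powr p + \<beta> x powr p) / 2"
    by (simp add: S_def \<alpha>_def \<beta>_def powr_powr add_divide_distrib)
  have S0: "S x > 0" using pmean_arg_pos(2)[OF e] by (simp add: S_def add_divide_distrib)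
  define F where "F f x = (((f x)\<^sup>2 + e\<^sup>2) powr (p/2 - 1) * f x) *\<^sub>R grad f x" for f and x :: "real^'n"
  have "partial i (\<lambda>x. pmean p e (\<psi>1 x) (\<psi>2 x)) x = 1/p * S x powr (1/p - 1) * partial i S x" for i
  proof -
    have "((\<lambda>t. t powr (1/p) - e) has_real_derivative 1/p * S x powr (1/p - 1)) (at (S x))"
      using S0 p1 by (auto intro!: derivative_eq_intros)
    from partial_compose[OF Ssm this]
    have "partial i (\<lambda>x. S x powr (1/p) - e) x = 1/p * S x powr (1/p - 1) * partial i S x" .
    moreover have "(\<lambda>x. S x powr (1/p) - e) = (\<lambda>x. pmean p e (\<psi>1 x) (\<psi>2 x))"
      by (simp add: pmean_def S_def add_divide_distrib)
    ultimately show ?thesis by simp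
  qed
  moreover have "partial i S x = p / 2 * (F \<psi>1 x $ i + F \<psi>2 x $ i)" for i
    unfolding S_def F_def
    by (subst partial_add[OF smooth_pmean_part[OF sm(1)] smooth_pmean_part[OF sm(2)]])
      (simp only: partial_pmean_part[OF sm(1)] partial_pmean_part[OF sm(2)], simp add: algebra_simps)
  ultimately have "grad (\<lambda>x. pmean p e (\<psi>1 x) (\<psi>2 x)) x = (S x powr (1/p - 1) / 2) *\<^sub>R (F \<psi>1 x + F \<psi>2 x)"
    using p1 by (simp add: vec_eq_iff)
  then have "norm (grad (\<lambda>x. pmean p e (\<psi>1 x) (\<psi>2 x)) x) \<le> S x powr (1/p - 1) / 2 * (norm (F \<psi>1 x) + norm (F \<psi>2 x))"
    using norm_triangle_ineq[of "F \<psi>1 x" "F \<psi>2 x"] by (simp add: mult_left_mono)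
  moreover have FF: "norm (F f x) \<le> (((f x)\<^sup>2 + e\<^sup>2) powr (1/2)) powr (p - 1) * norm (grad f x)" for f
  proof -
    let ?a = "(f x)\<^sup>2 + e\<^sup>2"
    have a: "?a > 0" by (rule pmean_arg_pos(1)[OF e])
    have "sqrt ((f x)\<^sup>2) \<le> sqrt ?a" by (simp only: real_sqrt_le_iff) simp
    then have "\<bar>f x\<bar> \<le> ?a powr (1/2)" using a by (simp add: powr_half_sqrt)
    then have "?a powr (p/2 - 1) * \<bar>f x\<bar> \<le> ?a powr (p/2 - 1) * ?a powr (1/2)" by (intro mult_left_mono) auto
    also have "\<dots> = (?a powr (1/2)) powr (p - 1)"
      by (simp add: powr_powr diff_divide_distrib flip: powr_add)
    finally show ?thesis by (simp add: F_def abs_mult mult_right_mono)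
  qed
  have "S x powr (1/p - 1) / 2 * (norm (F \<psi>1 x) + norm (F \<psi>2 x)) \<le> S x powr (1/p - 1) / 2 *
    (\<alpha> x powr (p - 1) * norm (grad \<psi>1 x) + \<beta> x powr (p - 1) * norm (grad \<psi>2 x))"
    unfolding \<alpha>_def \<beta>_def by (intro mult_left_mono add_mono FF) auto
  ultimately show ?thesis unfolding Seq by (simp only: times_divide_eq_left times_divide_eq_right)
qed

end

text \<open>Hidden convexity in pointwise form: the Hoelder bound controls the p-th power of the
  gradient norm of the mean, and \<Phi> is convex and increasing in that power.\<close>

lemma (in log_orlicz) Phi_grad_pmean_le:
  assumes "smooth \<psi>1" "smooth \<psi>2" "e > 0"
  shows "\<Phi> (norm (grad (\<lambda>x. pmean p e (\<psi>1 x) (\<psi>2 x)) x))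
    \<le> (\<Phi> (norm (grad \<psi>1 x)) + \<Phi> (norm (grad \<psi>2 x))) / 2"
proof -
  let ?a = "((\<psi>1 x)\<^sup>2 + e\<^sup>2) powr (1/2)" and ?b = "((\<psi>2 x)\<^sup>2 + e\<^sup>2) powr (1/2)"
  let ?Z = "((?a powr p + ?b powr p) / 2) powr (1/p - 1) *
     ((?a powr (p - 1) * norm (grad \<psi>1 x) + ?b powr (p - 1) * norm (grad \<psi>2 x)) / 2)"
  have ab: "?a > 0" "?b > 0" using pmean_arg_pos(1)[OF assms(3)] by (metis powr_gt_zero less_irrefl)+
  have "\<Phi> (norm (grad (\<lambda>x. pmean p e (\<psi>1 x) (\<psi>2 x)) x)) \<le> \<Phi> ?Z"
    by (intro Phi_mono norm_grad_pmean_le assms p_gt_1) auto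
  also have "\<dots> \<le> (\<Phi> (norm (grad \<psi>1 x)) + \<Phi> (norm (grad \<psi>2 x))) / 2"
    by (intro Phi_powr_mean_le powr_mean_quotient_le p_gt_1 ab mult_nonneg_nonneg) auto
  finally show ?thesis .
qed

context variational_problem
begin

text \<open>The Diaz-Saa phenomenon: along power means the gradient part of the energy is convex and the
  term with \<open>lam\<close> is affine, so that only the last term contributes to the defect.\<close>

lemma powr_gap_le_energy_gap:
  assumes \<psi>: "\<psi>1 \<in> test_functions \<Omega>" "\<psi>2 \<in> test_functions \<Omega>"
    and m: "\<And>\<psi>. \<psi> \<in> test_functions \<Omega> \<Longrightarrow> m \<le> energy \<psi>"
  shows "(LINT x|\<mu>. (\<bar>\<psi>1 x\<bar> powr r + \<bar>\<psi>2 x\<bar> powr r) / 2 - ((\<bar>\<psi>1 x\<bar> powr p + \<bar>\<psi>2 x\<bar> powr p) / 2) powr (r / p))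
    \<le> r * ((energy \<psi>1 + energy \<psi>2) / 2 - m)"
proof -
  define D where "D x = (\<bar>\<psi>1 x\<bar> powr r + \<bar>\<psi>2 x\<bar> powr r) / 2 - ((\<bar>\<psi>1 x\<bar> powr p + \<bar>\<psi>2 x\<bar> powr p) / 2) powr (r / p)" for x
  define w where "w n x = pmean p (1 / real (Suc n)) (\<psi>1 x) (\<psi>2 x)" for n x
  \<comment> \<open>The exact power mean, to which the smooth competitors \<open>w n\<close>
    converge. Only its lower-order integral is used: the gradient term is bounded uniformly in
    \<open>n\<close> before the limit.\<close>
  define w0 where "w0 x = ((\<bar>\<psi>1 x\<bar> powr p + \<bar>\<psi>2 x\<bar> powr p) / 2) powr (1/p)" for x
  obtain C1 where C1: "\<And>x. \<bar>\<psi>1 x\<bar> \<le> C1" using test_bounded[OF \<psi>(1)] by blast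
  obtain C2 where C2: "\<And>x. \<bar>\<psi>2 x\<bar> \<le> C2" using test_bounded[OF \<psi>(2)] by blast
  define B where "B = max C1 C2"
  have B: "\<bar>\<psi>1 x\<bar> \<le> B" "\<bar>\<psi>2 x\<bar> \<le> B" for x using C1[of x] C2[of x] by (auto simp: B_def)
  note sm = test_smooth[OF \<psi>(1)] test_smooth[OF \<psi>(2)]
  note meas = test_measurable[OF \<psi>(1)] test_measurable[OF \<psi>(2)]
  have wt: "w n \<in> test_functions \<Omega>" for n
  proof (rule test_functionsI[OF _ \<psi>])
    show "smooth (w n)" unfolding w_def using p_gt_1 by (intro smooth_pmean sm) auto
  qed (use pmean_0[of "1 / real (Suc n)" p] p_gt_1 in \<open>simp add: w_def\<close>)
  have wb: "\<bar>w n x\<bar> \<le> B" for n x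
    using pmean_bounds[of "1 / real (Suc n)" p "\<psi>1 x" B "\<psi>2 x"] B p_gt_1 by (simp add: w_def)
  have w0m: "w0 \<in> borel_measurable \<mu>" unfolding w0_def using meas by measurable
  have i: "integrable \<mu> (\<lambda>x. \<Phi> (norm (grad \<psi>1 x)))" "integrable \<mu> (\<lambda>x. \<Phi> (norm (grad \<psi>2 x)))"
    "integrable \<mu> (\<lambda>x. \<Phi> (norm (grad (w n) x)))" "integrable \<mu> (\<lambda>x. low (\<psi>1 x))" "integrable \<mu> (\<lambda>x. low (\<psi>2 x))" for n
    using test_grad_mod[OF \<psi>(1)] test_grad_mod[OF \<psi>(2)] test_grad_mod[OF wt] test_low_integrable \<psi>
    by (auto simp: mod_int_def)
  let ?G = "((LINT x|\<mu>. \<Phi> (norm (grad \<psi>1 x))) + (LINT x|\<mu>. \<Phi> (norm (grad \<psi>2 x)))) / 2"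
  have g: "(LINT x|\<mu>. \<Phi> (norm (grad (w n) x))) \<le> ?G" for n
  proof -
    have "(LINT x|\<mu>. \<Phi> (norm (grad (w n) x))) \<le> (LINT x|\<mu>. (\<Phi> (norm (grad \<psi>1 x)) + \<Phi> (norm (grad \<psi>2 x))) / 2)"
      using i unfolding w_def by (intro integral_mono Phi_grad_pmean_le sm) auto
    then show ?thesis using i by simp
  qed
  have "m - ?G \<le> (LINT x|\<mu>. low (w n x))" for n
    using m[OF wt[of n]] g[of n] unfolding energy_def by linarith
  moreover have "(\<lambda>n. LINT x|\<mu>. low (w n x)) \<longlonglongrightarrow> (LINT x|\<mu>. low (w0 x))"
    using p_gt_1 by (intro tendsto_integral_low[where B = B] test_measurable[OF wt] w0m wb AE_I2)
      (auto simp: w_def w0_def simp del: of_nat_Suc intro!: pmean_tendsto)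
  ultimately have ml: "m - ?G \<le> (LINT x|\<mu>. low (w0 x))" by (intro LIMSEQ_le_const) auto
  have w0b: "\<bar>w0 x\<bar> \<le> B" for x
    using wb[of _ x] pmean_tendsto[of p "\<psi>1 x" "\<psi>2 x"] p_gt_1
    by (intro LIMSEQ_le_const2[OF tendsto_rabs[OF pmean_tendsto[of p "\<psi>1 x" "\<psi>2 x", folded w0_def]]]) (auto simp: w_def)
  have iw: "integrable \<mu> (\<lambda>x. low (w0 x))" by (rule integrable_low[OF w0m w0b])
  \<comment> \<open>\<open>w0 x powr p\<close> is exactly the arithmetic mean of the p-th powers, so
    the terms with \<open>lam\<close> cancel.\<close>
  have pw: "D x = r * ((low (\<psi>1 x) + low (\<psi>2 x)) / 2 - low (w0 x))" for x
  proof -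
    have "w0 x powr r = ((\<bar>\<psi>1 x\<bar> powr p + \<bar>\<psi>2 x\<bar> powr p) / 2) powr (r / p)"
      "w0 x powr p = (\<bar>\<psi>1 x\<bar> powr p + \<bar>\<psi>2 x\<bar> powr p) / 2"
      using p_gt_1 by (auto simp: w0_def powr_powr add_nonneg_nonneg)
    moreover have "\<bar>w0 x\<bar> = w0 x" by (simp add: w0_def)
    moreover have "r * (((a / r - lam * (b / p)) + (a' / r - lam * (b' / p))) / 2 - (W / r - lam * (((b + b') / 2) / p)))
        = (a + a') / 2 - W" for a b a' b' W
      using r_gt_1 p_gt_1 by (simp add: field_simps)
    ultimately show ?thesis by (simp only: D_def low_def)
  qed
  have "(LINT x|\<mu>. D x) = r * (((LINT x|\<mu>. low (\<psi>1 x)) + (LINT x|\<mu>. low (\<psi>2 x))) / 2 - (LINT x|\<mu>. low (w0 x)))"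
    unfolding pw using i iw by simp
  also have "\<dots> \<le> r * ((energy \<psi>1 + energy \<psi>2) / 2 - m)"
    using ml r_gt_1 unfolding energy_def by (intro mult_left_mono) (auto simp: field_simps)
  finally show ?thesis unfolding D_def .
qed

end

subsection \<open>Existence of a minimizer\<close>

text \<open>For nonnegative quantities such as distances this is the Cauchy property.\<close>

definition small2 :: "(nat \<Rightarrow> nat \<Rightarrow> real) \<Rightarrow> bool" where
  "small2 X \<longleftrightarrow> (\<forall>e>0. \<exists>N. \<forall>i\<ge>N. \<forall>j\<ge>N. X i j < e)"

lemma small2_by_small:
  assumes "\<And>e. 0 < e \<Longrightarrow> e \<le> 1 \<Longrightarrow> \<exists>C. \<forall>i j. X i j \<le> e * A + C * y i j"
    and y: "small2 y" "\<And>i j. 0 \<le> y i j"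
  shows "small2 X"
  unfolding small2_def
proof (intro allI impI)
  fix \<epsilon> :: real assume \<epsilon>: "0 < \<epsilon>"
  obtain e where e: "0 < e" "e \<le> 1" and a: "e * A < \<epsilon> / 2" using small_multiplier[OF \<epsilon>] by blast
  obtain C where C: "\<And>i j. X i j \<le> e * A + C * y i j" using assms(1)[OF e] by blast
  define d where "d = \<epsilon> / (2 * (\<bar>C\<bar> + 1))"
  have d: "d > 0" using \<epsilon> by (simp add: d_def)
  then obtain N where N: "\<And>i j. i \<ge> N \<Longrightarrow> j \<ge> N \<Longrightarrow> y i j < d" using y(1) unfolding small2_def by blast
  have "X i j < \<epsilon>" if "i \<ge> N" "j \<ge> N" for i j
  proof -
    have "C * y i j \<le> (\<bar>C\<bar> + 1) * y i j" using y(2) by (intro mult_right_mono) auto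
    also have "\<dots> \<le> (\<bar>C\<bar> + 1) * d" using N[OF that] by (intro mult_left_mono) auto
    also have "\<dots> = \<epsilon> / 2" by (simp add: d_def field_simps)
    finally show ?thesis using C[of i j] a by linarith
  qed
  then show "\<exists>N. \<forall>i\<ge>N. \<forall>j\<ge>N. X i j < \<epsilon>" by blast
qed

lemma small2_add:
  assumes "small2 X" "small2 Y"
  shows "small2 (\<lambda>i j. X i j + Y i j)"
  unfolding small2_def
proof (intro allI impI)
  fix e :: real assume "0 < e"
  then have e: "0 < e / 2" by simp
  obtain N1 N2 where "\<And>i j. i \<ge> N1 \<Longrightarrow> j \<ge> N1 \<Longrightarrow> X i j < e / 2" "\<And>i j. i \<ge> N2 \<Longrightarrow> j \<ge> N2 \<Longrightarrow> Y i j < e / 2"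
    using assms e unfolding small2_def by metis
  then have "X i j + Y i j < e" if "i \<ge> max N1 N2" "j \<ge> max N1 N2" for i j
    using that by (metis add_strict_mono field_sum_of_halves max.bounded_iff)
  then show "\<exists>N. \<forall>i\<ge>N. \<forall>j\<ge>N. X i j + Y i j < e" by blast
qed

lemma small2_inverse: "small2 (\<lambda>i j. 1 / real (Suc i) + 1 / real (Suc j))"
  unfolding small2_def
proof (intro allI impI)
  fix e :: real assume "0 < e"
  then obtain N where N: "1 / real (Suc N) < e / 2" using nat_approx_posE[of "e/2"] by auto
  have "1 / real (Suc i) < e / 2" if "i \<ge> N" for i
    using N frac_le[of 1 1 "real (Suc N)" "real (Suc i)"] that by simp
  then have "1 / real (Suc i) + 1 / real (Suc j) < e" if "i \<ge> N" "j \<ge> N" for i j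
    using that by (metis add_strict_mono field_sum_of_halves)
  then show "\<exists>N. \<forall>i\<ge>N. \<forall>j\<ge>N. 1 / real (Suc i) + 1 / real (Suc j) < e" by blast
qed

lemma small2_subseq:
  assumes "small2 X" "strict_mono \<sigma>"
  shows "small2 (\<lambda>i j. X (\<sigma> i) (\<sigma> j))"
  using assms unfolding small2_def by (meson le_trans seq_suble)

lemma powr_mean_gap_nonneg:
  fixes x y p r :: real
  assumes "p > 0" "r > p" "x \<ge> 0" "y \<ge> 0"
  shows "0 \<le> (x powr r + y powr r) / 2 - ((x powr p + y powr p) / 2) powr (r / p)"
proof (cases "x powr p = y powr p")
  case True
  have "x powr r = (x powr p) powr (r / p)" "y powr r = (y powr p) powr (r / p)"
    using assms by (simp_all add: powr_powr)
  then show ?thesis using True by simp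
next
  case False
  then show ?thesis
    using powr_mean_less[of "r/p" "x powr p" "y powr p"] assms by (simp add: powr_powr)
qed

lemma powr_lipschitz:
  fixes x y s B :: real
  assumes "s \<ge> 1" "x \<in> {0..B}" "y \<in> {0..B}"
  shows "\<bar>x powr s - y powr s\<bar> \<le> s * B powr (s - 1) * \<bar>x - y\<bar>"
proof -
  have *: "a powr s - b powr s \<le> s * B powr (s - 1) * \<bar>a - b\<bar>" if "a \<in> {0..B}" "b \<in> {0..B}" for a b
  proof -
    have "a powr s - b powr s \<le> s * a powr (s - 1) * (a - b)"
      using powr_ge_tangent[of s a b] assms(1) that by (simp add: algebra_simps)
    also have "\<dots> \<le> s * a powr (s - 1) * \<bar>a - b\<bar>" using assms by (intro mult_left_mono) auto
    also have "\<dots> \<le> s * B powr (s - 1) * \<bar>a - b\<bar>"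
      using assms that by (intro mult_right_mono mult_left_mono powr_mono2) auto
    finally show ?thesis .
  qed
  show ?thesis using *[OF assms(2,3)] *[OF assms(3,2)] by (simp add: abs_le_iff abs_minus_commute)
qed

context variational_problem
begin

lemma low_lipschitz:
  assumes "x \<in> {0..B}" "y \<in> {0..B}"
  shows "\<bar>low x - low y\<bar> \<le> (B powr (r - 1) + lam * B powr (p - 1)) * \<bar>x - y\<bar>"
proof -
  have "\<bar>x powr r / r - y powr r / r\<bar> \<le> B powr (r - 1) * \<bar>x - y\<bar>"
    using powr_lipschitz[of r x B y] assms r_gt_1 by (simp add: field_simps flip: diff_divide_distrib)
  moreover have "\<bar>x powr p / p - y powr p / p\<bar> \<le> B powr (p - 1) * \<bar>x - y\<bar>"
    using powr_lipschitz[of p x B y] assms p_gt_1 by (simp add: field_simps flip: diff_divide_distrib)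
  then have "lam * \<bar>x powr p / p - y powr p / p\<bar> \<le> lam * (B powr (p - 1) * \<bar>x - y\<bar>)"
    using lam_pos by (intro mult_left_mono) auto
  then have "\<bar>lam * (x powr p / p) - lam * (y powr p / p)\<bar> \<le> lam * (B powr (p - 1) * \<bar>x - y\<bar>)"
    using lam_pos by (simp only: right_diff_distrib[symmetric] abs_mult abs_of_pos)
  ultimately show ?thesis using assms unfolding low_def by (simp add: algebra_simps)
qed

lemma minimizing_sequence:
  obtains m z where "\<And>\<psi>. \<psi> \<in> test_functions \<Omega> \<Longrightarrow> m \<le> energy \<psi>"
    and "\<And>n. z n \<in> test_functions \<Omega>" "\<And>n x. 0 \<le> z n x" "\<And>n x. z n x \<le> bd"
    and "\<And>n. energy (z n) \<le> m + 1 / real (Suc n)"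
proof -
  define m where "m = Inf (energy ` test_functions \<Omega>)"
  have "- low_bound bd * vol \<le> energy \<psi>" if "\<psi> \<in> test_functions \<Omega>" for \<psi>
  proof -
    have "0 \<le> (LINT x|\<mu>. \<Phi> (norm (grad \<psi> x)))" by simp
    then show ?thesis using modular_le_energy[OF that] by linarith
  qed
  then have bdd: "bdd_below (energy ` test_functions \<Omega>)" by (intro bdd_belowI2)
  have m: "m \<le> energy \<psi>" if "\<psi> \<in> test_functions \<Omega>" for \<psi>
    unfolding m_def using that by (intro cINF_lower bdd)
  have "\<exists>z\<in>test_functions \<Omega>. (\<forall>x. 0 \<le> z x \<and> z x \<le> bd) \<and> energy z \<le> m + 1 / real (Suc n)" for n
  proof -
    \<comment> \<open>Half of the tolerance is spent on approaching the infimum, the other half on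
      the truncation.\<close>
    have pos: "1 / real (Suc n) / 2 > 0" by simp
    have ne: "energy ` test_functions \<Omega> \<noteq> {}" using test_zero by blast
    have "Inf (energy ` test_functions \<Omega>) < m + 1 / real (Suc n) / 2" unfolding m_def using pos by simp
    from cInf_lessD[OF ne this] obtain \<psi> where \<psi>: "\<psi> \<in> test_functions \<Omega>" "energy \<psi> < m + 1 / real (Suc n) / 2" by blast
    obtain \<psi>' where \<psi>': "\<psi>' \<in> test_functions \<Omega>" "\<forall>x. 0 \<le> \<psi>' x \<and> \<psi>' x \<le> bd" "energy \<psi>' < energy \<psi> + 1 / real (Suc n) / 2"
      using energy_truncation[OF \<psi>(1) pos] by blast
    have "1 / real (Suc n) / 2 + 1 / real (Suc n) / 2 = 1 / real (Suc n)" by (rule field_sum_of_halves)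
    then have "energy \<psi>' \<le> m + 1 / real (Suc n)" using \<psi>(2) \<psi>'(3) by linarith
    then show ?thesis using \<psi>' by blast
  qed
  then obtain z where "\<And>n. z n \<in> test_functions \<Omega>" "\<And>n x. 0 \<le> z n x \<and> z n x \<le> bd"
    "\<And>n. energy (z n) \<le> m + 1 / real (Suc n)" by metis
  then show ?thesis using that[of m z] m by blast
qed

text \<open>Where two members differ by at least \<open>e\<close>, the defect \<open>D\<close> is at
  least \<open>d\<close> while their difference is at most \<open>bd\<close>; elsewhere the
  difference is below \<open>e\<close>. The integral of \<open>D\<close> is controlled by how far
  the two energies exceed the infimum.\<close>

lemma minimizing_sequence_L1_Cauchy:
  assumes m: "\<And>\<psi>. \<psi> \<in> test_functions \<Omega> \<Longrightarrow> m \<le> energy \<psi>"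
    and z: "\<And>n. z n \<in> test_functions \<Omega>" "\<And>n x. 0 \<le> z n x" "\<And>n x. z n x \<le> bd"
    and E: "\<And>n. energy (z n) \<le> m + 1 / real (Suc n)"
  shows "small2 (\<lambda>i j. LINT x|\<mu>. \<bar>z i x - z j x\<bar>)"
proof (rule small2_by_small[OF _ small2_inverse])
  fix e :: real assume e: "0 < e"
  obtain d where d: "d > 0" "\<And>x y. x \<in> {0..bd} \<Longrightarrow> y \<in> {0..bd} \<Longrightarrow> \<bar>x - y\<bar> \<ge> e \<Longrightarrow>
    d \<le> (x powr r + y powr r) / 2 - ((x powr p + y powr p) / 2) powr (r / p)"
    using powr_mean_gap[OF p_gt_1 r_gt_p e, of bd] by blast
  define D where "D i j x = (\<bar>z i x\<bar> powr r + \<bar>z j x\<bar> powr r) / 2 - ((\<bar>z i x\<bar> powr p + \<bar>z j x\<bar> powr p) / 2) powr (r / p)"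
    for i j x
  have ab: "\<bar>z n x\<bar> = z n x" for n x using z(2) by simp
  have D0: "0 \<le> D i j x" for i j x unfolding D_def using p_gt_1 r_gt_p by (intro powr_mean_gap_nonneg) auto
  have pw: "\<bar>z i x - z j x\<bar> \<le> e + bd / d * D i j x" for i j x
  proof (cases "\<bar>z i x - z j x\<bar> \<ge> e")
    case True
    then have "d \<le> D i j x" using d(2)[of "z i x" "z j x"] z(2,3) unfolding D_def ab by auto
    then have "bd / d * d \<le> bd / d * D i j x" using d bd_pos by (intro mult_left_mono) auto
    then have "bd \<le> bd / d * D i j x" using d by simp
    moreover have "\<bar>z i x - z j x\<bar> \<le> bd" using z(2)[of i x] z(3)[of i x] z(2)[of j x] z(3)[of j x] by linarith
    ultimately show ?thesis using e by linarith
  next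
    case False
    moreover have "0 \<le> bd / d * D i j x" using D0 d bd_pos by simp
    ultimately show ?thesis by linarith
  qed
  have iD: "integrable \<mu> (D i j)" for i j
  proof (rule integrable_const_bound[where B = "bd powr r"])
    show "D i j \<in> borel_measurable \<mu>" unfolding D_def using test_measurable[OF z(1)] by measurable
    have "D i j x \<le> bd powr r" for x
    proof -
      have "\<bar>z n x\<bar> powr r \<le> bd powr r" for n using z(2,3) r_gt_1 unfolding ab by (intro powr_mono2) auto
      from this[of i] this[of j]
      have "(\<bar>z i x\<bar> powr r + \<bar>z j x\<bar> powr r) / 2 \<le> bd powr r" by simp
      then show ?thesis unfolding D_def by (smt (verit) powr_ge_zero)
    qed
    then show "AE x in \<mu>. norm (D i j x) \<le> bd powr r" using D0 by simp
  qed
  show "\<exists>C. \<forall>i j. (LINT x|\<mu>. \<bar>z i x - z j x\<bar>) \<le> e * vol + C * (1 / real (Suc i) + 1 / real (Suc j))"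
  proof (intro exI allI)
    fix i j
    have "(LINT x|\<mu>. \<bar>z i x - z j x\<bar>) \<le> (LINT x|\<mu>. e + bd / d * D i j x)"
      using test_lebesgue_on(1)[OF z(1) open_\<Omega>] iD pw by (intro integral_mono) auto
    also have "\<dots> = e * vol + bd / d * (LINT x|\<mu>. D i j x)" using iD by (simp add: vol_def)
    finally have le: "(LINT x|\<mu>. \<bar>z i x - z j x\<bar>) \<le> e * vol + bd / d * (LINT x|\<mu>. D i j x)" .
    have "(LINT x|\<mu>. D i j x) \<le> r * ((energy (z i) + energy (z j)) / 2 - m)"
      unfolding D_def by (rule powr_gap_le_energy_gap[OF z(1) z(1) m])
    also have "\<dots> \<le> r * (1 / real (Suc i) + 1 / real (Suc j))"
    proof (rule mult_left_mono)
      have "1 / real (Suc i) \<ge> 0" "1 / real (Suc j) \<ge> 0" by auto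
      then show "(energy (z i) + energy (z j)) / 2 - m \<le> 1 / real (Suc i) + 1 / real (Suc j)"
        using E[of i] E[of j] by argo
    qed (use r_gt_1 in simp)
    finally have "bd / d * (LINT x|\<mu>. D i j x) \<le> bd / d * (r * (1 / real (Suc i) + 1 / real (Suc j)))"
      using d(1) bd_pos by (intro mult_left_mono) auto
    with le show "(LINT x|\<mu>. \<bar>z i x - z j x\<bar>) \<le> e * vol + (bd / d * r) * (1 / real (Suc i) + 1 / real (Suc j))"
      unfolding mult.assoc by linarith
  qed
qed simp

text \<open>Here the ordinary midpoint is the competitor. The lower-order part is not convex, but it
  is Lipschitz on \<open>{0..bd}\<close>, so its defect is bounded by the \<open>L^1\<close>
  distance, which is already small. The convexity defect of the gradient part must then be small
  too.\<close>

lemma minimizing_sequence_grad_Cauchy: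
  assumes m: "\<And>\<psi>. \<psi> \<in> test_functions \<Omega> \<Longrightarrow> m \<le> energy \<psi>"
    and z: "\<And>n. z n \<in> test_functions \<Omega>" "\<And>n x. 0 \<le> z n x" "\<And>n x. z n x \<le> bd"
    and E: "\<And>n. energy (z n) \<le> m + 1 / real (Suc n)"
  shows "small2 (\<lambda>i j. LINT x|\<mu>. \<Phi> (norm (grad (z i) x - grad (z j) x)))"
proof -
  define \<Lambda> where "\<Lambda> = bd powr (r - 1) + lam * bd powr (p - 1)"
  have \<Lambda>: "\<Lambda> \<ge> 0" using lam_pos by (simp add: \<Lambda>_def)
  define y where "y i j = (1 / real (Suc i) + 1 / real (Suc j)) + \<Lambda> * (LINT x|\<mu>. \<bar>z i x - z j x\<bar>)" for i j
  \<comment> \<open>With \<open>A = 0\<close> the absorption lemma amounts to multiplication by a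
    constant.\<close>
  have "small2 (\<lambda>i j. \<Lambda> * (LINT x|\<mu>. \<bar>z i x - z j x\<bar>))"
    by (rule small2_by_small[where A = 0, OF _ minimizing_sequence_L1_Cauchy[OF assms]]) auto
  then have y: "small2 y" unfolding y_def by (intro small2_add small2_inverse)
  have y0: "0 \<le> y i j" for i j unfolding y_def using \<Lambda> by (intro add_nonneg_nonneg mult_nonneg_nonneg) auto
  define P where "P n x = \<Phi> (norm (grad (z n) x))" for n x
  \<comment> \<open>A common bound for the gradient modulars, by coercivity, since all energies in
    the sequence are at most \<open>m + 1\<close>.\<close>
  define B where "B = m + 1 + low_bound bd * vol"
  have iP: "integrable \<mu> (P n)" for n using test_grad_mod[OF z(1)] by (simp add: P_def[abs_def] mod_int_def)
  have PB: "(LINT x|\<mu>. P n x) \<le> B" for n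
  proof -
    have "1 / real (Suc n) \<le> 1" by simp
    then show ?thesis using modular_le_energy[OF z(1), of n] E[of n] unfolding P_def B_def by linarith
  qed
  show ?thesis
  proof (rule small2_by_small[OF _ y y0])
    fix e :: real assume e: "0 < e" "e \<le> 1"
    obtain C where C: "C > 0" "\<And>a b :: real^'n. \<Phi> (norm (a - b)) \<le> e * (\<Phi> (norm a) + \<Phi> (norm b))
     + C * ((\<Phi> (norm a) + \<Phi> (norm b)) / 2 - \<Phi> (norm ((a + b) /\<^sub>R 2)))"
      using Phi_uniformly_convex[OF e] by blast
    show "\<exists>C. \<forall>i j. (LINT x|\<mu>. \<Phi> (norm (grad (z i) x - grad (z j) x))) \<le> e * (2 * B) + C * y i j"
    proof (intro exI[of _ C] allI)
      fix i j
      define w where "w x = 1/2 * (z i x + z j x)" for x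
      have w: "w \<in> test_functions \<Omega>" unfolding w_def by (intro test_cmult test_add z)
      have gw: "grad w x = (grad (z i) x + grad (z j) x) /\<^sub>R 2" for x
        unfolding w_def using test_smooth[OF z(1)] by (simp only: grad_cmult grad_add smooth_add) simp
      define Q where "Q x = \<Phi> (norm (grad w x))" for x
      have iQ: "integrable \<mu> Q" using test_grad_mod[OF w] by (simp add: Q_def[abs_def] mod_int_def)
      have il: "integrable \<mu> (\<lambda>x. low (z n x))" "integrable \<mu> (\<lambda>x. low (w x))" for n
        using test_low_integrable z(1) w by auto
      have ia: "integrable \<mu> (\<lambda>x. \<bar>z i x - z j x\<bar>)"
        using test_lebesgue_on(1)[OF z(1) open_\<Omega>] by auto
      have "(LINT x|\<mu>. low (w x)) \<le> (LINT x|\<mu>. (low (z i x) + low (z j x)) / 2 + \<Lambda> * \<bar>z i x - z j x\<bar>)"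
      proof (rule integral_mono)
        fix x
        have "w x \<in> {0..bd}" "z i x \<in> {0..bd}" "z j x \<in> {0..bd}"
          using z(2,3)[of i x] z(2,3)[of j x] by (auto simp: w_def)
        then have "\<bar>low (w x) - low (z i x)\<bar> \<le> \<Lambda> * \<bar>w x - z i x\<bar>" "\<bar>low (w x) - low (z j x)\<bar> \<le> \<Lambda> * \<bar>w x - z j x\<bar>"
          unfolding \<Lambda>_def by (auto intro: low_lipschitz)
        moreover have "\<Lambda> * \<bar>w x - z n x\<bar> \<le> \<Lambda> * \<bar>z i x - z j x\<bar>" if "n = i \<or> n = j" for n
        proof (rule mult_left_mono[OF _ \<Lambda>])
          have "w x - z i x = (z j x - z i x) / 2" "w x - z j x = (z i x - z j x) / 2"
            by (auto simp: w_def field_simps)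
          then have "\<bar>w x - z i x\<bar> = \<bar>z j x - z i x\<bar> / 2" "\<bar>w x - z j x\<bar> = \<bar>z i x - z j x\<bar> / 2"
            by (simp_all only: abs_divide abs_numeral)
          then have "\<bar>w x - z i x\<bar> \<le> \<bar>z i x - z j x\<bar> \<and> \<bar>w x - z j x\<bar> \<le> \<bar>z i x - z j x\<bar>"
            using abs_minus_commute[of "z i x" "z j x"] abs_ge_zero[of "z i x - z j x"]
            by (smt (verit) field_sum_of_halves)
          then show "\<bar>w x - z n x\<bar> \<le> \<bar>z i x - z j x\<bar>" using that by metis
        qed
        then have "\<Lambda> * \<bar>w x - z i x\<bar> \<le> \<Lambda> * \<bar>z i x - z j x\<bar>" "\<Lambda> * \<bar>w x - z j x\<bar> \<le> \<Lambda> * \<bar>z i x - z j x\<bar>" by blast+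
        ultimately have "low (w x) \<le> low (z i x) + \<Lambda> * \<bar>z i x - z j x\<bar>" "low (w x) \<le> low (z j x) + \<Lambda> * \<bar>z i x - z j x\<bar>"
          by (simp_all only: abs_le_iff) linarith+
        then have "(low (w x) + low (w x)) / 2 \<le> ((low (z i x) + \<Lambda> * \<bar>z i x - z j x\<bar>) + (low (z j x) + \<Lambda> * \<bar>z i x - z j x\<bar>)) / 2"
          by (intro divide_right_mono add_mono) auto
        then show "low (w x) \<le> (low (z i x) + low (z j x)) / 2 + \<Lambda> * \<bar>z i x - z j x\<bar>"
          by (simp add: add_divide_distrib)
      qed (use il ia in auto)
      also have "\<dots> = ((LINT x|\<mu>. low (z i x)) + (LINT x|\<mu>. low (z j x))) / 2 + \<Lambda> * (LINT x|\<mu>. \<bar>z i x - z j x\<bar>)"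
        using il ia by simp
      finally have lw: "(LINT x|\<mu>. low (w x)) \<le> \<dots>" .
      have "((LINT x|\<mu>. P i x) + (LINT x|\<mu>. P j x)) / 2 - (LINT x|\<mu>. Q x) \<le> y i j"
      proof -
        have "m \<le> (LINT x|\<mu>. Q x) + (LINT x|\<mu>. low (w x))" using m[OF w] by (simp add: energy_def Q_def)
        moreover have "(LINT x|\<mu>. P n x) + (LINT x|\<mu>. low (z n x)) \<le> m + 1 / real (Suc n)" for n
          using E[of n] by (simp add: energy_def P_def)
        moreover have "1 / real (Suc i) \<ge> 0" "1 / real (Suc j) \<ge> 0" by auto
        moreover have "(P + P') / 2 - Q \<le> (a + b) + L"
          if "m \<le> Q + l" "P + k \<le> m + a" "P' + k' \<le> m + b" "0 \<le> a" "0 \<le> b" "l \<le> (k + k') / 2 + L"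
          for P P' Q a b k k' l L :: real using that by (simp add: field_simps)
        ultimately show ?thesis using lw unfolding y_def by blast
      qed
      then have gap: "C * (((LINT x|\<mu>. P i x) + (LINT x|\<mu>. P j x)) / 2 - (LINT x|\<mu>. Q x)) \<le> C * y i j"
        using C(1) by (intro mult_left_mono) auto
      have "(LINT x|\<mu>. \<Phi> (norm (grad (z i) x - grad (z j) x)))
         \<le> (LINT x|\<mu>. e * (P i x + P j x) + C * ((P i x + P j x) / 2 - Q x))"
      proof (rule integral_mono)
        show "integrable \<mu> (\<lambda>x. \<Phi> (norm (grad (z i) x - grad (z j) x)))"
          using mod_int_diff[OF test_grad_mod[OF z(1)] test_grad_mod[OF z(1)]] by (simp add: mod_int_def)
        show "\<Phi> (norm (grad (z i) x - grad (z j) x)) \<le> e * (P i x + P j x) + C * ((P i x + P j x) / 2 - Q x)" for x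
          using C(2)[of "grad (z i) x" "grad (z j) x"] by (simp only: P_def Q_def gw)
      qed (use iP iQ in auto)
      also have "\<dots> = e * ((LINT x|\<mu>. P i x) + (LINT x|\<mu>. P j x))
          + C * (((LINT x|\<mu>. P i x) + (LINT x|\<mu>. P j x)) / 2 - (LINT x|\<mu>. Q x))"
        using iP iQ by simp
      also have "\<dots> \<le> e * (2 * B) + C * y i j"
      proof (rule add_mono[OF _ gap])
        show "e * ((LINT x|\<mu>. P i x) + (LINT x|\<mu>. P j x)) \<le> e * (2 * B)"
          using PB[of i] PB[of j] e by (intro mult_left_mono) auto
      qed
      finally show "(LINT x|\<mu>. \<Phi> (norm (grad (z i) x - grad (z j) x))) \<le> e * (2 * B) + C * y i j" .
    qed
  qed
qed

lemma minimizing_limit: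
  obtains m z u g where "\<And>\<psi>. \<psi> \<in> test_functions \<Omega> \<Longrightarrow> m \<le> energy \<psi>"
    and "\<And>n. z n \<in> test_functions \<Omega>" "\<And>n x. \<bar>z n x\<bar> \<le> bd"
    and "(\<lambda>n. energy (z n)) \<longlonglongrightarrow> m"
    and "u \<in> borel_measurable \<mu>" "\<And>x. \<bar>u x\<bar> \<le> bd" "AE x in \<mu>. (\<lambda>n. z n x) \<longlonglongrightarrow> u x"
    and "mod_int g" "(\<lambda>n. LINT x|\<mu>. \<Phi> (norm (grad (z n) x - g x))) \<longlonglongrightarrow> 0"
proof -
  obtain m \<psi> where m: "\<And>\<psi>. \<psi> \<in> test_functions \<Omega> \<Longrightarrow> m \<le> energy \<psi>"
    and \<psi>: "\<And>n. \<psi> n \<in> test_functions \<Omega>" "\<And>n x. 0 \<le> \<psi> n x" "\<And>n x. \<psi> n x \<le> bd"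
    and E: "\<And>n. energy (\<psi> n) \<le> m + 1 / real (Suc n)"
    using minimizing_sequence by blast
  have c1: "small2 (\<lambda>i j. LINT x|\<mu>. \<bar>\<psi> i x - \<psi> j x\<bar>)"
    by (rule minimizing_sequence_L1_Cauchy[OF m \<psi> E])
  have c2: "small2 (\<lambda>i j. LINT x|\<mu>. \<Phi> (norm (grad (\<psi> i) x - grad (\<psi> j) x)))"
    by (rule minimizing_sequence_grad_Cauchy[OF m \<psi> E])
  have md: "mod_int (\<lambda>x. grad (\<psi> i) x - grad (\<psi> j) x)" for i j
    by (intro mod_int_diff test_grad_mod \<psi>)
  have c3: "small2 (\<lambda>i j. LINT x|\<mu>. norm (grad (\<psi> i) x - grad (\<psi> j) x))"
  proof (rule small2_by_small[OF _ c2])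
    fix e :: real assume e: "0 < e"
    show "\<exists>C. \<forall>i j. (LINT x|\<mu>. norm (grad (\<psi> i) x - grad (\<psi> j) x))
       \<le> e * vol + C * (LINT x|\<mu>. \<Phi> (norm (grad (\<psi> i) x - grad (\<psi> j) x)))"
      using integral_norm_le_modular[OF md e] by blast
  qed simp
  \<comment> \<open>Pairing the function with its gradient lets a single subsequence converge almost
    everywhere in both components.\<close>
  define s where "s n x = (\<psi> n x, grad (\<psi> n) x)" for n x
  have is1: "integrable \<mu> (\<psi> n)" "integrable \<mu> (grad (\<psi> n))" for n
    using test_lebesgue_on(1)[OF \<psi>(1) open_\<Omega>] mod_int_integrable[OF test_grad_mod[OF \<psi>(1)]] by auto
  have iS: "integrable \<mu> (s n)" for n
  proof (rule Bochner_Integration.integrable_bound[where f = "\<lambda>x. \<bar>\<psi> n x\<bar> + norm (grad (\<psi> n) x)"])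
    show "s n \<in> borel_measurable \<mu>" unfolding s_def using is1 by (intro borel_measurable_Pair) auto
    show "AE x in \<mu>. norm (s n x) \<le> norm (\<bar>\<psi> n x\<bar> + norm (grad (\<psi> n) x))"
      using norm_Pair_le[of "\<psi> n x" "grad (\<psi> n) x" for x] by (intro AE_I2) (simp add: s_def)
  qed (use is1 in auto)
  have "\<exists>N. \<forall>i\<ge>N. \<forall>j\<ge>N. (LINT x|\<mu>. norm (s i x - s j x)) < e" if "e > 0" for e
  proof -
    have "small2 (\<lambda>i j. (LINT x|\<mu>. \<bar>\<psi> i x - \<psi> j x\<bar>) + (LINT x|\<mu>. norm (grad (\<psi> i) x - grad (\<psi> j) x)))"
      by (intro small2_add c1 c3)
    from this[unfolded small2_def, rule_format, OF that] obtain N where N: "\<And>i j. i \<ge> N \<Longrightarrow> j \<ge> N \<Longrightarrow>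
       (LINT x|\<mu>. \<bar>\<psi> i x - \<psi> j x\<bar>) + (LINT x|\<mu>. norm (grad (\<psi> i) x - grad (\<psi> j) x)) < e"
      by blast
    have "(LINT x|\<mu>. norm (s i x - s j x)) \<le> (LINT x|\<mu>. \<bar>\<psi> i x - \<psi> j x\<bar>) + (LINT x|\<mu>. norm (grad (\<psi> i) x - grad (\<psi> j) x))" for i j
    proof -
      have "(LINT x|\<mu>. norm (s i x - s j x)) \<le> (LINT x|\<mu>. \<bar>\<psi> i x - \<psi> j x\<bar> + norm (grad (\<psi> i) x - grad (\<psi> j) x))"
      proof (rule integral_mono)
        show "integrable \<mu> (\<lambda>x. norm (s i x - s j x))" using iS by (intro integrable_norm Bochner_Integration.integrable_diff)
        show "norm (s i x - s j x) \<le> \<bar>\<psi> i x - \<psi> j x\<bar> + norm (grad (\<psi> i) x - grad (\<psi> j) x)" for x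
          using norm_Pair_le[of "\<psi> i x - \<psi> j x" "grad (\<psi> i) x - grad (\<psi> j) x"] by (simp add: s_def)
      qed (use is1 in auto)
      then show ?thesis using is1 by simp
    qed
    then show ?thesis using N by (meson le_less_trans)
  qed
  from cauchy_L1_AE_cauchy_subseq[OF iS this] obtain \<sigma> where \<sigma>: "strict_mono \<sigma>" "AE x in \<mu>. Cauchy (\<lambda>i. s (\<sigma> i) x)"
    by blast
  define z where "z n = \<psi> (\<sigma> n)" for n
  \<comment> \<open>Clamping makes the bounds hold at every point, including those where the
    sequence diverges and \<open>lim\<close> is arbitrary.\<close>
  define u where "u x = max 0 (min bd (lim (\<lambda>n. z n x)))" for x
  define g where "g x = lim (\<lambda>n. grad (z n) x)" for x
  have z: "z n \<in> test_functions \<Omega>" "0 \<le> z n x" "z n x \<le> bd" for n x using \<psi> by (auto simp: z_def)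
  have um: "u \<in> borel_measurable \<mu>" unfolding u_def using test_measurable[OF z(1)] by measurable
  have gm: "g \<in> borel_measurable \<mu>" unfolding g_def using test_grad_mod[OF z(1)]
    by (intro borel_measurable_lim_metric) (auto simp: mod_int_def)
  have lim: "AE x in \<mu>. (\<lambda>n. z n x) \<longlonglongrightarrow> u x \<and> (\<lambda>n. grad (z n) x) \<longlonglongrightarrow> g x"
    using \<sigma>(2)
  proof (rule eventually_mono)
    fix x assume "Cauchy (\<lambda>i. s (\<sigma> i) x)"
    then obtain l where "(\<lambda>i. s (\<sigma> i) x) \<longlonglongrightarrow> l" using Cauchy_convergent_iff convergent_def by blast
    from tendsto_fst[OF this] tendsto_snd[OF this]
    have l: "(\<lambda>n. z n x) \<longlonglongrightarrow> fst l" "(\<lambda>n. grad (z n) x) \<longlonglongrightarrow> snd l" by (auto simp: s_def z_def)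
    have "0 \<le> fst l" "fst l \<le> bd"
      using LIMSEQ_le_const[OF l(1)] LIMSEQ_le_const2[OF l(1)] z(2,3) by auto
    then have "u x = fst l" using limI[OF l(1)] by (simp add: u_def)
    moreover have "g x = snd l" using limI[OF l(2)] by (simp add: g_def)
    ultimately show "(\<lambda>n. z n x) \<longlonglongrightarrow> u x \<and> (\<lambda>n. grad (z n) x) \<longlonglongrightarrow> g x" using l by simp
  qed
  \<comment> \<open>Fatou's lemma sends the second index of the Cauchy estimate to infinity. The
    extended integral is used because the modular of \<open>g\<close> is not yet known to be
    finite.\<close>
  have fatou: "\<exists>N. \<forall>n\<ge>N. (\<integral>\<^sup>+x. ennreal (\<Phi> (norm (grad (z n) x - g x))) \<partial>\<mu>) \<le> ennreal e" if e: "e > 0" for e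
  proof -
    have "small2 (\<lambda>i j. LINT x|\<mu>. \<Phi> (norm (grad (z i) x - grad (z j) x)))"
      unfolding z_def by (rule small2_subseq[OF c2 \<sigma>(1)])
    then obtain N where N: "\<And>i j. i \<ge> N \<Longrightarrow> j \<ge> N \<Longrightarrow> (LINT x|\<mu>. \<Phi> (norm (grad (z i) x - grad (z j) x))) < e"
      using e unfolding small2_def by blast
    have "(\<integral>\<^sup>+x. ennreal (\<Phi> (norm (grad (z n) x - g x))) \<partial>\<mu>) \<le> ennreal e" if n: "n \<ge> N" for n
    proof -
      have mm: "mod_int (\<lambda>x. grad (z n) x - grad (z k) x)" for k by (intro mod_int_diff test_grad_mod z)
      have "(\<integral>\<^sup>+x. ennreal (\<Phi> (norm (grad (z n) x - g x))) \<partial>\<mu>)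
        = (\<integral>\<^sup>+x. liminf (\<lambda>k. ennreal (\<Phi> (norm (grad (z n) x - grad (z k) x)))) \<partial>\<mu>)"
      proof (rule nn_integral_cong_AE, rule eventually_mono[OF lim])
        fix x assume "(\<lambda>n. z n x) \<longlonglongrightarrow> u x \<and> (\<lambda>n. grad (z n) x) \<longlonglongrightarrow> g x"
        then have "(\<lambda>k. norm (grad (z n) x - grad (z k) x)) \<longlonglongrightarrow> norm (grad (z n) x - g x)" by (intro tendsto_intros) auto
        then have "(\<lambda>k. \<Phi> (norm (grad (z n) x - grad (z k) x))) \<longlonglongrightarrow> \<Phi> (norm (grad (z n) x - g x))"
          by (intro continuous_on_tendsto_compose[OF continuous_on_Phi_UNIV]) auto
        then have "(\<lambda>k. ennreal (\<Phi> (norm (grad (z n) x - grad (z k) x)))) \<longlonglongrightarrow> ennreal (\<Phi> (norm (grad (z n) x - g x)))"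
          by (rule tendsto_ennrealI)
        then show "ennreal (\<Phi> (norm (grad (z n) x - g x))) = liminf (\<lambda>k. ennreal (\<Phi> (norm (grad (z n) x - grad (z k) x))))"
          by (intro lim_imp_Liminf[symmetric]) auto
      qed
      also have "\<dots> \<le> liminf (\<lambda>k. \<integral>\<^sup>+x. ennreal (\<Phi> (norm (grad (z n) x - grad (z k) x))) \<partial>\<mu>)"
        using mm by (intro nn_integral_liminf) (auto simp: mod_int_def)
      also have "\<dots> \<le> liminf (\<lambda>k. ennreal e)"
      proof (rule Liminf_mono, rule eventually_sequentiallyI)
        fix k assume "k \<ge> N"
        then show "(\<integral>\<^sup>+x. ennreal (\<Phi> (norm (grad (z n) x - grad (z k) x))) \<partial>\<mu>) \<le> ennreal e"
          using N[OF n, of k] nn_integral_Phi[OF mm[of k]] by (simp add: ennreal_leI)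
      qed
      also have "\<dots> = ennreal e" by (rule Liminf_const) simp
      finally show ?thesis .
    qed
    then show ?thesis by blast
  qed
  \<comment> \<open>\<open>g\<close> is the difference of a test gradient and a field of finite
    modular.\<close>
  have mg: "mod_int g"
  proof -
    obtain n where n: "(\<integral>\<^sup>+x. ennreal (\<Phi> (norm (grad (z n) x - g x))) \<partial>\<mu>) \<le> ennreal 1" using fatou[of 1] by auto
    have "mod_int (\<lambda>x. grad (z n) x - g x)"
      unfolding mod_int_def integrable_iff_bounded
      using n gm test_grad_mod[OF z(1)[of n]] by (auto simp: mod_int_def intro: le_less_trans)
    from mod_int_diff[OF test_grad_mod[OF z(1)[of n]] this] show ?thesis by simp
  qed
  have "(\<lambda>n. LINT x|\<mu>. \<Phi> (norm (grad (z n) x - g x))) \<longlonglongrightarrow> 0"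
  proof (rule LIMSEQ_I)
    fix e :: real assume e: "0 < e"
    then obtain N where N: "\<And>n. n \<ge> N \<Longrightarrow> (\<integral>\<^sup>+x. ennreal (\<Phi> (norm (grad (z n) x - g x))) \<partial>\<mu>) \<le> ennreal (e/2)"
      using fatou[of "e/2"] by auto
    have "norm ((LINT x|\<mu>. \<Phi> (norm (grad (z n) x - g x))) - 0) < e" if "n \<ge> N" for n
    proof -
      have "ennreal (LINT x|\<mu>. \<Phi> (norm (grad (z n) x - g x))) \<le> ennreal (e/2)"
        using N[OF that] nn_integral_Phi[OF mod_int_diff[OF test_grad_mod[OF z(1)] mg]] by simp
      then show ?thesis using e by (simp add: ennreal_le_iff)
    qed
    then show "\<exists>N. \<forall>n\<ge>N. norm ((LINT x|\<mu>. \<Phi> (norm (grad (z n) x - g x))) - 0) < e" by blast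
  qed
  moreover have "(\<lambda>n. energy (z n)) \<longlonglongrightarrow> m"
  proof (rule tendsto_sandwich[of "\<lambda>n. m" _ _ "\<lambda>n. m + 1 / real (Suc (\<sigma> n))"])
    have "(\<lambda>n. m + 1 / real (Suc n)) \<longlonglongrightarrow> m + 0"
      using LIMSEQ_Suc[OF lim_1_over_n[where 'a=real]] by (intro tendsto_add tendsto_const) simp
    from LIMSEQ_subseq_LIMSEQ[OF this \<sigma>(1)] show "(\<lambda>n. m + 1 / real (Suc (\<sigma> n))) \<longlonglongrightarrow> m" by (simp add: o_def)
    show "\<forall>\<^sub>F n in sequentially. m \<le> energy (z n)" using m[OF z(1)] by simp
    show "\<forall>\<^sub>F n in sequentially. energy (z n) \<le> m + 1 / real (Suc (\<sigma> n))" using E unfolding z_def by (intro always_eventually) auto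
  qed simp
  moreover have "\<bar>u x\<bar> \<le> bd" "\<bar>z n x\<bar> \<le> bd" for n x using bd_pos z(2,3) by (auto simp: u_def)
  moreover have "AE x in \<mu>. (\<lambda>n. z n x) \<longlonglongrightarrow> u x" using lim by (auto elim: eventually_mono)
  ultimately show ?thesis using that[of m z u g] m z(1) um mg by blast
qed

end

subsection \<open>Elements of the Orlicz-Sobolev space\<close>

context orlicz_domain
begin

lemma complete_\<mu>: "complete_measure \<mu>"
proof
  fix A B assume "B \<subseteq> A" "A \<in> null_sets \<mu>"
  then have A: "A \<subseteq> \<Omega>" "A \<in> null_sets lebesgue" "B \<subseteq> A"
    using open_\<Omega> by (auto simp: null_sets_restrict_space)
  then have "B \<in> null_sets lebesgue" by (metis completion.complete2)
  then show "B \<in> sets \<mu>" using A open_\<Omega> by (auto simp: sets_restrict_space_iff)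
qed

text \<open>The chosen \<open>weak_grad\<close> is known only almost everywhere. Completeness of the
  measure transfers measurability from a good representative to the integrand of the weak
  formulation.\<close>

lemma measurable_AE_eq:
  fixes f g :: "real^'n \<Rightarrow> 'b::euclidean_space"
  assumes f: "f \<in> borel_measurable \<mu>" and eq: "AE x in \<mu>. f x = g x"
  shows "g \<in> borel_measurable \<mu>"
proof (rule measurableI)
  fix A :: "'b set" assume A: "A \<in> sets borel"
  have "AE x in \<mu>. x \<in> f -` A \<inter> space \<mu> \<longleftrightarrow> x \<in> g -` A \<inter> space \<mu>"
    using eq by (auto elim!: eventually_mono)
  then show "g -` A \<inter> space \<mu> \<in> sets \<mu>"
    by (rule complete_measure.in_sets_AE[OF complete_\<mu>]) (use measurable_sets[OF f A] in auto)
qed simp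

lemma mod_int_nth:
  fixes g :: "real^'n \<Rightarrow> real^'n"
  assumes "mod_int g"
  shows "mod_int (\<lambda>x. g x $ i)"
proof (rule mod_intI[where g = "\<lambda>x. \<Phi> (norm (g x))"])
  have "(\<lambda>v. v $ i) \<in> borel_measurable borel"
    by (intro borel_measurable_continuous_onI continuous_intros)
  then show "(\<lambda>x. g x $ i) \<in> borel_measurable \<mu>"
    using assms measurable_compose unfolding mod_int_def by blast
  show "AE x in \<mu>. \<Phi> (norm (g x $ i)) \<le> \<Phi> (norm (g x))"
    by (intro AE_I2 Phi_mono) (auto simp: component_le_norm_cart)
qed (use assms in \<open>simp add: mod_int_def\<close>)

lemma mod_int_vec:
  fixes g :: "'n \<Rightarrow> real^'n \<Rightarrow> real"
  assumes "\<And>i. mod_int (g i)"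
  shows "mod_int (\<lambda>x. \<chi> i. g i x)"
proof -
  have 1: "mod_int (\<lambda>x. g i x *\<^sub>R axis i (1 :: real))" for i
  proof (rule mod_intI[where g = "\<lambda>x. \<Phi> (norm (g i x))"])
    show "(\<lambda>x. g i x *\<^sub>R axis i (1 :: real)) \<in> borel_measurable \<mu>"
      using assms[of i] by (intro borel_measurable_scaleR) (auto simp: mod_int_def)
  qed (use assms[of i] in \<open>auto simp: mod_int_def norm_axis_1\<close>)
  have s: "mod_int (\<lambda>x. \<Sum>i\<in>F. g i x *\<^sub>R axis i (1 :: real))" if "finite F" for F
    using that
  proof (induction F rule: finite_induct)
    case empty
    then show ?case by (intro mod_int_bounded[where C = 0]) auto
  next
    case (insert i F)
    then show ?case using mod_int_add[OF 1 insert.IH, of i] by simp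
  qed
  have "(\<Sum>i\<in>UNIV. g i x *\<^sub>R axis i (1 :: real)) = (\<chi> i. g i x)" for x
    using basis_expansion[of "\<chi> i. g i x"] by (simp add: scalar_mult_eq_scaleR)
  with s[OF finite[of UNIV]] show ?thesis by (simp only:)
qed

text \<open>Translates the closure in the norm into a sequence converging in the modular, and
  replaces the chosen weak gradient by a representative \<open>h\<close> with finite
  modular.\<close>

lemma sobolev0_approx:
  assumes "v \<in> orlicz_sobolev0 \<Phi> \<Omega>"
  obtains h \<psi> where "mod_int v" "mod_int h" "AE x in \<mu>. weak_grad \<Omega> v x = h x"
    and "\<And>n. \<psi> n \<in> test_functions \<Omega>"
    and "(\<lambda>n. LINT x|\<mu>. \<Phi> (norm (v x - \<psi> n x))) \<longlonglongrightarrow> 0"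
    and "(\<lambda>n. LINT x|\<mu>. \<Phi> (norm (grad (\<psi> n) x - h x))) \<longlonglongrightarrow> 0"
proof -
  have v: "mod_int v" "\<forall>i. \<exists>g. mod_int g \<and> has_weak_partial \<Omega> i v g"
    and ap: "\<And>e. e > 0 \<Longrightarrow> \<exists>\<psi>\<in>test_functions \<Omega>. orlicz_sobolev_norm \<Phi> \<Omega> (\<lambda>x. v x - \<psi> x) < e"
    using assms unfolding orlicz_sobolev0_def orlicz_sobolev_def Bex_def orlicz_space_iff by auto
  obtain g where g: "\<And>i. mod_int (g i)" "\<And>i. has_weak_partial \<Omega> i v (g i)" using v(2) by metis
  define h where "h x = (\<chi> i. g i x)" for x
  have h: "mod_int h" unfolding h_def by (rule mod_int_vec[OF g(1)])
  have wh: "has_weak_partial \<Omega> i v (\<lambda>x. h x $ i)" for i using g(2)[of i] by (simp add: h_def)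
  have "\<exists>\<psi>\<in>test_functions \<Omega>. (LINT x|\<mu>. \<Phi> (norm (v x - \<psi> x))) \<le> 1 / real (Suc n) \<and>
     (LINT x|\<mu>. \<Phi> (norm (grad \<psi> x - h x))) \<le> 1 / real (Suc n)" for n
  proof -
    \<comment> \<open>The bound by 1 marks the range in which the norm controls the modular.\<close>
    have e: "1 / real (Suc n) > 0" "1 / real (Suc n) \<le> 1" by auto
    obtain \<psi> where \<psi>: "\<psi> \<in> test_functions \<Omega>" "orlicz_sobolev_norm \<Phi> \<Omega> (\<lambda>x. v x - \<psi> x) < 1 / real (Suc n)"
      using ap[OF e(1)] by blast
    obtain C where C: "\<And>x. \<bar>\<psi> x\<bar> \<le> C" using test_bounded[OF \<psi>(1)] by blast
    have "mod_int \<psi>"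
      using C by (intro mod_int_bounded[where C = C] continuous_\<mu> smooth_continuous test_smooth[OF \<psi>(1)]) auto
    then have m1: "mod_int (\<lambda>x. v x - \<psi> x)" by (rule mod_int_diff[OF v(1)])
    have "mod_int (grad \<psi>)"
    proof -
      obtain C where "\<And>x. norm (grad \<psi> x) \<le> C" using test_grad_bounded[OF \<psi>(1)] by blast
      then show ?thesis
        by (intro mod_int_bounded[where C = C] continuous_\<mu> continuous_on_grad test_smooth[OF \<psi>(1)]) auto
    qed
    then have m2: "mod_int (\<lambda>x. h x - grad \<psi> x)" by (rule mod_int_diff[OF h])
    have "AE x in \<mu>. weak_grad \<Omega> (\<lambda>x. v x - \<psi> x) x = h x - grad \<psi> x"
      using has_weak_partial_diff[OF wh has_weak_partial_test[OF \<psi>(1) open_\<Omega>] open_\<Omega>]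
      by (intro weak_grad_AE open_\<Omega>) simp
    then have "AE x in \<mu>. norm (weak_grad \<Omega> (\<lambda>x. v x - \<psi> x) x) = norm (h x - grad \<psi> x)"
      by (auto elim: eventually_mono)
    from luxemburg_norm_cong_AE[OF this] \<psi>(2)
    have s: "luxemburg_norm \<Phi> \<Omega> (\<lambda>x. norm (v x - \<psi> x)) + luxemburg_norm \<Phi> \<Omega> (\<lambda>x. norm (h x - grad \<psi> x)) < 1 / real (Suc n)"
      unfolding orlicz_sobolev_norm_def luxemburg_norm_abs[of "\<lambda>x. v x - \<psi> x"] by simp
    then have "luxemburg_norm \<Phi> \<Omega> (\<lambda>x. norm (v x - \<psi> x)) < 1 / real (Suc n)"
      "luxemburg_norm \<Phi> \<Omega> (\<lambda>x. norm (h x - grad \<psi> x)) < 1 / real (Suc n)"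
      using luxemburg_nonneg[OF m1] luxemburg_nonneg[OF m2] by linarith+
    from luxemburg_lessD[OF m1 this(1) e(2)] luxemburg_lessD[OF m2 this(2) e(2)] \<psi>(1)
    show ?thesis by (auto simp: norm_minus_commute)
  qed
  then have "\<exists>\<psi>. \<forall>n. \<psi> n \<in> test_functions \<Omega> \<and> (LINT x|\<mu>. \<Phi> (norm (v x - \<psi> n x))) \<le> 1 / real (Suc n) \<and>
     (LINT x|\<mu>. \<Phi> (norm (grad (\<psi> n) x - h x))) \<le> 1 / real (Suc n)"
    unfolding Bex_def by (intro choice allI)
  then obtain \<psi> where \<psi>: "\<And>n. \<psi> n \<in> test_functions \<Omega>"
    "\<And>n. (LINT x|\<mu>. \<Phi> (norm (v x - \<psi> n x))) \<le> 1 / real (Suc n)"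
    "\<And>n. (LINT x|\<mu>. \<Phi> (norm (grad (\<psi> n) x - h x))) \<le> 1 / real (Suc n)" by blast
  have e0: "(\<lambda>n. 1 / real (Suc n)) \<longlonglongrightarrow> 0" using LIMSEQ_Suc[OF lim_1_over_n[where 'a=real]] by simp
  have "(\<lambda>n. LINT x|\<mu>. \<Phi> (norm (v x - \<psi> n x))) \<longlonglongrightarrow> 0"
    by (rule tendsto_sandwich[OF _ _ tendsto_const e0]) (use \<psi>(2) in \<open>auto intro!: always_eventually\<close>)
  moreover have "(\<lambda>n. LINT x|\<mu>. \<Phi> (norm (grad (\<psi> n) x - h x))) \<longlonglongrightarrow> 0"
    by (rule tendsto_sandwich[OF _ _ tendsto_const e0]) (use \<psi>(3) in \<open>auto intro!: always_eventually\<close>)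
  ultimately show ?thesis using that[of h \<psi>] v(1) h weak_grad_AE[OF wh open_\<Omega>] \<psi>(1) by blast
qed

lemma sobolev0I:
  assumes u: "mod_int u" and g: "mod_int g" and wg: "\<And>i. has_weak_partial \<Omega> i u (\<lambda>x. g x $ i)"
    and \<psi>: "\<And>n. \<psi> n \<in> test_functions \<Omega>" "\<And>n. mod_int (\<lambda>x. u x - \<psi> n x)" "\<And>n. mod_int (\<lambda>x. g x - grad (\<psi> n) x)"
    and lim: "(\<lambda>n. LINT x|\<mu>. \<Phi> (norm (u x - \<psi> n x))) \<longlonglongrightarrow> 0"
      "(\<lambda>n. LINT x|\<mu>. \<Phi> (norm (g x - grad (\<psi> n) x))) \<longlonglongrightarrow> 0"
  shows "u \<in> orlicz_sobolev0 \<Phi> \<Omega>"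
  unfolding orlicz_sobolev0_def
proof (intro CollectI conjI allI impI)
  show "u \<in> orlicz_sobolev \<Phi> \<Omega>"
    using u wg mod_int_nth[OF g] unfolding orlicz_sobolev_def Bex_def orlicz_space_iff by blast
  fix e :: real assume e: "0 < e"
  \<comment> \<open>The function and its gradient each receive norm at most \<open>k\<close>. The
    bound by 1 is required for passing from a modular below \<open>k powr (p + q)\<close> to the
    norm.\<close>
  define k where "k = min 1 (e / 3)"
  have k: "0 < k" "k \<le> 1" "k + k < e" using e by (auto simp: k_def min_def)
  have kp: "0 < k powr (p + q)" using k by simp
  have "eventually (\<lambda>n. (LINT x|\<mu>. \<Phi> (norm (u x - \<psi> n x))) < k powr (p + q) \<and>
     (LINT x|\<mu>. \<Phi> (norm (g x - grad (\<psi> n) x))) < k powr (p + q)) sequentially"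
    by (intro eventually_conj order_tendstoD(2)[OF lim(1) kp] order_tendstoD(2)[OF lim(2) kp])
  then obtain n where n: "(LINT x|\<mu>. \<Phi> (norm (u x - \<psi> n x))) < k powr (p + q)"
     "(LINT x|\<mu>. \<Phi> (norm (g x - grad (\<psi> n) x))) < k powr (p + q)" by (auto simp: eventually_sequentially)
  have "AE x in \<mu>. weak_grad \<Omega> (\<lambda>x. u x - \<psi> n x) x = g x - grad (\<psi> n) x"
    using has_weak_partial_diff[OF wg has_weak_partial_test[OF \<psi>(1) open_\<Omega>] open_\<Omega>]
    by (intro weak_grad_AE open_\<Omega>) simp
  then have "AE x in \<mu>. norm (weak_grad \<Omega> (\<lambda>x. u x - \<psi> n x) x) = norm (g x - grad (\<psi> n) x)"
    by (auto elim: eventually_mono)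
  from luxemburg_norm_cong_AE[OF this]
  have "orlicz_sobolev_norm \<Phi> \<Omega> (\<lambda>x. u x - \<psi> n x) =
      luxemburg_norm \<Phi> \<Omega> (\<lambda>x. norm (u x - \<psi> n x)) + luxemburg_norm \<Phi> \<Omega> (\<lambda>x. norm (g x - grad (\<psi> n) x))"
    unfolding orlicz_sobolev_norm_def luxemburg_norm_abs[of "\<lambda>x. u x - \<psi> n x"] by simp
  also have "\<dots> \<le> k + k"
    using n k \<psi>(2,3) by (intro add_mono luxemburg_le) auto
  finally show "\<exists>\<psi>\<in>test_functions \<Omega>. orlicz_sobolev_norm \<Phi> \<Omega> (\<lambda>x. u x - \<psi> x) < e"
    using k(3) \<psi>(1) by (meson le_less_trans)
qed

lemma tendsto_modular_bounded:
  fixes f :: "nat \<Rightarrow> real^'n \<Rightarrow> real"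
  assumes "\<And>n. f n \<in> borel_measurable \<mu>" "\<And>n x. \<bar>f n x\<bar> \<le> B" "AE x in \<mu>. (\<lambda>n. f n x) \<longlonglongrightarrow> 0"
  shows "(\<lambda>n. LINT x|\<mu>. \<Phi> (f n x)) \<longlonglongrightarrow> 0"
proof -
  have "(\<lambda>n. LINT x|\<mu>. \<Phi> (f n x)) \<longlonglongrightarrow> (LINT x|\<mu>. 0)"
  proof (rule integral_dominated_convergence[where w = "\<lambda>x. \<Phi> B"])
    show "AE x in \<mu>. (\<lambda>n. \<Phi> (f n x)) \<longlonglongrightarrow> 0"
      using assms(3)
    proof (rule eventually_mono)
      fix x assume "(\<lambda>n. f n x) \<longlonglongrightarrow> 0"
      from continuous_on_tendsto_compose[OF continuous_on_Phi_UNIV this] show "(\<lambda>n. \<Phi> (f n x)) \<longlonglongrightarrow> 0" by simp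
    qed
    show "AE x in \<mu>. norm (\<Phi> (f n x)) \<le> \<Phi> B" for n
    proof (intro AE_I2)
      fix x
      have "\<Phi> (f n x) \<le> \<Phi> B" using assms(2)[of n x] by (intro Phi_mono_abs) linarith
      then show "norm (\<Phi> (f n x)) \<le> \<Phi> B" by simp
    qed
  qed (use assms(1) in auto)
  then show ?thesis by simp
qed

end

subsection \<open>The Euler-Lagrange equation\<close>

context variational_problem
begin

context
  fixes m :: real and z :: "nat \<Rightarrow> real^'n \<Rightarrow> real" and u :: "real^'n \<Rightarrow> real" and g :: "real^'n \<Rightarrow> real^'n"
  assumes m: "\<And>\<psi>. \<psi> \<in> test_functions \<Omega> \<Longrightarrow> m \<le> energy \<psi>"
    and z: "\<And>n. z n \<in> test_functions \<Omega>" "\<And>n x. \<bar>z n x\<bar> \<le> bd"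
    and En: "(\<lambda>n. energy (z n)) \<longlonglongrightarrow> m"
    and u: "u \<in> borel_measurable \<mu>" "\<And>x. \<bar>u x\<bar> \<le> bd" "AE x in \<mu>. (\<lambda>n. z n x) \<longlonglongrightarrow> u x"
    and g: "mod_int g" "(\<lambda>n. LINT x|\<mu>. \<Phi> (norm (grad (z n) x - g x))) \<longlonglongrightarrow> 0"
begin

text \<open>The infimum is attained by the pair \<open>u\<close>, \<open>g\<close>, with no
  reference yet to \<open>g\<close> being the weak gradient of \<open>u\<close>.\<close>

lemma limit_energy: "(LINT x|\<mu>. \<Phi> (norm (g x))) + (LINT x|\<mu>. low (u x)) = m"
proof -
  have "(\<lambda>n. energy (z n)) \<longlonglongrightarrow> (LINT x|\<mu>. \<Phi> (norm (g x))) + (LINT x|\<mu>. low (u x))"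
    unfolding energy_def
    by (intro tendsto_add modular_continuous tendsto_integral_low[where B = bd] test_grad_mod z u g test_measurable)
  from LIMSEQ_unique[OF this En] show ?thesis .
qed

text \<open>\<open>z n + t * \<eta>\<close> is again a test function, so the lower bound
  \<open>m\<close> for its energy survives the limit; boundedness of \<eta> keeps the lower-order
  terms dominated.\<close>

lemma limit_minimal:
  assumes \<eta>: "\<eta> \<in> test_functions \<Omega>"
  shows "m \<le> (LINT x|\<mu>. \<Phi> (norm (g x + t *\<^sub>R grad \<eta> x))) + (LINT x|\<mu>. low (u x + t * \<eta> x))"
proof -
  obtain C where C: "\<And>x. \<bar>\<eta> x\<bar> \<le> C" using test_bounded[OF \<eta>] by blast
  define w where "w n x = z n x + t * \<eta> x" for n x
  have w: "w n \<in> test_functions \<Omega>" for n unfolding w_def by (intro test_add test_cmult z \<eta>)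
  have gw: "grad (w n) x = grad (z n) x + t *\<^sub>R grad \<eta> x" for n x
    unfolding w_def using test_smooth[OF z(1)] test_smooth[OF \<eta>]
    by (simp only: grad_add grad_cmult smooth_mult[OF smooth_const])
  have g': "mod_int (\<lambda>x. g x + t *\<^sub>R grad \<eta> x)" by (intro mod_int_add mod_int_scaleR g test_grad_mod \<eta>)
  have wb: "\<bar>w n x\<bar> \<le> bd + \<bar>t\<bar> * C" for n x
  proof -
    have "\<bar>t * \<eta> x\<bar> \<le> \<bar>t\<bar> * C" using C by (simp add: abs_mult mult_left_mono)
    then show ?thesis unfolding w_def using z(2)[of n x] by linarith
  qed
  have "(\<lambda>n. energy (w n)) \<longlonglongrightarrow> (LINT x|\<mu>. \<Phi> (norm (g x + t *\<^sub>R grad \<eta> x))) + (LINT x|\<mu>. low (u x + t * \<eta> x))"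
    unfolding energy_def
  proof (intro tendsto_add modular_continuous test_grad_mod w g')
    show "(\<lambda>n. LINT x|\<mu>. \<Phi> (norm (grad (w n) x - (g x + t *\<^sub>R grad \<eta> x)))) \<longlonglongrightarrow> 0"
      using g(2) by (simp add: gw)
    show "(\<lambda>n. LINT x|\<mu>. low (w n x)) \<longlonglongrightarrow> (LINT x|\<mu>. low (u x + t * \<eta> x))"
    proof (rule tendsto_integral_low[OF test_measurable[OF w] _ wb])
      show "(\<lambda>x. u x + t * \<eta> x) \<in> borel_measurable \<mu>" using u(1) test_measurable[OF \<eta>] by measurable
      show "AE x in \<mu>. (\<lambda>n. w n x) \<longlonglongrightarrow> u x + t * \<eta> x"
        using u(3) by (rule eventually_mono) (auto simp: w_def intro!: tendsto_intros)
    qed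
  qed
  then show ?thesis using m[OF w] by (intro LIMSEQ_le_const) auto
qed

definition power_term :: "real \<Rightarrow> real \<Rightarrow> real" where "power_term s x = \<bar>x\<bar> powr (s - 2) * x"

lemma abs_power_term_le: "s > 1 \<Longrightarrow> \<bar>x\<bar> \<le> B \<Longrightarrow> \<bar>power_term s x\<bar> \<le> B powr (s - 1)"
  by (simp add: power_term_def abs_powr_mult_self powr_mono2)

lemma power_term_borel: "s > 1 \<Longrightarrow> power_term s \<in> borel_measurable borel"
  unfolding power_term_def[abs_def] by (intro borel_measurable_continuous_onI continuous_on_powr_mult_self)

lemma power_term_measurable: "s > 1 \<Longrightarrow> f \<in> borel_measurable \<mu> \<Longrightarrow> (\<lambda>x. power_term s (f x)) \<in> borel_measurable \<mu>"
  using measurable_compose[OF _ power_term_borel] .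

lemma power_term_integrable:
  assumes "s > 1" "integrable \<mu> v"
  shows "integrable \<mu> (\<lambda>x. v x * power_term s (u x))"
  by (rule integrable_mult_bounded[OF assms(2) power_term_measurable[OF assms(1) u(1)] abs_power_term_le[OF assms(1) u(2)]])

text \<open>The direction and its gradient are separate arguments, so the functional is linear in
  the pair and can be followed along approximating test functions.\<close>

definition EL :: "(real^'n \<Rightarrow> real) \<Rightarrow> (real^'n \<Rightarrow> real^'n) \<Rightarrow> real" where
  "EL v h = (LINT x|\<mu>. flux (g x) \<bullet> h x) + (LINT x|\<mu>. v x * power_term r (u x)) - lam * (LINT x|\<mu>. v x * power_term p (u x))"

text \<open>Convexity inequalities take the place of differentiation under the integral. The
  subgradients are taken at the perturbed point for \<Phi> and the r-th power, but at
  \<open>u\<close> for the p-th power, which enters with a minus sign; thus every increment is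
  bounded above by \<open>t n\<close> times an integrable expression. Division by \<open>t n\<close>
  and a limit give the claim.\<close>

lemma EL_nonneg:
  assumes \<eta>: "\<eta> \<in> test_functions \<Omega>"
  shows "0 \<le> EL \<eta> (grad \<eta>)"
proof -
  define t where "t n = 1 / real (Suc n)" for n
  have t: "0 < t n" "t n \<le> 1" for n by (auto simp: t_def)
  have t0: "t \<longlonglongrightarrow> 0" unfolding t_def using LIMSEQ_Suc[OF lim_1_over_n[where 'a=real]] by simp
  obtain C where C: "\<And>x. \<bar>\<eta> x\<bar> \<le> C" using test_bounded[OF \<eta>] by blast
  note \<eta>m = test_measurable[OF \<eta>] and \<eta>g = test_grad_mod[OF \<eta>]
  define gn where "gn n x = g x + t n *\<^sub>R grad \<eta> x" for n x
  define un where "un n x = u x + t n * \<eta> x" for n x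
  have gn: "mod_int (gn n)" for n unfolding gn_def by (intro mod_int_add mod_int_scaleR g \<eta>g)
  have unm: "un n \<in> borel_measurable \<mu>" for n unfolding un_def using u(1) \<eta>m by measurable
  have unb: "\<bar>un n x\<bar> \<le> bd + C" for n x
  proof -
    have "\<bar>t n * \<eta> x\<bar> \<le> 1 * C" unfolding abs_mult using C[of x] t[of n] by (intro mult_mono) auto
    then show ?thesis unfolding un_def using u(2)[of x] by linarith
  qed
  have i\<eta>: "integrable \<mu> \<eta>" by (rule test_lebesgue_on(1)[OF \<eta> open_\<Omega>])
  have iA: "integrable \<mu> (\<lambda>x. flux (gn n x) \<bullet> grad \<eta> x)" for n by (rule integrable_flux_inner[OF gn \<eta>g])
  have iB: "integrable \<mu> (\<lambda>x. \<eta> x * power_term r (un n x))" for n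
    by (rule integrable_mult_bounded[OF i\<eta> power_term_measurable[OF r_gt_1 unm] abs_power_term_le[OF r_gt_1 unb]])
  have iC: "integrable \<mu> (\<lambda>x. \<eta> x * power_term p (u x))" by (rule power_term_integrable[OF p_gt_1 i\<eta>])
  define G where "G n = (LINT x|\<mu>. flux (gn n x) \<bullet> grad \<eta> x) + (LINT x|\<mu>. \<eta> x * power_term r (un n x))
     - lam * (LINT x|\<mu>. \<eta> x * power_term p (u x))" for n
  have "0 \<le> G n" for n
  proof -
    have i1: "integrable \<mu> (\<lambda>x. \<Phi> (norm (gn n x)))" "integrable \<mu> (\<lambda>x. \<Phi> (norm (g x)))"
      "integrable \<mu> (\<lambda>x. low (un n x))" "integrable \<mu> (\<lambda>x. low (u x))"
      using gn[of n] g(1) integrable_low[OF unm unb] integrable_low[OF u(1,2)] by (auto simp: mod_int_def)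
    have "0 \<le> (LINT x|\<mu>. \<Phi> (norm (gn n x))) + (LINT x|\<mu>. low (un n x)) - ((LINT x|\<mu>. \<Phi> (norm (g x))) + (LINT x|\<mu>. low (u x)))"
      using limit_minimal[OF \<eta>, of "t n"] limit_energy unfolding gn_def un_def by linarith
    also have "\<dots> = (LINT x|\<mu>. (\<Phi> (norm (gn n x)) - \<Phi> (norm (g x))) + (low (un n x) - low (u x)))"
      using i1 by simp
    also have "\<dots> \<le> (LINT x|\<mu>. t n * (flux (gn n x) \<bullet> grad \<eta> x + \<eta> x * power_term r (un n x) - lam * (\<eta> x * power_term p (u x))))"
    proof (rule integral_mono)
      fix x
      have "\<Phi> (norm (gn n x)) - \<Phi> (norm (g x)) \<le> t n * (flux (gn n x) \<bullet> grad \<eta> x)"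
        using Phi_gradient_ineq[of "gn n x" "g x"] by (simp add: gn_def inner_diff_right)
      moreover have "\<bar>un n x\<bar> powr r / r - \<bar>u x\<bar> powr r / r \<le> t n * (\<eta> x * power_term r (un n x))"
        using powr_gradient_ineq[OF r_gt_1, of "un n x" "u x"] by (simp add: un_def power_term_def algebra_simps)
      moreover have "lam * (t n * (\<eta> x * power_term p (u x))) \<le> lam * (\<bar>un n x\<bar> powr p / p - \<bar>u x\<bar> powr p / p)"
        using powr_gradient_ineq[OF p_gt_1, of "u x" "un n x"] lam_pos
        by (intro mult_left_mono) (auto simp: un_def power_term_def algebra_simps)
      ultimately show "(\<Phi> (norm (gn n x)) - \<Phi> (norm (g x))) + (low (un n x) - low (u x))
        \<le> t n * (flux (gn n x) \<bullet> grad \<eta> x + \<eta> x * power_term r (un n x) - lam * (\<eta> x * power_term p (u x)))"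
        unfolding low_def by (simp only: algebra_simps)
    qed (use i1 iA iB iC in auto)
    also have "\<dots> = t n * G n" unfolding G_def using iA iB iC by simp
    finally show ?thesis using t[of n] by (simp add: zero_le_mult_iff)
  qed
  moreover have "G \<longlonglongrightarrow> EL \<eta> (grad \<eta>)"
    unfolding G_def EL_def
  proof (intro tendsto_add tendsto_diff tendsto_const)
    show "(\<lambda>n. LINT x|\<mu>. flux (gn n x) \<bullet> grad \<eta> x) \<longlonglongrightarrow> (LINT x|\<mu>. flux (g x) \<bullet> grad \<eta> x)"
    \<comment> \<open>The outer factor is Young's inequality with \<open>e = 1\<close>; the inner
      one bounds \<open>\<Phi> (norm (gn n x))\<close> by the quasi-triangle inequality, using
      \<open>t n \<le> 1\<close>.\<close>
    proof (rule integral_dominated_convergence[where w = "\<lambda>x. 2 powr (p + q) * (2 powr (p + q) * (\<Phi> (norm (g x)) + \<Phi> (norm (grad \<eta> x))) + \<Phi> (norm (grad \<eta> x)))"])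
      show "AE x in \<mu>. (\<lambda>n. flux (gn n x) \<bullet> grad \<eta> x) \<longlonglongrightarrow> flux (g x) \<bullet> grad \<eta> x"
      proof (intro AE_I2 tendsto_inner tendsto_const)
        fix x
        have "(\<lambda>n. gn n x) \<longlonglongrightarrow> g x + 0 *\<^sub>R grad \<eta> x" unfolding gn_def by (intro tendsto_intros t0)
        then show "(\<lambda>n. flux (gn n x)) \<longlonglongrightarrow> flux (g x)"
          using continuous_on_tendsto_compose[OF continuous_on_flux] by simp
      qed
      show "AE x in \<mu>. norm (flux (gn n x) \<bullet> grad \<eta> x) \<le> 2 powr (p + q) * (2 powr (p + q) * (\<Phi> (norm (g x)) + \<Phi> (norm (grad \<eta> x))) + \<Phi> (norm (grad \<eta> x)))" for n
      proof (intro AE_I2)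
        fix x
        have "\<Phi> (norm (t n *\<^sub>R grad \<eta> x)) \<le> \<Phi> (norm (grad \<eta> x))"
          using t[of n] by (intro Phi_mono) (auto simp: mult_left_le_one_le)
        then have "2 powr (p + q) * (\<Phi> (norm (g x)) + \<Phi> (norm (t n *\<^sub>R grad \<eta> x))) \<le> 2 powr (p + q) * (\<Phi> (norm (g x)) + \<Phi> (norm (grad \<eta> x)))"
          by (intro mult_left_mono) auto
        then have "\<Phi> (norm (gn n x)) \<le> 2 powr (p + q) * (\<Phi> (norm (g x)) + \<Phi> (norm (grad \<eta> x)))"
          using Phi_norm_add_le[of "g x" "t n *\<^sub>R grad \<eta> x"] unfolding gn_def by linarith
        then have "2 powr (p + q) * (\<Phi> (norm (gn n x)) + \<Phi> (norm (grad \<eta> x)))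
          \<le> 2 powr (p + q) * (2 powr (p + q) * (\<Phi> (norm (g x)) + \<Phi> (norm (grad \<eta> x))) + \<Phi> (norm (grad \<eta> x)))"
          by (intro mult_left_mono) auto
        then show "norm (flux (gn n x) \<bullet> grad \<eta> x) \<le> 2 powr (p + q) * (2 powr (p + q) * (\<Phi> (norm (g x)) + \<Phi> (norm (grad \<eta> x))) + \<Phi> (norm (grad \<eta> x)))"
        proof -
          assume a: "2 powr (p + q) * (\<Phi> (norm (gn n x)) + \<Phi> (norm (grad \<eta> x)))
            \<le> 2 powr (p + q) * (2 powr (p + q) * (\<Phi> (norm (g x)) + \<Phi> (norm (grad \<eta> x))) + \<Phi> (norm (grad \<eta> x)))"
          have "\<bar>flux (gn n x) \<bullet> grad \<eta> x\<bar> \<le> 2 powr (p + q) * (\<Phi> (norm (gn n x)) + \<Phi> (norm (grad \<eta> x)))"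
            using flux_inner_le[of 1 "gn n x" "grad \<eta> x"] by simp
          from order_trans[OF this a] show ?thesis by (simp only: real_norm_def)
        qed
      qed
    qed (use iA integrable_flux_inner[OF g(1) \<eta>g] g \<eta>g in \<open>auto simp: mod_int_def\<close>)
    show "(\<lambda>n. LINT x|\<mu>. \<eta> x * power_term r (un n x)) \<longlonglongrightarrow> (LINT x|\<mu>. \<eta> x * power_term r (u x))"
    proof (rule integral_dominated_convergence[where w = "\<lambda>x. C * (bd + C) powr (r - 1)"])
      show "AE x in \<mu>. (\<lambda>n. \<eta> x * power_term r (un n x)) \<longlonglongrightarrow> \<eta> x * power_term r (u x)"
      proof (intro AE_I2 tendsto_mult tendsto_const)
        fix x
        have "(\<lambda>n. un n x) \<longlonglongrightarrow> u x + 0 * \<eta> x" unfolding un_def by (intro tendsto_intros t0)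
        then show "(\<lambda>n. power_term r (un n x)) \<longlonglongrightarrow> power_term r (u x)"
          using continuous_on_tendsto_compose[OF continuous_on_powr_mult_self[OF r_gt_1]] unfolding power_term_def by simp
      qed
      show "AE x in \<mu>. norm (\<eta> x * power_term r (un n x)) \<le> C * (bd + C) powr (r - 1)" for n
        using C abs_power_term_le[OF r_gt_1 unb] order_trans[OF abs_ge_zero C]
        by (intro AE_I2) (auto simp: abs_mult intro!: mult_mono)
    qed (use iB power_term_integrable[OF r_gt_1 i\<eta>] in auto)
  qed
  ultimately show ?thesis by (intro LIMSEQ_le_const) auto
qed

lemma EL_test: "\<eta> \<in> test_functions \<Omega> \<Longrightarrow> EL \<eta> (grad \<eta>) = 0"
proof -
  assume \<eta>: "\<eta> \<in> test_functions \<Omega>"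
  have "0 \<le> EL (\<lambda>x. (-1) * \<eta> x) (grad (\<lambda>x. (-1) * \<eta> x))" by (rule EL_nonneg[OF test_cmult[OF \<eta>]])
  also have "grad (\<lambda>x. (-1) * \<eta> x) = (\<lambda>x. - grad \<eta> x)"
    using grad_cmult[OF test_smooth[OF \<eta>], of "-1"] by auto
  also have "EL (\<lambda>x. (-1) * \<eta> x) (\<lambda>x. - grad \<eta> x) = - EL \<eta> (grad \<eta>)"
    by (simp add: EL_def)
  finally show ?thesis using EL_nonneg[OF \<eta>] by simp
qed

text \<open>Since \<open>u\<close> is bounded, the power terms act as bounded weights, for which
  \<open>L^1\<close> convergence of the directions suffices; the flux term follows the gradients in
  the modular.\<close>

lemma EL_limit:
  assumes v: "mod_int v" and h: "mod_int h" and \<psi>: "\<And>n. \<psi> n \<in> test_functions \<Omega>"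
    and lim: "(\<lambda>n. LINT x|\<mu>. \<Phi> (norm (v x - \<psi> n x))) \<longlonglongrightarrow> 0"
      "(\<lambda>n. LINT x|\<mu>. \<Phi> (norm (grad (\<psi> n) x - h x))) \<longlonglongrightarrow> 0"
  shows "EL v h = 0"
proof -
  have i\<psi>: "integrable \<mu> (\<psi> n)" for n by (rule test_lebesgue_on(1)[OF \<psi> open_\<Omega>])
  have "mod_int (\<psi> n)" for n
    using test_bounded[OF \<psi>] by (metis mod_int_bounded[OF test_measurable[OF \<psi>]] AE_I2 real_norm_def)
  then have "(\<lambda>n. LINT x|\<mu>. norm (v x - \<psi> n x)) \<longlonglongrightarrow> 0"
    using lim(1) by (intro modular_small_integral mod_int_diff[OF v])
  then have l1: "(\<lambda>n. LINT x|\<mu>. \<bar>\<psi> n x - v x\<bar>) \<longlonglongrightarrow> 0" by (simp add: abs_minus_commute)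
  have pt: "(\<lambda>n. LINT x|\<mu>. \<psi> n x * power_term s (u x)) \<longlonglongrightarrow> (LINT x|\<mu>. v x * power_term s (u x))" if "s > 1" for s
    by (rule tendsto_integral_mult_bounded[OF i\<psi> mod_int_integrable[OF v] l1
          power_term_measurable[OF that u(1)] abs_power_term_le[OF that u(2)]])
  have "(\<lambda>n. EL (\<psi> n) (grad (\<psi> n))) \<longlonglongrightarrow> EL v h"
    unfolding EL_def
    by (intro tendsto_add tendsto_diff tendsto_mult tendsto_const pt r_gt_1 p_gt_1
        flux_inner_tendsto[OF g(1) test_grad_mod[OF \<psi>] h lim(2)])
  then show ?thesis by (simp add: EL_test[OF \<psi>] LIMSEQ_const_iff)
qed

lemma limit_weak_partial: "has_weak_partial \<Omega> i u (\<lambda>x. g x $ i)"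
proof (rule has_weak_partial_limit[OF z(1) open_\<Omega>])
  have mu: "mod_int u" using u by (intro mod_int_bounded[where C = bd]) auto
  show iu: "integrable \<mu> u" by (rule mod_int_integrable[OF mu])
  show ig: "integrable \<mu> (\<lambda>x. g x $ i)" by (rule mod_int_integrable[OF mod_int_nth[OF g(1)]])
  have "(\<lambda>n. LINT x|\<mu>. \<bar>z n x - u x\<bar>) \<longlonglongrightarrow> (LINT x|\<mu>. 0)"
  proof (rule integral_dominated_convergence[where w = "\<lambda>x. 2 * bd"])
    show "AE x in \<mu>. (\<lambda>n. \<bar>z n x - u x\<bar>) \<longlonglongrightarrow> 0"
      using u(3) by (rule eventually_mono) (auto intro: tendsto_rabs_zero simp: LIM_zero_iff)
    show "AE x in \<mu>. norm \<bar>z n x - u x\<bar> \<le> 2 * bd" for n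
    proof (intro AE_I2)
      fix x show "norm \<bar>z n x - u x\<bar> \<le> 2 * bd" using z(2)[of n x] u(2)[of x] by simp
    qed
    show "(\<lambda>x. \<bar>z n x - u x\<bar>) \<in> borel_measurable \<mu>" for n using test_measurable[OF z(1)[of n]] u(1) by measurable
  qed auto
  then show "(\<lambda>n. LINT x|\<mu>. \<bar>z n x - u x\<bar>) \<longlonglongrightarrow> 0" by simp
  have md: "mod_int (\<lambda>x. grad (z n) x - g x)" for n by (intro mod_int_diff test_grad_mod z g)
  have l: "(\<lambda>n. LINT x|\<mu>. norm (grad (z n) x - g x)) \<longlonglongrightarrow> 0" by (rule modular_small_integral[OF md g(2)])
  show "(\<lambda>n. LINT x|\<mu>. \<bar>partial i (z n) x - g x $ i\<bar>) \<longlonglongrightarrow> 0"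
  proof (rule tendsto_sandwich[OF _ _ tendsto_const l])
    have "(LINT x|\<mu>. \<bar>partial i (z n) x - g x $ i\<bar>) \<le> (LINT x|\<mu>. norm (grad (z n) x - g x))" for n
    proof (rule integral_mono)
      show "integrable \<mu> (\<lambda>x. \<bar>partial i (z n) x - g x $ i\<bar>)"
        using ig test_lebesgue_on(1)[OF test_partial[OF z(1)] open_\<Omega>] by auto
      show "integrable \<mu> (\<lambda>x. norm (grad (z n) x - g x))" using mod_int_integrable[OF md] by auto
      show "\<bar>partial i (z n) x - g x $ i\<bar> \<le> norm (grad (z n) x - g x)" for x
        using component_le_norm_cart[of "grad (z n) x - g x" i] by simp
    qed
    then show "\<forall>\<^sub>F n in sequentially. (LINT x|\<mu>. \<bar>partial i (z n) x - g x $ i\<bar>) \<le> (LINT x|\<mu>. norm (grad (z n) x - g x))"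
      by (intro always_eventually) auto
  qed auto
qed

lemma limit_sobolev0: "u \<in> orlicz_sobolev0 \<Phi> \<Omega>"
proof (rule sobolev0I[OF _ g(1) limit_weak_partial z(1)])
  show mu: "mod_int u" using u by (intro mod_int_bounded[where C = bd]) auto
  have b: "\<bar>u x - z n x\<bar> \<le> 2 * bd" for n x using z(2)[of n x] u(2)[of x] by linarith
  have ms: "(\<lambda>x. u x - z n x) \<in> borel_measurable \<mu>" for n using test_measurable[OF z(1)[of n]] u(1) by measurable
  show "mod_int (\<lambda>x. u x - z n x)" for n using b ms by (intro mod_int_bounded[where C = "2 * bd"]) auto
  show "mod_int (\<lambda>x. g x - grad (z n) x)" for n by (intro mod_int_diff test_grad_mod z g)
  have "AE x in \<mu>. (\<lambda>n. u x - z n x) \<longlonglongrightarrow> 0"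
    using u(3)
  proof (rule eventually_mono)
    fix x assume "(\<lambda>n. z n x) \<longlonglongrightarrow> u x"
    from tendsto_diff[OF tendsto_const this, of "u x"] show "(\<lambda>n. u x - z n x) \<longlonglongrightarrow> 0" by simp
  qed
  from tendsto_modular_bounded[OF ms b this] show "(\<lambda>n. LINT x|\<mu>. \<Phi> (norm (u x - z n x))) \<longlonglongrightarrow> 0" by simp
  show "(\<lambda>n. LINT x|\<mu>. \<Phi> (norm (g x - grad (z n) x))) \<longlonglongrightarrow> 0" using g(2) by (simp add: norm_minus_commute)
qed

lemma limit_weak_solution: "weak_solution p q r lam \<Omega> u"
  unfolding weak_solution_def Let_def
proof (intro conjI ballI limit_sobolev0)
  fix v assume "v \<in> orlicz_sobolev0 \<Phi> \<Omega>"
  then obtain h \<psi> where v: "mod_int v" "mod_int h" "AE x in \<mu>. weak_grad \<Omega> v x = h x"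
    and \<psi>: "\<And>n. \<psi> n \<in> test_functions \<Omega>" "(\<lambda>n. LINT x|\<mu>. \<Phi> (norm (v x - \<psi> n x))) \<longlonglongrightarrow> 0"
      "(\<lambda>n. LINT x|\<mu>. \<Phi> (norm (grad (\<psi> n) x - h x))) \<longlonglongrightarrow> 0"
    using sobolev0_approx by blast
  let ?A = "\<lambda>x. (ln (1 + norm (weak_grad \<Omega> u x) powr q) * norm (weak_grad \<Omega> u x) powr (p - 2)) *\<^sub>R weak_grad \<Omega> u x \<bullet> weak_grad \<Omega> v x"
  have i0: "integrable \<mu> (\<lambda>x. flux (g x) \<bullet> h x)" by (rule integrable_flux_inner[OF g(1) v(2)])
  have ae: "AE x in \<mu>. flux (g x) \<bullet> h x = ?A x"
    using v(3) weak_grad_AE[OF limit_weak_partial open_\<Omega>] by eventually_elim (simp add: flux_def)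
  have mA: "?A \<in> borel_measurable \<mu>" by (rule measurable_AE_eq[OF borel_measurable_integrable[OF i0] ae])
  show iA: "integrable \<mu> ?A" using integrable_cong_AE_imp[OF i0 mA] ae by (auto elim: eventually_mono)
  have eqA: "(LINT x|\<mu>. ?A x) = (LINT x|\<mu>. flux (g x) \<bullet> h x)"
    using ae by (intro integral_cong_AE mA borel_measurable_integrable[OF i0]) (auto elim: eventually_mono)
  have pt: "(\<lambda>x. \<bar>u x\<bar> powr (s - 2) * u x * v x) = (\<lambda>x. v x * power_term s (u x))" for s
    by (simp add: power_term_def mult_ac)
  have iv: "integrable \<mu> v" by (rule mod_int_integrable[OF v(1)])
  show "integrable \<mu> (\<lambda>x. \<bar>u x\<bar> powr (p - 2) * u x * v x)" "integrable \<mu> (\<lambda>x. \<bar>u x\<bar> powr (r - 2) * u x * v x)"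
    unfolding pt by (intro power_term_integrable p_gt_1 r_gt_1 iv)+
  show "(LINT x|\<mu>. ?A x) - lam * (LINT x|\<mu>. \<bar>u x\<bar> powr (p - 2) * u x * v x) + (LINT x|\<mu>. \<bar>u x\<bar> powr (r - 2) * u x * v x) = 0"
    using EL_limit[OF v(1,2) \<psi>] unfolding pt eqA EL_def by simp
qed

text \<open>For \<open>u = 0\<close> the minimal value would reduce to an integral of \<Phi>, which
  is nonnegative.\<close>

lemma limit_nontrivial:
  assumes "m < 0"
  shows "\<not> (AE x in \<mu>. u x = 0)"
proof
  assume "AE x in \<mu>. u x = 0"
  then have "(LINT x|\<mu>. low (u x)) = (LINT x|\<mu>. 0)"
    using u(1) by (intro integral_cong_AE) (auto elim!: eventually_mono)
  moreover have "0 \<le> (LINT x|\<mu>. \<Phi> (norm (g x)))" by simp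
  ultimately show False using limit_energy assms by simp
qed

end

lemma nontrivial_weak_solution_exists:
  assumes "\<psi> \<in> test_functions \<Omega>" "energy \<psi> < 0"
  shows "\<exists>u. weak_solution p q r lam \<Omega> u \<and> \<not> (AE x in \<mu>. u x = 0)"
proof -
  obtain m z u g where *: "\<And>\<psi>. \<psi> \<in> test_functions \<Omega> \<Longrightarrow> m \<le> energy \<psi>"
    "\<And>n. z n \<in> test_functions \<Omega>" "\<And>n x. \<bar>z n x\<bar> \<le> bd" "(\<lambda>n. energy (z n)) \<longlonglongrightarrow> m"
    "u \<in> borel_measurable \<mu>" "\<And>x. \<bar>u x\<bar> \<le> bd" "AE x in \<mu>. (\<lambda>n. z n x) \<longlonglongrightarrow> u x"
    "mod_int g" "(\<lambda>n. LINT x|\<mu>. \<Phi> (norm (grad (z n) x - g x))) \<longlonglongrightarrow> 0"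
    using minimizing_limit by blast
  have "m < 0" using *(1)[OF assms(1)] assms(2) by simp
  then show ?thesis using limit_weak_solution[OF *] limit_nontrivial[OF *] by blast
qed

end

section \<open>A test function with negative energy for large \<open>lam\<close>\<close>

lemma test_function_nontrivial:
  fixes \<Omega> :: "(real^'n::finite) set"
  assumes "open \<Omega>" "\<Omega> \<noteq> {}"
  shows "\<exists>\<psi>\<in>test_functions \<Omega>. \<exists>x\<in>\<Omega>. \<psi> x \<noteq> 0"
proof -
  obtain x where x: "x \<in> \<Omega>" using assms by blast
  obtain e where e: "e > 0" "cball x e \<subseteq> \<Omega>" using assms(1) x open_contains_cball by blast
  obtain a b where "x \<in> box a b" "box a b \<subseteq> ball x e" using rational_boxes[OF e(1), of x] by blast
  moreover from this have "cbox a b \<subseteq> cball x e"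
  proof -
    assume "x \<in> box a b" "box a b \<subseteq> ball x e"
    then have "closure (box a b) \<subseteq> cball x e" "box a b \<noteq> {}"
      using closure_minimal[OF order_trans[OF _ ball_subset_cball] closed_cball, of "box a b" x e] by blast+
    then show ?thesis using closure_box[of a b] by metis
  qed
  ultimately have ab: "x \<in> box a b" "cbox a b \<subseteq> \<Omega>" using e by auto
  then show ?thesis using box_bump_test[OF ab(2)] box_bump_pos_iff[of a b x] x by blast
qed

lemma (in orlicz_domain) integral_powr_test_pos:
  assumes \<psi>: "\<psi> \<in> test_functions \<Omega>" "x0 \<in> \<Omega>" "\<psi> x0 \<noteq> 0" and "s > 0"
  shows "integrable \<mu> (\<lambda>x. \<bar>\<psi> x\<bar> powr s)" "0 < (LINT x|\<mu>. \<bar>\<psi> x\<bar> powr s)"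
proof -
  have c: "continuous_on UNIV (\<lambda>x. \<bar>\<psi> x\<bar> powr s)"
    using assms(4) smooth_continuous[OF test_smooth[OF \<psi>(1)]] by (intro continuous_on_powr' continuous_intros) auto
  obtain C where C: "\<And>x. \<bar>\<psi> x\<bar> \<le> C" using test_bounded[OF \<psi>(1)] by blast
  show i: "integrable \<mu> (\<lambda>x. \<bar>\<psi> x\<bar> powr s)"
    using C assms(4) by (intro integrable_const_bound[where B = "C powr s"] continuous_\<mu>[OF c] AE_I2) (auto intro: powr_mono2)
  show "0 < (LINT x|\<mu>. \<bar>\<psi> x\<bar> powr s)"
  proof (rule ccontr)
    assume "\<not> ?thesis"
    moreover have "0 \<le> (LINT x|\<mu>. \<bar>\<psi> x\<bar> powr s)" by simp
    ultimately have "(LINT x|\<mu>. \<bar>\<psi> x\<bar> powr s) = 0" by linarith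
    then have "AE x in \<mu>. \<bar>\<psi> x\<bar> powr s = 0" using integral_nonneg_eq_0_iff_AE[OF i] by simp
    then have "AE x in lebesgue. x \<in> \<Omega> \<longrightarrow> \<psi> x = 0" using open_\<Omega> by (subst (asm) AE_restrict_space_iff) auto
    moreover have "open (\<Omega> \<inter> {x. \<psi> x \<noteq> 0})"
      using smooth_continuous[OF test_smooth[OF \<psi>(1)]] open_\<Omega>
      by (intro open_Int open_Collect_neq continuous_intros)
    moreover have "x0 \<in> \<Omega> \<inter> {x. \<psi> x \<noteq> 0}" using \<psi> by simp
    ultimately have "x0 \<in> {}"
      by (intro mem_closed_if_AE_lebesgue_open[of "\<Omega> \<inter> {x. \<psi> x \<noteq> 0}" "{}"]) (auto elim!: eventually_mono)
    then show False by simp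
  qed
qed

theorem theorem2:
  fixes \<Omega> :: "(real^'n::finite) set" and p q r :: real
  assumes "CARD('n) \<ge> 3"
    and "open \<Omega>" and "connected \<Omega>" and "\<Omega> \<noteq> {}" and "bounded \<Omega>" and "smooth_boundary \<Omega>"
    and "p > 1" and "q > 1"
    and "p + q < real CARD('n)" and "p + q < r" and "r < (real CARD('n) * p - real CARD('n) + p) / (real CARD('n) - p)"
  shows "\<exists>lam_star>0. \<forall>lam\<ge>lam_star. \<exists>u.
           weak_solution p q r lam \<Omega> u \<and> \<not> (AE x in lebesgue_on \<Omega>. u x = 0)"
proof -
  interpret orlicz_domain p q \<Omega> using assms by unfold_locales auto
  obtain \<psi> x0 where \<psi>: "\<psi> \<in> test_functions \<Omega>" "x0 \<in> \<Omega>" "\<psi> x0 \<noteq> 0"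
    using test_function_nontrivial[OF assms(2,4)] by blast
  define P where "P = (LINT x|\<mu>. \<bar>\<psi> x\<bar> powr p)"
  define R where "R = (LINT x|\<mu>. \<Phi> (norm (grad \<psi> x))) + (LINT x|\<mu>. \<bar>\<psi> x\<bar> powr r) / r"
  have r: "r > 1" "r > p" using assms by auto
  have P: "P > 0" unfolding P_def using integral_powr_test_pos[OF \<psi>] assms by simp
  have ip: "integrable \<mu> (\<lambda>x. \<bar>\<psi> x\<bar> powr p)" "integrable \<mu> (\<lambda>x. \<bar>\<psi> x\<bar> powr r)"
    using integral_powr_test_pos(1)[OF \<psi>] assms r by auto
  have R: "R \<ge> 0" unfolding R_def using r by simp
  \<comment> \<open>Solves \<open>lam_star * (P / p) = R + 1\<close>; as the energy of \<psi> is
    \<open>R - lam * (P / p)\<close>, it is at most -1 from there on.\<close>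
  define lam_star where "lam_star = p * (R + 1) / P"
  have "\<exists>u. weak_solution p q r lam \<Omega> u \<and> \<not> (AE x in \<mu>. u x = 0)" if lam: "lam \<ge> lam_star" for lam
  proof -
    have ls: "0 < lam_star" using R P assms by (simp add: lam_star_def)
    interpret variational_problem p q \<Omega> r lam by unfold_locales (use r lam ls in auto)
    have "energy \<psi> = R - lam * (P / p)"
      unfolding energy_def R_def P_def low_def using ip by simp
    moreover have "R + 1 \<le> lam * (P / p)"
    proof -
      have "lam_star * (P / p) \<le> lam * (P / p)" using lam P assms by (intro mult_right_mono) auto
      moreover have "lam_star * (P / p) = R + 1" using P assms by (simp add: lam_star_def)
      ultimately show ?thesis by simp
    qed
    ultimately have "energy \<psi> < 0" by linarith
    then show ?thesis using nontrivial_weak_solution_exists[OF \<psi>(1)] by blast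
  qed
  moreover have "lam_star > 0" using R P assms by (simp add: lam_star_def)
  ultimately show ?thesis by blast
qed

end
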